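(* Let $(M,g,J)$, $\dim M=2n\ge6$, be a Bochner-Kähler manifold with $d\tau\ne0$ (at every point). If the scalar distribution $D_\tau$ is a $B_0$-distribution, then $(M,g,J,D_\tau)$ is of quasi-constant holomorphic sectional curvatures and $$R=a\pi+b\Phi,\qquad b\neq0 .$$
   Context: **Conventions.** $(M,g,J)$ is Kähler of real dimension $2n$, $\nabla$ the Levi-Civita connection, $R(X,Y)Z=\nabla_X\nabla_YZ-\nabla_Y\nabla_XZ-\nabla_{[X,Y]}Z$, $R(X,Y,Z,U)=g(R(X,Y)Z,U)$, $\rho(Y,Z)=\sum_iR(e_i,Y,Z,e_i)$, $\tau=\sum_i\rho(e_i,e_i)$ for an orthonormal basis of $T_mM$. **Bochner-Kähler.** In a complex basis $Z_\alpha$ of $T^{1,0}M$ (with $Z_{\bar\alpha}=\overline{Z_\alpha}$): $$R_{\alpha\bar\beta\gamma\bar\delta}=\frac1{n+2}(g_{\alpha\bar\beta}\rho_{\gamma\bar\delta}+g_{\gamma\bar\beta}\rho_{\alpha\bar\delta}+g_{\gamma\bar\delta}\rho_{\alpha\bar\beta}+g_{\alpha\bar\delta}\rho_{\gamma\bar\beta})-\frac{\tau}{2(n+1)(n+2)}(g_{\alpha\bar\beta}g_{\gamma\bar\delta}+g_{\gamma\bar\beta}g_{\alpha\bar\delta}).$$ **Scalar distribution, $B_0$.** With $\xi=\mathrm{grad}\,\tau/\|d\tau\|$, the scalar distribution $D_\tau$ is the orthogonal complement of $\mathrm{span}\{\xi,J\xi\}$. It is a $B_0$-distribution if there are functions $k$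 (nowhere zero) and $p^*$ such that $\nabla_{x_0}\xi=\frac k2x_0$ for $x_0\in D_\tau$, $\nabla_{J\xi}\xi=-p^*J\xi$, $\nabla_\xi\xi=0$. **Quasi-constant holomorphic sectional curvatures.** $(M,g,J,D)$, with $D$ a $J$-invariant distribution of real codimension $2$, has this property if the sectional curvature of each holomorphic section $E(m)$ depends only on $m$ and the angle between $E(m)$ and $D^\perp(m)$. **Tensors and functions.** $\eta(X)=g(X,\xi)$, $\tilde\eta(X)=g(X,J\xi)$, $$4\pi(X,Y)Z=g(Y,Z)X-g(X,Z)Y-2g(JX,Y)JZ+g(JY,Z)JX-g(JX,Z)JY,$$ $$\begin{aligned}8\Phi(X,Y)Z={}&g(Y,Z)(\eta(X)\xi+\tilde\eta(X)J\xi)-g(X,Z)(\eta(Y)\xi+\tilde\eta(Y)J\xi)\\&+g(JY,Z)(\eta(X)J\xi-\tilde\eta(X)\xi)-g(JX,Z)(\eta(Y)J\xi-\tilde\eta(Y)\xi)\\&-2g(JX,Y)(\eta(Z)J\xi-\tilde\eta(Z)\xi)\\&+(\eta(Y)\eta(Z)+\tilde\eta(Y)\tilde\eta(Z))X-(\eta(X)\eta(Z)+\tilde\eta(X)\tilde\eta(Z))Y\\&+(\eta(Y)\tilde\eta(Z)-\tilde\eta(Y)\eta(Z))JX-(\eta(X)\tilde\eta(Z)-\tilde\eta(X)\eta(Z))JY\\&-2(\eta(X)\tilde\eta(Y)-\tilde\eta(X)\eta(Y))JZ.\end{aligned}$$ With $\varkappa=R(\xi,J\xi,J\xi,\xi)$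 and $\sigma=\rho(\xi,\xi)$, $$a=\frac{\tau-4\sigma+2\varkappa}{n(n-1)},\qquad b=\frac{-2\tau+4(n+2)\sigma-4(n+1)\varkappa}{n(n-1)} .$$ *)

theory Defs
  imports "HOL-Analysis.Analysis"
begin

section \<open>Smooth manifolds and tensor fields by local expressions\<close>

text \<open>
  A manifold modelled on \<^typ>\<open>'e::euclidean_space\<close> is a topological space with a smooth atlas.
  A chart is a pair of its domain and its coordinate map (only relevant on the domain).
  A geometric object on the manifold is the family, indexed by the charts, of its local
  expressions; these are functions of the coordinate point \<open>x\<close> (only relevant on the open image
  of the chart), and tangent vectors are represented by their coordinate components, elements
  of \<^typ>\<open>'e::euclidean_space\<close>. Objects given as data satisfy the usual transformation laws.
\<close>

primrec cont_diff_on :: "'a::real_normed_vector set \<Rightarrow> ('a \<Rightarrow> 'b::real_normed_vector) \<Rightarrow> nat \<Rightarrow> bool"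
  where
  "cont_diff_on S f 0 \<longleftrightarrow> continuous_on S f"
| "cont_diff_on S f (Suc k) \<longleftrightarrow>
     (\<forall>x\<in>S. f differentiable (at x)) \<and>
     (\<forall>v. cont_diff_on S (\<lambda>x. frechet_derivative f (at x) v) k)"

text \<open>Only used for open sets \<open>S\<close>.\<close>

definition smooth_on :: "'a::real_normed_vector set \<Rightarrow> ('a \<Rightarrow> 'b::real_normed_vector) \<Rightarrow> bool" where
  "smooth_on S f \<longleftrightarrow> (\<forall>k. cont_diff_on S f k)"

type_synonym ('m, 'e) chart = "'m set \<times> ('m \<Rightarrow> 'e)"

definition chart_image :: "('m, 'e) chart \<Rightarrow> 'e set" where
  "chart_image c = snd c ` fst c"

definition chart_inv :: "('m, 'e) chart \<Rightarrow> 'e \<Rightarrow> 'm" where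
  "chart_inv c = inv_into (fst c) (snd c)"

definition overlap :: "('m, 'e) chart \<Rightarrow> ('m, 'e) chart \<Rightarrow> 'e set" where
  "overlap c d = snd c ` (fst c \<inter> fst d)"

definition transition :: "('m, 'e) chart \<Rightarrow> ('m, 'e) chart \<Rightarrow> 'e \<Rightarrow> 'e" where
  "transition c d = snd d \<circ> chart_inv c"

definition dtransition ::
    "('m, 'e::euclidean_space) chart \<Rightarrow> ('m, 'e) chart \<Rightarrow> 'e \<Rightarrow> 'e \<Rightarrow> 'e" where
  "dtransition c d x = frechet_derivative (transition c d) (at x)"

definition smooth_manifold :: "'m topology \<Rightarrow> ('m, 'e::euclidean_space) chart set \<Rightarrow> bool" where
  "smooth_manifold T A \<longleftrightarrow>
     Hausdorff_space T \<and> second_countable T \<and> topspace T = (\<Union>c\<in>A. fst c) \<and>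
     (\<forall>c\<in>A. openin T (fst c) \<and> open (chart_image c) \<and>
        homeomorphic_map (subtopology T (fst c)) (top_of_set (chart_image c)) (snd c)) \<and>
     (\<forall>c\<in>A. \<forall>d\<in>A. smooth_on (overlap c d) (transition c d))"

definition riemannian_metric ::
    "('m, 'e::euclidean_space) chart set \<Rightarrow>
     (('m, 'e) chart \<Rightarrow> 'e \<Rightarrow> 'e \<Rightarrow> 'e \<Rightarrow> real) \<Rightarrow> bool" where
  "riemannian_metric A g \<longleftrightarrow>
     (\<forall>c\<in>A. (\<forall>u v. smooth_on (chart_image c) (\<lambda>x. g c x u v)) \<and>
        (\<forall>x\<in>chart_image c. bilinear (g c x) \<and> (\<forall>u v. g c x u v = g c x v u) \<and>
           (\<forall>u. u \<noteq> 0 \<longrightarrow> g c x u u > 0))) \<and>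
     (\<forall>c\<in>A. \<forall>d\<in>A. \<forall>x\<in>overlap c d. \<forall>u v.
        g d (transition c d x) (dtransition c d x u) (dtransition c d x v) = g c x u v)"

definition almost_complex ::
    "('m, 'e::euclidean_space) chart set \<Rightarrow> (('m, 'e) chart \<Rightarrow> 'e \<Rightarrow> 'e \<Rightarrow> 'e) \<Rightarrow> bool" where
  "almost_complex A J \<longleftrightarrow>
     (\<forall>c\<in>A. (\<forall>u. smooth_on (chart_image c) (\<lambda>x. J c x u)) \<and>
        (\<forall>x\<in>chart_image c. linear (J c x) \<and> (\<forall>u. J c x (J c x u) = - u))) \<and>
     (\<forall>c\<in>A. \<forall>d\<in>A. \<forall>x\<in>overlap c d. \<forall>u.
        J d (transition c d x) (dtransition c d x u) = dtransition c d x (J c x u))"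

text \<open>
  An affine connection is given by its Christoffel symbols \<open>\<Gamma> c x\<close>, regarded as bilinear maps;
  the transformation law says that the covariant derivative of a vector field transforms as a
  vector field.
\<close>

definition affine_connection ::
    "('m, 'e::euclidean_space) chart set \<Rightarrow>
     (('m, 'e) chart \<Rightarrow> 'e \<Rightarrow> 'e \<Rightarrow> 'e \<Rightarrow> 'e) \<Rightarrow> bool" where
  "affine_connection A \<Gamma> \<longleftrightarrow>
     (\<forall>c\<in>A. (\<forall>u v. smooth_on (chart_image c) (\<lambda>x. \<Gamma> c x u v)) \<and>
        (\<forall>x\<in>chart_image c. bilinear (\<Gamma> c x))) \<and>
     (\<forall>c\<in>A. \<forall>d\<in>A. \<forall>x\<in>overlap c d. \<forall>u v.
        dtransition c d x (\<Gamma> c x u v) =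
          frechet_derivative (\<lambda>y. dtransition c d y v) (at x) u +
          \<Gamma> d (transition c d x) (dtransition c d x u) (dtransition c d x v))"

definition covd ::
    "('e::euclidean_space \<Rightarrow> 'e \<Rightarrow> 'e \<Rightarrow> 'e) \<Rightarrow> ('e \<Rightarrow> 'e) \<Rightarrow> ('e \<Rightarrow> 'e) \<Rightarrow> 'e \<Rightarrow> 'e" where
  "covd \<Gamma> X Y x = frechet_derivative Y (at x) (X x) + \<Gamma> x (X x) (Y x)"

definition lie_bracket :: "('e::euclidean_space \<Rightarrow> 'e) \<Rightarrow> ('e \<Rightarrow> 'e) \<Rightarrow> 'e \<Rightarrow> 'e" where
  "lie_bracket X Y x = frechet_derivative Y (at x) (X x) - frechet_derivative X (at x) (Y x)"

definition levi_civita ::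
    "('m, 'e::euclidean_space) chart set \<Rightarrow> (('m, 'e) chart \<Rightarrow> 'e \<Rightarrow> 'e \<Rightarrow> 'e \<Rightarrow> real) \<Rightarrow>
     (('m, 'e) chart \<Rightarrow> 'e \<Rightarrow> 'e \<Rightarrow> 'e \<Rightarrow> 'e) \<Rightarrow> bool" where
  "levi_civita A g \<Gamma> \<longleftrightarrow> affine_connection A \<Gamma> \<and>
     (\<forall>c\<in>A. \<forall>X Y Z. smooth_on (chart_image c) X \<longrightarrow> smooth_on (chart_image c) Y \<longrightarrow>
        smooth_on (chart_image c) Z \<longrightarrow>
        (\<forall>x\<in>chart_image c.
           covd (\<Gamma> c) X Y x - covd (\<Gamma> c) Y X x = lie_bracket X Y x \<and>
           frechet_derivative (\<lambda>y. g c y (Y y) (Z y)) (at x) (X x) =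
             g c x (covd (\<Gamma> c) X Y x) (Z x) + g c x (Y x) (covd (\<Gamma> c) X Z x)))"

definition kaehler_manifold ::
    "'m topology \<Rightarrow> ('m, 'e::euclidean_space) chart set \<Rightarrow>
     (('m, 'e) chart \<Rightarrow> 'e \<Rightarrow> 'e \<Rightarrow> 'e \<Rightarrow> real) \<Rightarrow> (('m, 'e) chart \<Rightarrow> 'e \<Rightarrow> 'e \<Rightarrow> 'e) \<Rightarrow>
     (('m, 'e) chart \<Rightarrow> 'e \<Rightarrow> 'e \<Rightarrow> 'e \<Rightarrow> 'e) \<Rightarrow> bool" where
  "kaehler_manifold T A g J \<Gamma> \<longleftrightarrow>
     smooth_manifold T A \<and> riemannian_metric A g \<and> almost_complex A J \<and> levi_civita A g \<Gamma> \<and>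
     (\<forall>c\<in>A. \<forall>x\<in>chart_image c. \<forall>u v. g c x (J c x u) (J c x v) = g c x u v) \<and>
     (\<forall>c\<in>A. \<forall>X Y. smooth_on (chart_image c) X \<longrightarrow> smooth_on (chart_image c) Y \<longrightarrow>
        (\<forall>x\<in>chart_image c. covd (\<Gamma> c) X (\<lambda>y. J c y (Y y)) x = J c x (covd (\<Gamma> c) X Y x)))"


section \<open>Curvature\<close>

text \<open>
  From here on \<open>G\<close>, \<open>J\<close>, \<open>\<Gamma>\<close> denote the local expressions of the metric, the complex structure
  and the Levi-Civita connection in one chart.
\<close>

definition curvature ::
    "('e::euclidean_space \<Rightarrow> 'e \<Rightarrow> 'e \<Rightarrow> 'e) \<Rightarrow> ('e \<Rightarrow> 'e) \<Rightarrow> ('e \<Rightarrow> 'e) \<Rightarrow> ('e \<Rightarrow> 'e) \<Rightarrow> 'e \<Rightarrow> 'e" where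
  "curvature \<Gamma> X Y Z x =
     covd \<Gamma> X (covd \<Gamma> Y Z) x - covd \<Gamma> Y (covd \<Gamma> X Z) x - covd \<Gamma> (lie_bracket X Y) Z x"

text \<open>
  Since the curvature is tensorial, its value on tangent vectors at \<open>x\<close> may be computed with
  the extensions that have constant components.
\<close>

definition riem :: "('e::euclidean_space \<Rightarrow> 'e \<Rightarrow> 'e \<Rightarrow> 'e) \<Rightarrow> 'e \<Rightarrow> 'e \<Rightarrow> 'e \<Rightarrow> 'e \<Rightarrow> 'e" where
  "riem \<Gamma> x u v w = curvature \<Gamma> (\<lambda>_. u) (\<lambda>_. v) (\<lambda>_. w) x"

definition riem4 ::
    "('e::euclidean_space \<Rightarrow> 'e \<Rightarrow> 'e \<Rightarrow> real) \<Rightarrow> ('e \<Rightarrow> 'e \<Rightarrow> 'e \<Rightarrow> 'e) \<Rightarrow>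
     'e \<Rightarrow> 'e \<Rightarrow> 'e \<Rightarrow> 'e \<Rightarrow> 'e \<Rightarrow> real" where
  "riem4 G \<Gamma> x u v w z = G x (riem \<Gamma> x u v w) z"

definition orthonormal_basis ::
    "('e::euclidean_space \<Rightarrow> 'e \<Rightarrow> 'e \<Rightarrow> real) \<Rightarrow> 'e \<Rightarrow> 'e set \<Rightarrow> bool" where
  "orthonormal_basis G x B \<longleftrightarrow>
     span B = UNIV \<and> (\<forall>u\<in>B. \<forall>v\<in>B. G x u v = (if u = v then 1 else 0))"

definition ricci ::
    "('e::euclidean_space \<Rightarrow> 'e \<Rightarrow> 'e \<Rightarrow> real) \<Rightarrow> ('e \<Rightarrow> 'e \<Rightarrow> 'e \<Rightarrow> 'e) \<Rightarrow>
     'e \<Rightarrow> 'e \<Rightarrow> 'e \<Rightarrow> real" where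
  "ricci G \<Gamma> x v w = (\<Sum>e\<in>(SOME B. orthonormal_basis G x B). riem4 G \<Gamma> x e v w e)"

definition scal ::
    "('e::euclidean_space \<Rightarrow> 'e \<Rightarrow> 'e \<Rightarrow> real) \<Rightarrow> ('e \<Rightarrow> 'e \<Rightarrow> 'e \<Rightarrow> 'e) \<Rightarrow> 'e \<Rightarrow> real" where
  "scal G \<Gamma> x = (\<Sum>e\<in>(SOME B. orthonormal_basis G x B). ricci G \<Gamma> x e e)"


section \<open>Bochner-Kaehler manifolds\<close>

text \<open>
  A vector \<open>u + i v\<close> of the complexified tangent space is the pair \<open>(u, v)\<close>;
  real tensors are extended complex multilinearly.
\<close>

definition cscale :: "complex \<Rightarrow> 'e::euclidean_space \<times> 'e \<Rightarrow> 'e \<times> 'e" where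
  "cscale a z = (Re a *\<^sub>R fst z - Im a *\<^sub>R snd z, Re a *\<^sub>R snd z + Im a *\<^sub>R fst z)"

definition cconj :: "'e::euclidean_space \<times> 'e \<Rightarrow> 'e \<times> 'e" where
  "cconj z = (fst z, - snd z)"

definition cext :: "('e \<Rightarrow> complex) \<Rightarrow> 'e \<times> 'e \<Rightarrow> complex" where
  "cext f z = f (fst z) + \<i> * f (snd z)"

definition cext2 :: "('e \<Rightarrow> 'e \<Rightarrow> real) \<Rightarrow> 'e \<times> 'e \<Rightarrow> 'e \<times> 'e \<Rightarrow> complex" where
  "cext2 h z1 z2 = cext (\<lambda>u1. cext (\<lambda>u2. complex_of_real (h u1 u2)) z2) z1"

definition cext4 :: "('e \<Rightarrow> 'e \<Rightarrow> 'e \<Rightarrow> 'e \<Rightarrow> real) \<Rightarrow>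
    'e \<times> 'e \<Rightarrow> 'e \<times> 'e \<Rightarrow> 'e \<times> 'e \<Rightarrow> 'e \<times> 'e \<Rightarrow> complex" where
  "cext4 h z1 z2 z3 z4 =
     cext (\<lambda>u1. cext (\<lambda>u2. cext (\<lambda>u3. cext (\<lambda>u4. complex_of_real (h u1 u2 u3 u4)) z4) z3) z2) z1"

definition T10 :: "('e::euclidean_space \<Rightarrow> 'e \<Rightarrow> 'e) \<Rightarrow> 'e \<Rightarrow> ('e \<times> 'e) set" where
  "T10 J x = {z. (J x (fst z), J x (snd z)) = cscale \<i> z}"

definition complex_basis :: "('e::euclidean_space \<Rightarrow> 'e \<Rightarrow> 'e) \<Rightarrow> 'e \<Rightarrow> ('e \<times> 'e) set \<Rightarrow> bool" where
  "complex_basis J x B \<longleftrightarrow>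
     \<not> module.dependent cscale B \<and> module.span cscale B = T10 J x"

text \<open>By multilinearity it does not matter in which basis of \<open>T10\<close> the identity is required.\<close>

definition bochner_kaehler ::
    "'m topology \<Rightarrow> ('m, 'e::euclidean_space) chart set \<Rightarrow>
     (('m, 'e) chart \<Rightarrow> 'e \<Rightarrow> 'e \<Rightarrow> 'e \<Rightarrow> real) \<Rightarrow> (('m, 'e) chart \<Rightarrow> 'e \<Rightarrow> 'e \<Rightarrow> 'e) \<Rightarrow>
     (('m, 'e) chart \<Rightarrow> 'e \<Rightarrow> 'e \<Rightarrow> 'e \<Rightarrow> 'e) \<Rightarrow> nat \<Rightarrow> bool" where
  "bochner_kaehler T A g J \<Gamma> n \<longleftrightarrow> kaehler_manifold T A g J \<Gamma> \<and>
     (\<forall>c\<in>A. \<forall>x\<in>chart_image c. \<exists>B. complex_basis (J c) x B \<and>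
        (\<forall>\<alpha>\<in>B. \<forall>\<beta>\<in>B. \<forall>\<gamma>\<in>B. \<forall>\<delta>\<in>B.
           let h = cext2 (g c x); r = cext2 (ricci (g c) (\<Gamma> c) x);
               \<tau> = complex_of_real (scal (g c) (\<Gamma> c) x);
               \<beta>' = cconj \<beta>; \<delta>' = cconj \<delta>
           in cext4 (riem4 (g c) (\<Gamma> c) x) \<alpha> \<beta>' \<gamma> \<delta>' =
                1 / (of_nat n + 2) *
                  (h \<alpha> \<beta>' * r \<gamma> \<delta>' + h \<gamma> \<beta>' * r \<alpha> \<delta>' + h \<gamma> \<delta>' * r \<alpha> \<beta>' + h \<alpha> \<delta>' * r \<gamma> \<beta>') -
                \<tau> / (2 * (of_nat n + 1) * (of_nat n + 2)) *
                  (h \<alpha> \<beta>' * h \<gamma> \<delta>' + h \<gamma> \<beta>' * h \<alpha> \<delta>')))"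


section \<open>The scalar distribution\<close>

definition grad :: "('e::euclidean_space \<Rightarrow> 'e \<Rightarrow> 'e \<Rightarrow> real) \<Rightarrow> ('e \<Rightarrow> real) \<Rightarrow> 'e \<Rightarrow> 'e" where
  "grad G f x = (THE w. \<forall>v. G x w v = frechet_derivative f (at x) v)"

text \<open>The norm of a covector is the norm of its metric dual.\<close>

definition xi ::
    "('e::euclidean_space \<Rightarrow> 'e \<Rightarrow> 'e \<Rightarrow> real) \<Rightarrow> ('e \<Rightarrow> 'e \<Rightarrow> 'e \<Rightarrow> 'e) \<Rightarrow> 'e \<Rightarrow> 'e" where
  "xi G \<Gamma> x = (let w = grad G (scal G \<Gamma>) x in (1 / sqrt (G x w w)) *\<^sub>R w)"

definition orth_compl ::
    "('e::euclidean_space \<Rightarrow> 'e \<Rightarrow> 'e \<Rightarrow> real) \<Rightarrow> 'e \<Rightarrow> 'e set \<Rightarrow> 'e set" where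
  "orth_compl G x S = {v. \<forall>w\<in>S. G x v w = 0}"

definition scalar_distribution ::
    "('e::euclidean_space \<Rightarrow> 'e \<Rightarrow> 'e \<Rightarrow> real) \<Rightarrow> ('e \<Rightarrow> 'e \<Rightarrow> 'e) \<Rightarrow> ('e \<Rightarrow> 'e \<Rightarrow> 'e \<Rightarrow> 'e) \<Rightarrow>
     'e \<Rightarrow> 'e set" where
  "scalar_distribution G J \<Gamma> x = orth_compl G x (span {xi G \<Gamma> x, J x (xi G \<Gamma> x)})"

definition scalar_B0 ::
    "'m topology \<Rightarrow> ('m, 'e::euclidean_space) chart set \<Rightarrow>
     (('m, 'e) chart \<Rightarrow> 'e \<Rightarrow> 'e \<Rightarrow> 'e \<Rightarrow> real) \<Rightarrow> (('m, 'e) chart \<Rightarrow> 'e \<Rightarrow> 'e \<Rightarrow> 'e) \<Rightarrow>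
     (('m, 'e) chart \<Rightarrow> 'e \<Rightarrow> 'e \<Rightarrow> 'e \<Rightarrow> 'e) \<Rightarrow> bool" where
  "scalar_B0 T A g J \<Gamma> \<longleftrightarrow>
     (\<exists>(k :: 'm \<Rightarrow> real) (pstar :: 'm \<Rightarrow> real). (\<forall>m\<in>topspace T. k m \<noteq> 0) \<and>
        (\<forall>c\<in>A. \<forall>x\<in>chart_image c.
           let \<xi> = xi (g c) (\<Gamma> c); J\<xi> = (\<lambda>y. J c y (\<xi> y)); m = chart_inv c x
           in (\<forall>x0\<in>scalar_distribution (g c) (J c) (\<Gamma> c) x.
                 covd (\<Gamma> c) (\<lambda>_. x0) \<xi> x = (k m / 2) *\<^sub>R x0) \<and>
              covd (\<Gamma> c) J\<xi> \<xi> x = - pstar m *\<^sub>R J\<xi> x \<and>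
              covd (\<Gamma> c) \<xi> \<xi> x = 0))"


section \<open>Quasi-constant holomorphic sectional curvatures\<close>

text \<open>
  Smoothness of a distribution of codimension 2 is expressed by its being, locally, the common
  kernel of two smooth 1-forms.
\<close>

definition codim2_distribution ::
    "('m, 'e::euclidean_space) chart set \<Rightarrow> (('m, 'e) chart \<Rightarrow> 'e \<Rightarrow> 'e set) \<Rightarrow> bool" where
  "codim2_distribution A D \<longleftrightarrow>
     (\<forall>c\<in>A. \<forall>x\<in>chart_image c.
        subspace (D c x) \<and> dim (D c x) + 2 = DIM('e) \<and>
        (\<exists>V w1 w2. open V \<and> x \<in> V \<and> V \<subseteq> chart_image c \<and>
           (\<forall>v. smooth_on V (\<lambda>y. w1 y v) \<and> smooth_on V (\<lambda>y. w2 y v)) \<and>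
           (\<forall>y\<in>V. linear (w1 y) \<and> linear (w2 y) \<and>
              D c y = {v. w1 y v = (0::real) \<and> w2 y v = (0::real)}))) \<and>
     (\<forall>c\<in>A. \<forall>d\<in>A. \<forall>x\<in>overlap c d. D d (transition c d x) = dtransition c d x ` D c x)"

definition sectional_curvature ::
    "('e::euclidean_space \<Rightarrow> 'e \<Rightarrow> 'e \<Rightarrow> real) \<Rightarrow> ('e \<Rightarrow> 'e \<Rightarrow> 'e \<Rightarrow> 'e) \<Rightarrow> 'e \<Rightarrow> 'e \<Rightarrow> 'e \<Rightarrow> real" where
  "sectional_curvature G \<Gamma> x u v =
     riem4 G \<Gamma> x u v v u / (G x u u * G x v v - (G x u v)\<^sup>2)"

definition holomorphic_section :: "('e::euclidean_space \<Rightarrow> 'e \<Rightarrow> 'e) \<Rightarrow> 'e \<Rightarrow> 'e set \<Rightarrow> bool" where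
  "holomorphic_section J x E \<longleftrightarrow> subspace E \<and> dim E = 2 \<and> J x ` E \<subseteq> E"

text \<open>
  The smallest angle between nonzero vectors of two subspaces. For two \<open>J\<close>-invariant planes
  both principal angles agree, so there is no ambiguity in the angle between them.
\<close>

definition subspace_angle ::
    "('e::euclidean_space \<Rightarrow> 'e \<Rightarrow> 'e \<Rightarrow> real) \<Rightarrow> 'e \<Rightarrow> 'e set \<Rightarrow> 'e set \<Rightarrow> real" where
  "subspace_angle G x E F =
     (INF (u, w)\<in>(E - {0}) \<times> (F - {0}). arccos (G x u w / (sqrt (G x u u) * sqrt (G x w w))))"

definition quasi_constant_hsc ::
    "('m, 'e::euclidean_space) chart set \<Rightarrow>
     (('m, 'e) chart \<Rightarrow> 'e \<Rightarrow> 'e \<Rightarrow> 'e \<Rightarrow> real) \<Rightarrow> (('m, 'e) chart \<Rightarrow> 'e \<Rightarrow> 'e \<Rightarrow> 'e) \<Rightarrow>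
     (('m, 'e) chart \<Rightarrow> 'e \<Rightarrow> 'e \<Rightarrow> 'e \<Rightarrow> 'e) \<Rightarrow> (('m, 'e) chart \<Rightarrow> 'e \<Rightarrow> 'e set) \<Rightarrow> bool" where
  "quasi_constant_hsc A g J \<Gamma> D \<longleftrightarrow>
     codim2_distribution A D \<and>
     (\<forall>c\<in>A. \<forall>x\<in>chart_image c. J c x ` D c x \<subseteq> D c x) \<and>
     (\<exists>F :: 'm \<Rightarrow> real \<Rightarrow> real. \<forall>c\<in>A. \<forall>x\<in>chart_image c. \<forall>u v.
        holomorphic_section (J c) x (span {u, v}) \<longrightarrow>
        sectional_curvature (g c) (\<Gamma> c) x u v =
          F (chart_inv c x)
            (subspace_angle (g c) x (span {u, v}) (orth_compl (g c) x (D c x))))"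


section \<open>The tensors \<open>\<pi>\<close>, \<open>\<Phi>\<close> and the functions \<open>a\<close>, \<open>b\<close>\<close>

definition pi_tensor ::
    "('e::euclidean_space \<Rightarrow> 'e \<Rightarrow> 'e \<Rightarrow> real) \<Rightarrow> ('e \<Rightarrow> 'e \<Rightarrow> 'e) \<Rightarrow> 'e \<Rightarrow> 'e \<Rightarrow> 'e \<Rightarrow> 'e \<Rightarrow> 'e" where
  "pi_tensor G J x X Y Z = (1/4) *\<^sub>R
     (G x Y Z *\<^sub>R X - G x X Z *\<^sub>R Y - (2 * G x (J x X) Y) *\<^sub>R J x Z
      + G x (J x Y) Z *\<^sub>R J x X - G x (J x X) Z *\<^sub>R J x Y)"

definition Phi_tensor ::
    "('e::euclidean_space \<Rightarrow> 'e \<Rightarrow> 'e \<Rightarrow> real) \<Rightarrow> ('e \<Rightarrow> 'e \<Rightarrow> 'e) \<Rightarrow> ('e \<Rightarrow> 'e \<Rightarrow> 'e \<Rightarrow> 'e) \<Rightarrow>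
     'e \<Rightarrow> 'e \<Rightarrow> 'e \<Rightarrow> 'e \<Rightarrow> 'e" where
  "Phi_tensor G J \<Gamma> x X Y Z =
     (let \<xi> = xi G \<Gamma> x; J\<xi> = J x \<xi>; \<eta> = (\<lambda>U. G x U \<xi>); \<eta>' = (\<lambda>U. G x U J\<xi>) in
      (1/8) *\<^sub>R
       (G x Y Z *\<^sub>R (\<eta> X *\<^sub>R \<xi> + \<eta>' X *\<^sub>R J\<xi>) - G x X Z *\<^sub>R (\<eta> Y *\<^sub>R \<xi> + \<eta>' Y *\<^sub>R J\<xi>)
        + G x (J x Y) Z *\<^sub>R (\<eta> X *\<^sub>R J\<xi> - \<eta>' X *\<^sub>R \<xi>) - G x (J x X) Z *\<^sub>R (\<eta> Y *\<^sub>R J\<xi> - \<eta>' Y *\<^sub>R \<xi>)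
        - (2 * G x (J x X) Y) *\<^sub>R (\<eta> Z *\<^sub>R J\<xi> - \<eta>' Z *\<^sub>R \<xi>)
        + (\<eta> Y * \<eta> Z + \<eta>' Y * \<eta>' Z) *\<^sub>R X - (\<eta> X * \<eta> Z + \<eta>' X * \<eta>' Z) *\<^sub>R Y
        + (\<eta> Y * \<eta>' Z - \<eta>' Y * \<eta> Z) *\<^sub>R J x X - (\<eta> X * \<eta>' Z - \<eta>' X * \<eta> Z) *\<^sub>R J x Y
        - (2 * (\<eta> X * \<eta>' Y - \<eta>' X * \<eta> Y)) *\<^sub>R J x Z))"

definition kappa ::
    "('e::euclidean_space \<Rightarrow> 'e \<Rightarrow> 'e \<Rightarrow> real) \<Rightarrow> ('e \<Rightarrow> 'e \<Rightarrow> 'e) \<Rightarrow> ('e \<Rightarrow> 'e \<Rightarrow> 'e \<Rightarrow> 'e) \<Rightarrow>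
     'e \<Rightarrow> real" where
  "kappa G J \<Gamma> x =
     (let \<xi> = xi G \<Gamma> x in riem4 G \<Gamma> x \<xi> (J x \<xi>) (J x \<xi>) \<xi>)"

definition sigma ::
    "('e::euclidean_space \<Rightarrow> 'e \<Rightarrow> 'e \<Rightarrow> real) \<Rightarrow> ('e \<Rightarrow> 'e \<Rightarrow> 'e \<Rightarrow> 'e) \<Rightarrow> 'e \<Rightarrow> real" where
  "sigma G \<Gamma> x = ricci G \<Gamma> x (xi G \<Gamma> x) (xi G \<Gamma> x)"

definition coeff_a ::
    "nat \<Rightarrow> ('e::euclidean_space \<Rightarrow> 'e \<Rightarrow> 'e \<Rightarrow> real) \<Rightarrow> ('e \<Rightarrow> 'e \<Rightarrow> 'e) \<Rightarrow>
     ('e \<Rightarrow> 'e \<Rightarrow> 'e \<Rightarrow> 'e) \<Rightarrow> 'e \<Rightarrow> real" where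
  "coeff_a n G J \<Gamma> x =
     (scal G \<Gamma> x - 4 * sigma G \<Gamma> x + 2 * kappa G J \<Gamma> x) / (real n * (real n - 1))"

definition coeff_b ::
    "nat \<Rightarrow> ('e::euclidean_space \<Rightarrow> 'e \<Rightarrow> 'e \<Rightarrow> real) \<Rightarrow> ('e \<Rightarrow> 'e \<Rightarrow> 'e) \<Rightarrow>
     ('e \<Rightarrow> 'e \<Rightarrow> 'e \<Rightarrow> 'e) \<Rightarrow> 'e \<Rightarrow> real" where
  "coeff_b n G J \<Gamma> x =
     (- 2 * scal G \<Gamma> x + 4 * (real n + 2) * sigma G \<Gamma> x - 4 * (real n + 1) * kappa G J \<Gamma> x)
       / (real n * (real n - 1))"

end

theory Submission
  imports Defs
begin

text \<open>
  Differentiating \<open>\<nabla>\<xi>\<close>, which a \<open>B\<^sub>0\<close>-distribution prescribes, shows that \<open>R(x\<^sub>0, \<xi>)\<xi>\<close> is a multiple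
  of \<open>x\<^sub>0\<close> for every \<open>x\<^sub>0\<close> in \<open>D\<^sub>\<tau>\<close>. A Bochner-Kaehler curvature tensor is the product of the metric
  with a modified Ricci form \<open>h\<close>, so this forces \<open>h = l g + m (\<eta>\<^sup>2 + \<eta>'\<^sup>2)\<close>, where \<open>\<eta>'\<close> is the metric
  dual of \<open>J\<xi>\<close>. Hence \<open>R = 4l \<pi> + 4m \<Phi>\<close>, and traces
  identify \<open>4l\<close> and \<open>4m\<close> with \<open>a\<close> and \<open>b\<close>. Where \<open>b\<close> vanishes, the second Bianchi identity on
  \<open>\<xi>, x\<^sub>0, Jx\<^sub>0\<close> gives \<open>da(\<xi>) = db(\<xi>) = 0\<close>, contradicting \<open>\<tau> = (n + 1)(n a + b)\<close> and \<open>d\<tau>(\<xi>) > 0\<close>.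
  The curvature of a holomorphic section is \<open>a + b cos\<^sup>2 \<theta>\<close>, with \<open>\<theta>\<close> its angle to the complement
  of \<open>D\<^sub>\<tau>\<close>; the functions \<open>a\<close>, \<open>b\<close> descend to the manifold as the curvature is a tensor.
\<close>

subsection \<open>Smooth functions\<close>

text \<open>Everything up to the comparison of charts is computed in one chart with constant vector
  fields, whose brackets vanish. Two obstacles shape the analysis. \<open>ricci\<close> and
  \<open>scal\<close> are traces over a basis picked by \<open>SOME\<close>, so their dependence on
  the point is opaque; independence of the trace from the basis, together with an orthonormal frame
  that is smooth on the whole chart, makes the scalar curvature and hence \<open>xi\<close> smooth.
  The functions \<open>k\<close> and \<open>pstar\<close> of a B0-distribution come with no
  regularity at all, so their differentiability has to be read off from the covariant derivative of
  \<open>xi\<close> before it can be differentiated again. The factor 4 in \<open>4l\<close> and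
  \<open>4m\<close> is a normalization: the product of the metric with itself is 4 times
  \<open>pi_tensor\<close>, and its product with the metric of the plane spanned by
  \<open>xi\<close> and \<open>J xi\<close> is 4 times \<open>Phi_tensor\<close>. In the last step
  dimension at least 6 supplies, next to a vector of the distribution, a second one orthogonal to it
  and to its image under \<open>J\<close>. Tested against this second vector the Bianchi identity
  contains \<open>da\<close> alone; with \<open>da(xi) = 0\<close> known, a test against
  \<open>xi\<close> and \<open>J xi\<close> isolates \<open>db\<close>.\<close>

lemma frechet_derivative_eq:
  "(f has_derivative f') (at x) \<Longrightarrow> frechet_derivative f (at x) = f'"
  using frechet_derivative_at by metis

lemma cont_diff_on_cong:
  assumes "open S" "\<And>x. x \<in> S \<Longrightarrow> f x = g x"
  shows "cont_diff_on S f k \<longleftrightarrow> cont_diff_on S g k"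
  using assms(2)
proof (induction k arbitrary: f g)
  case 0
  then show ?case using continuous_on_cong by (metis cont_diff_on.simps(1))
next
  case (Suc k)
  have d: "f differentiable at x \<longleftrightarrow> g differentiable at x" if "x \<in> S" for x
    using Suc.prems assms(1) that has_derivative_transform_within_open
    unfolding differentiable_def by metis
  have *: "frechet_derivative f (at x) = frechet_derivative g (at x)"
    if "x \<in> S" "f differentiable at x" for x
    using frechet_derivative_transform_within_open[of f x S g] that assms(1) Suc.prems by blast
  \<comment> \<open>\<open>frechet_derivative\<close> is unspecified where no derivative exists, so
    the derivative fields are compared only if \<open>f\<close> is differentiable on all of
    \<open>S\<close>; otherwise both sides are false.\<close>
  show ?case
  proof (cases "\<forall>x\<in>S. f differentiable at x")
    case True
    then have "cont_diff_on S (\<lambda>x. frechet_derivative f (at x) v) k \<longleftrightarrow>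
        cont_diff_on S (\<lambda>x. frechet_derivative g (at x) v) k" for v
      using * by (intro Suc.IH) auto
    then show ?thesis using d by simp
  next
    case False
    then show ?thesis using d by auto
  qed
qed

lemma cont_diff_on_SucD: "cont_diff_on S f (Suc k) \<Longrightarrow> cont_diff_on S f k"
proof (induction k arbitrary: f)
  case 0
  then show ?case
    by (auto intro!: continuous_at_imp_continuous_on differentiable_imp_continuous_within)
qed simp

lemma cont_diff_on_SucI:
  assumes "open S" "\<And>x. x \<in> S \<Longrightarrow> (f has_derivative f' x) (at x)"
    "\<And>v. cont_diff_on S (\<lambda>x. f' x v) k"
  shows "cont_diff_on S f (Suc k)"
proof -
  have "cont_diff_on S (\<lambda>x. frechet_derivative f (at x) v) k" for v
    using assms(3)[of v] frechet_derivative_eq[OF assms(2)]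
    by (subst cont_diff_on_cong[OF assms(1)]) auto
  then show ?thesis using assms(2) unfolding cont_diff_on.simps differentiable_def by blast
qed

lemma cont_diff_on_const: "cont_diff_on S (\<lambda>x. c) k"
  by (induction k arbitrary: c) auto

lemma cont_diff_on_add:
  assumes "open S" "cont_diff_on S f k" "cont_diff_on S g k"
  shows "cont_diff_on S (\<lambda>x. f x + g x) k"
  using assms(2,3)
proof (induction k arbitrary: f g)
  case 0 then show ?case by (auto intro: continuous_on_add)
next
  case (Suc k)
  then have "x \<in> S \<Longrightarrow> (f has_derivative frechet_derivative f (at x)) (at x)"
    "x \<in> S \<Longrightarrow> (g has_derivative frechet_derivative g (at x)) (at x)" for x
    by (auto simp flip: frechet_derivative_works)
  note d = has_derivative_add[OF this]
  show ?case
    by (rule cont_diff_on_SucI[OF assms(1) d]) (use Suc in auto)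
qed

lemma cont_diff_on_bilinear:
  assumes "open S" "bounded_bilinear h" "cont_diff_on S f k" "cont_diff_on S g k"
  shows "cont_diff_on S (\<lambda>x. h (f x) (g x)) k"
  using assms(3,4)
proof (induction k arbitrary: f g)
  case 0 then show ?case using bounded_bilinear.continuous_on[OF assms(2)] by auto
next
  case (Suc k)
  then have d: "x \<in> S \<Longrightarrow> (f has_derivative frechet_derivative f (at x)) (at x)"
    "x \<in> S \<Longrightarrow> (g has_derivative frechet_derivative g (at x)) (at x)" for x
    by (auto simp flip: frechet_derivative_works)
  note d = bounded_bilinear.FDERIV[OF assms(2) d]
  note fg = Suc.prems[THEN cont_diff_on_SucD]
  show ?case
    by (rule cont_diff_on_SucI[OF assms(1) d])
      (use Suc fg in \<open>auto intro!: cont_diff_on_add[OF assms(1)] Suc.IH\<close>)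
qed

lemma cont_diff_on_bounded_linear:
  assumes "open S" "bounded_linear h" "cont_diff_on S f k"
  shows "cont_diff_on S (\<lambda>x. h (f x)) k"
  using assms(3)
proof (induction k arbitrary: f)
  case 0 then show ?case using bounded_linear.continuous_on[OF assms(2)] by auto
next
  case (Suc k)
  then have d: "x \<in> S \<Longrightarrow> (f has_derivative frechet_derivative f (at x)) (at x)" for x
    by (auto simp flip: frechet_derivative_works)
  note d = bounded_linear.has_derivative[OF assms(2) d]
  show ?case
    by (rule cont_diff_on_SucI[OF assms(1) d]) (use Suc in auto)
qed

text \<open>Differentiating a power gives another power times the derivative of \<open>f\<close>, so
  the induction runs over all exponents at once. The exponent used later is -1/2, for dividing
  vector fields by their length.\<close>

lemma cont_diff_on_powr:
  fixes f :: "'a::real_normed_vector \<Rightarrow> real"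
  assumes "open S" "cont_diff_on S f k" "\<And>x. x \<in> S \<Longrightarrow> f x > 0"
  shows "cont_diff_on S (\<lambda>x. f x powr a) k"
  using assms(2,3)
proof (induction k arbitrary: a)
  case 0 then show ?case by (auto intro!: continuous_intros) force
next
  case (Suc k)
  have "(f has_derivative frechet_derivative f (at x)) (at x)" if "x \<in> S" for x
    using Suc.prems(1) that by (auto simp flip: frechet_derivative_works)
  then have "((\<lambda>x. f x powr a) has_derivative
      (\<lambda>v. (a * f x powr (a - 1)) * frechet_derivative f (at x) v)) (at x)" if "x \<in> S" for x
    using that Suc.prems(2)[OF that]
    by (auto intro!: derivative_eq_intros simp: fun_eq_iff powr_diff field_simps)
  moreover have "cont_diff_on S (\<lambda>x. (a * f x powr (a - 1)) * frechet_derivative f (at x) v) k" for v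
    using Suc cont_diff_on_SucD[OF Suc.prems(1)]
    by (intro cont_diff_on_bilinear[OF assms(1) bounded_bilinear_mult] cont_diff_on_const Suc.IH) auto
  ultimately show ?case by (rule cont_diff_on_SucI[OF assms(1)])
qed

lemma smooth_on_cong:
  "open S \<Longrightarrow> (\<And>x. x \<in> S \<Longrightarrow> f x = g x) \<Longrightarrow> smooth_on S f \<longleftrightarrow> smooth_on S g"
  by (simp add: smooth_on_def cont_diff_on_cong[of S f g])

lemma smooth_on_has_derivative:
  "smooth_on S f \<Longrightarrow> x \<in> S \<Longrightarrow> (f has_derivative frechet_derivative f (at x)) (at x)"
  unfolding smooth_on_def frechet_derivative_works[symmetric] by (metis cont_diff_on.simps(2))

lemma smooth_on_differentiable: "smooth_on S f \<Longrightarrow> x \<in> S \<Longrightarrow> f differentiable (at x)"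
  using smooth_on_has_derivative differentiable_def by blast

lemma smooth_on_frechet_derivative:
  "smooth_on S f \<Longrightarrow> smooth_on S (\<lambda>x. frechet_derivative f (at x) v)"
  unfolding smooth_on_def by (metis cont_diff_on.simps(2))

lemma smooth_on_const [simp]: "smooth_on S (\<lambda>x. c)"
  by (simp add: smooth_on_def cont_diff_on_const)

lemma smooth_on_add:
  "open S \<Longrightarrow> smooth_on S f \<Longrightarrow> smooth_on S g \<Longrightarrow> smooth_on S (\<lambda>x. f x + g x)"
  by (simp add: smooth_on_def cont_diff_on_add)

lemma smooth_on_bilinear:
  "open S \<Longrightarrow> bounded_bilinear h \<Longrightarrow> smooth_on S f \<Longrightarrow> smooth_on S g \<Longrightarrow>
    smooth_on S (\<lambda>x. h (f x) (g x))"
  by (simp add: smooth_on_def cont_diff_on_bilinear)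

lemmas smooth_on_mult = smooth_on_bilinear[OF _ bounded_bilinear_mult]
lemmas smooth_on_scaleR = smooth_on_bilinear[OF _ bounded_bilinear_scaleR]
lemmas smooth_on_inner = smooth_on_bilinear[OF _ bounded_bilinear_inner]

lemma smooth_on_minus: "open S \<Longrightarrow> smooth_on S f \<Longrightarrow> smooth_on S (\<lambda>x. - f x)"
  by (simp add: smooth_on_def cont_diff_on_bounded_linear[OF _ bounded_linear_minus[OF bounded_linear_ident]])

lemma smooth_on_diff:
  "open S \<Longrightarrow> smooth_on S f \<Longrightarrow> smooth_on S g \<Longrightarrow> smooth_on S (\<lambda>x. f x - g x)"
  using smooth_on_add[OF _ _ smooth_on_minus, of S f g] by simp

lemma smooth_on_sum:
  "open S \<Longrightarrow> (\<And>i. i \<in> I \<Longrightarrow> smooth_on S (f i)) \<Longrightarrow> smooth_on S (\<lambda>x. \<Sum>i\<in>I. f i x)"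
  by (induction I rule: infinite_finite_induct) (auto intro: smooth_on_add)

lemma smooth_on_powr:
  fixes f :: "'a::real_normed_vector \<Rightarrow> real"
  shows "open S \<Longrightarrow> smooth_on S f \<Longrightarrow> (\<And>x. x \<in> S \<Longrightarrow> f x > 0) \<Longrightarrow> smooth_on S (\<lambda>x. f x powr a)"
  by (simp add: smooth_on_def cont_diff_on_powr)

lemmas smooth_on_intros = smooth_on_const smooth_on_add smooth_on_minus smooth_on_diff
  smooth_on_mult smooth_on_scaleR smooth_on_inner smooth_on_sum

section \<open>Symmetry of second derivatives\<close>

lemma second_difference_mvt:
  fixes f :: "'a::real_normed_vector \<Rightarrow> real"
  assumes sm: "smooth_on (ball x r) f" and t: "t > 0" "t * norm u + t * norm v < r"
  shows "\<exists>p q. 0 \<le> p \<and> p \<le> t \<and> 0 \<le> q \<and> q \<le> t \<and>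
    f (x + t *\<^sub>R u + t *\<^sub>R v) - f (x + t *\<^sub>R u) - f (x + t *\<^sub>R v) + f x =
      t * t * frechet_derivative (\<lambda>y. frechet_derivative f (at y) u) (at (x + p *\<^sub>R u + q *\<^sub>R v)) v"
proof -
  have inb: "x + p *\<^sub>R u + q *\<^sub>R v \<in> ball x r" if "0 \<le> p" "p \<le> t" "0 \<le> q" "q \<le> t" for p q
  proof -
    have "norm (p *\<^sub>R u + q *\<^sub>R v) \<le> p * norm u + q * norm v"
      using norm_triangle_ineq[of "p *\<^sub>R u" "q *\<^sub>R v"] that by simp
    also have "\<dots> \<le> t * norm u + t * norm v"
      using that by (intro add_mono mult_right_mono) auto
    also note t(2)
    finally show ?thesis using norm_minus_cancel[of "p *\<^sub>R u + q *\<^sub>R v"]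
      by (simp add: dist_norm add.assoc)
  qed
  have d1: "((\<lambda>s. f (x + s *\<^sub>R u + q *\<^sub>R v)) has_real_derivative
      frechet_derivative f (at (x + p *\<^sub>R u + q *\<^sub>R v)) u) (at p)"
    if "0 \<le> p" "p \<le> t" "0 \<le> q" "q \<le> t" for p q
  proof -
    note d = smooth_on_has_derivative[OF sm inb[OF that]]
    have line: "((\<lambda>s. x + s *\<^sub>R u + q *\<^sub>R v) has_derivative (\<lambda>s. s *\<^sub>R u)) (at p)"
      by (auto intro!: derivative_eq_intros)
    have "((\<lambda>s. f (x + s *\<^sub>R u + q *\<^sub>R v)) has_derivative
        (\<lambda>s. frechet_derivative f (at (x + p *\<^sub>R u + q *\<^sub>R v)) (s *\<^sub>R u))) (at p)"
      by (rule has_derivative_compose[OF line d])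
    then show ?thesis
      by (simp only: has_field_derivative_def linear_scale[OF has_derivative_linear[OF d]]
          real_scaleR_def mult_commute_abs)
  qed
  define D where "D y = frechet_derivative f (at y) u" for y
  have d2: "((\<lambda>s. D (x + p *\<^sub>R u + s *\<^sub>R v)) has_real_derivative
      frechet_derivative D (at (x + p *\<^sub>R u + q *\<^sub>R v)) v) (at q)"
    if "0 \<le> p" "p \<le> t" "0 \<le> q" "q \<le> t" for p q
  proof -
    have d: "(D has_derivative frechet_derivative D (at (x + p *\<^sub>R u + q *\<^sub>R v)))
        (at (x + p *\<^sub>R u + q *\<^sub>R v))"
      unfolding D_def
      by (rule smooth_on_has_derivative[OF smooth_on_frechet_derivative[OF sm] inb[OF that]])
    have line: "((\<lambda>s. x + p *\<^sub>R u + s *\<^sub>R v) has_derivative (\<lambda>s. s *\<^sub>R v)) (at q)"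
      by (auto intro!: derivative_eq_intros)
    have "((\<lambda>s. D (x + p *\<^sub>R u + s *\<^sub>R v)) has_derivative
        (\<lambda>s. frechet_derivative D (at (x + p *\<^sub>R u + q *\<^sub>R v)) (s *\<^sub>R v))) (at q)"
      by (rule has_derivative_compose[OF line d])
    then show ?thesis
      by (simp only: has_field_derivative_def linear_scale[OF has_derivative_linear[OF d]]
          real_scaleR_def mult_commute_abs)
  qed
  \<comment> \<open>The second difference is \<open>F t - F 0\<close>: the mean value theorem in
    direction \<open>u\<close>, followed by one in direction \<open>v\<close>, turns it into a mixed
    derivative at an intermediate point. The summand \<open>0 *\<^sub>R v\<close> keeps the shape
    demanded by \<open>d1\<close>.\<close>
  define F where "F s = f (x + s *\<^sub>R u + t *\<^sub>R v) - f (x + s *\<^sub>R u + 0 *\<^sub>R v)" for s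
  have "(F has_real_derivative D (x + s *\<^sub>R u + t *\<^sub>R v) - D (x + s *\<^sub>R u + 0 *\<^sub>R v)) (at s)"
    if "0 \<le> s" "s \<le> t" for s
    unfolding F_def D_def by (rule DERIV_diff; rule d1) (use that t(1) in auto)
  then have "\<exists>p>0. p < t \<and> F t - F 0 = (t - 0) * (D (x + p *\<^sub>R u + t *\<^sub>R v) - D (x + p *\<^sub>R u + 0 *\<^sub>R v))"
    by (rule MVT2[OF t(1)])
  then obtain p where p: "0 < p" "p < t" and e1:
    "f (x + t *\<^sub>R u + t *\<^sub>R v) - f (x + t *\<^sub>R u) - f (x + t *\<^sub>R v) + f x =
      t * (D (x + p *\<^sub>R u + t *\<^sub>R v) - D (x + p *\<^sub>R u + 0 *\<^sub>R v))"
    by (auto simp: F_def)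
  have "\<exists>q>0. q < t \<and> D (x + p *\<^sub>R u + t *\<^sub>R v) - D (x + p *\<^sub>R u + 0 *\<^sub>R v) =
      (t - 0) * frechet_derivative D (at (x + p *\<^sub>R u + q *\<^sub>R v)) v"
    by (rule MVT2[OF t(1)], rule d2) (use p in auto)
  then obtain q where q: "0 < q" "q < t" and e2:
    "D (x + p *\<^sub>R u + t *\<^sub>R v) - D (x + p *\<^sub>R u + 0 *\<^sub>R v) =
      t * frechet_derivative D (at (x + p *\<^sub>R u + q *\<^sub>R v)) v"
    by auto
  from e1 e2 p q show ?thesis
    unfolding D_def by (intro exI[of _ p] exI[of _ q]) auto
qed

lemma smooth_on_subset: "smooth_on S f \<Longrightarrow> U \<subseteq> S \<Longrightarrow> smooth_on U f"
proof -
  have "cont_diff_on S f k \<Longrightarrow> U \<subseteq> S \<Longrightarrow> cont_diff_on U f k" for k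
    by (induction k arbitrary: f) (auto intro: continuous_on_subset)
  then show "smooth_on S f \<Longrightarrow> U \<subseteq> S \<Longrightarrow> smooth_on U f" by (auto simp: smooth_on_def)
qed

lemma smooth_on_continuous: "smooth_on S f \<Longrightarrow> continuous_on S f"
  unfolding smooth_on_def by (metis cont_diff_on.simps(1))

lemma second_derivative_symmetric_real:
  fixes f :: "'a::real_normed_vector \<Rightarrow> real"
  assumes "open S" "smooth_on S f" "x \<in> S"
  shows "frechet_derivative (\<lambda>y. frechet_derivative f (at y) u) (at x) v =
    frechet_derivative (\<lambda>y. frechet_derivative f (at y) v) (at x) u"
proof -
  define Duv where "Duv y = frechet_derivative (\<lambda>y. frechet_derivative f (at y) u) (at y) v" for y
  define Dvu where "Dvu y = frechet_derivative (\<lambda>y. frechet_derivative f (at y) v) (at y) u" for y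
  have "smooth_on S Duv" "smooth_on S Dvu"
    unfolding Duv_def Dvu_def by (intro smooth_on_frechet_derivative assms)+
  then have ct: "isCont Duv x" "isCont Dvu x"
    using smooth_on_continuous assms(1,3) continuous_on_eq_continuous_at by blast+
  obtain r where r: "r > 0" "ball x r \<subseteq> S" using assms(1,3) openE by blast
  \<comment> \<open>One and the same second difference is a value of \<open>Duv\<close> and a value
    of \<open>Dvu\<close> at points close to \<open>x\<close>; continuity of both at
    \<open>x\<close> brings the values at \<open>x\<close> within \<open>e\<close>.\<close>
  have "\<bar>Duv x - Dvu x\<bar> < e" if e: "e > 0" for e
  proof -
    obtain d1 where d1: "d1 > 0" "\<And>y. dist y x < d1 \<Longrightarrow> dist (Duv y) (Duv x) < e / 2"
      using ct(1) e unfolding continuous_at_eps_delta by (metis half_gt_zero)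
    obtain d2 where d2: "d2 > 0" "\<And>y. dist y x < d2 \<Longrightarrow> dist (Dvu y) (Dvu x) < e / 2"
      using ct(2) e unfolding continuous_at_eps_delta by (metis half_gt_zero)
    define m where "m = min r (min d1 d2)"
    \<comment> \<open>The 1 in the denominator excludes division by zero and makes
      \<open>t * norm u + t * norm v\<close> strictly less than \<open>m\<close>.\<close>
    define t where "t = m / (norm u + norm v + 1)"
    have m: "m > 0" using r d1 d2 by (simp add: m_def)
    have pos: "norm u + norm v + 1 > 0" by (smt (verit) norm_ge_zero)
    have t: "t > 0" "t * norm u + t * norm v < m"
    proof -
      show "t > 0" using m pos by (simp add: t_def)
      then have "t * norm u + t * norm v < t * (norm u + norm v + 1)" by (simp add: distrib_left)
      also have "\<dots> = m" using pos by (simp add: t_def)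
      finally show "t * norm u + t * norm v < m" .
    qed
    have near: "dist (x + p *\<^sub>R w + q *\<^sub>R w') x < m"
      if "0 \<le> p" "p \<le> t" "0 \<le> q" "q \<le> t" "t * norm w + t * norm w' < m" for p q w w'
    proof -
      have "norm (p *\<^sub>R w + q *\<^sub>R w') \<le> p * norm w + q * norm w'"
        using norm_triangle_ineq[of "p *\<^sub>R w" "q *\<^sub>R w'"] that by simp
      also have "\<dots> \<le> t * norm w + t * norm w'"
        using that by (intro add_mono mult_right_mono) auto
      also note that(5)
      finally show ?thesis by (simp add: dist_norm add.assoc)
    qed
    have sm: "smooth_on (ball x r) f" using smooth_on_subset assms(2) r(2) by blast
    have tr: "t * norm u + t * norm v < r" "t * norm v + t * norm u < r" using t(2) by (auto simp: m_def)
    obtain p q where pq: "0 \<le> p" "p \<le> t" "0 \<le> q" "q \<le> t" and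
      e1: "f (x + t *\<^sub>R u + t *\<^sub>R v) - f (x + t *\<^sub>R u) - f (x + t *\<^sub>R v) + f x =
        t * t * Duv (x + p *\<^sub>R u + q *\<^sub>R v)"
      using second_difference_mvt[OF sm t(1) tr(1)] unfolding Duv_def by blast
    obtain p' q' where pq': "0 \<le> p'" "p' \<le> t" "0 \<le> q'" "q' \<le> t" and
      e2: "f (x + t *\<^sub>R v + t *\<^sub>R u) - f (x + t *\<^sub>R v) - f (x + t *\<^sub>R u) + f x =
        t * t * Dvu (x + p' *\<^sub>R v + q' *\<^sub>R u)"
      using second_difference_mvt[OF sm t(1) tr(2)] unfolding Dvu_def by blast
    have "x + t *\<^sub>R v + t *\<^sub>R u = x + t *\<^sub>R u + t *\<^sub>R v" by (simp add: algebra_simps)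
    with e1 e2 have "t * t * Duv (x + p *\<^sub>R u + q *\<^sub>R v) = t * t * Dvu (x + p' *\<^sub>R v + q' *\<^sub>R u)"
      by (smt (verit))
    with t(1) have "Duv (x + p *\<^sub>R u + q *\<^sub>R v) = Dvu (x + p' *\<^sub>R v + q' *\<^sub>R u)" by simp
    moreover have "dist (Duv (x + p *\<^sub>R u + q *\<^sub>R v)) (Duv x) < e / 2"
      using d1(2) near[OF pq t(2)] by (simp add: m_def)
    moreover have "dist (Dvu (x + p' *\<^sub>R v + q' *\<^sub>R u)) (Dvu x) < e / 2"
      using d2(2) near[OF pq'] t(2) by (simp add: m_def add.commute)
    ultimately show ?thesis unfolding dist_real_def by linarith
  qed
  from this[of "\<bar>Duv x - Dvu x\<bar>"] have "Duv x = Dvu x" by force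
  then show ?thesis by (simp add: Duv_def Dvu_def)
qed

lemma second_derivative_symmetric:
  fixes f :: "'a::real_normed_vector \<Rightarrow> 'b::euclidean_space"
  assumes "open S" "smooth_on S f" "x \<in> S"
  shows "frechet_derivative (\<lambda>y. frechet_derivative f (at y) u) (at x) v =
    frechet_derivative (\<lambda>y. frechet_derivative f (at y) v) (at x) u"
proof (rule euclidean_eqI)
  fix b :: 'b
  have sm: "smooth_on S (\<lambda>y. f y \<bullet> b)" by (intro smooth_on_inner assms smooth_on_const)
  have inner: "frechet_derivative (\<lambda>y. h y \<bullet> b) (at y) w = frechet_derivative h (at y) w \<bullet> b"
    if "smooth_on S h" "y \<in> S" for h :: "'a \<Rightarrow> 'b" and y w
    using has_derivative_inner_left[OF smooth_on_has_derivative[OF that], of b] frechet_derivative_eq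
    by metis
  have "frechet_derivative (\<lambda>y. frechet_derivative f (at y) u) (at x) v \<bullet> b =
      frechet_derivative (\<lambda>y. frechet_derivative (\<lambda>y. f y \<bullet> b) (at y) u) (at x) v" for u v
  proof -
    have sd: "smooth_on S (\<lambda>y. frechet_derivative f (at y) u)"
      by (intro smooth_on_frechet_derivative assms)
    have "(\<lambda>y. frechet_derivative f (at y) u \<bullet> b) differentiable at x"
      by (rule smooth_on_differentiable[OF _ assms(3)])
        (intro smooth_on_inner smooth_on_const sd assms)
    then have "frechet_derivative (\<lambda>y. frechet_derivative f (at y) u \<bullet> b) (at x) =
        frechet_derivative (\<lambda>y. frechet_derivative (\<lambda>y. f y \<bullet> b) (at y) u) (at x)"
      by (rule frechet_derivative_transform_within_open[OF _ assms(1,3)])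
        (use inner assms in auto)
    then show ?thesis using inner[OF sd assms(3)] by metis
  qed
  then show "frechet_derivative (\<lambda>y. frechet_derivative f (at y) u) (at x) v \<bullet> b =
      frechet_derivative (\<lambda>y. frechet_derivative f (at y) v) (at x) u \<bullet> b"
    using second_derivative_symmetric_real[OF assms(1) sm assms(3)] by simp
qed

section \<open>Linear and bilinear maps depending on a point\<close>

lemma linear_family_expand:
  fixes L :: "'e::euclidean_space \<Rightarrow> 'b::real_normed_vector"
  shows "linear L \<Longrightarrow> L v = (\<Sum>b\<in>Basis. (v \<bullet> b) *\<^sub>R L b)"
  by (subst euclidean_representation[of v, symmetric])
    (simp only: linear_sum linear_scale)

text \<open>Tensors in a chart are given as differentiable only for fixed vector arguments.
  Expanding the argument in \<open>Basis\<close> yields the product rule for arguments that move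
  with the point.\<close>

lemma has_derivative_linear_family:
  fixes L :: "'a::real_normed_vector \<Rightarrow> 'e::euclidean_space \<Rightarrow> 'b::real_normed_vector"
  assumes "open S" "x \<in> S" "\<And>y. y \<in> S \<Longrightarrow> linear (L y)"
    "\<And>v. ((\<lambda>y. L y v) has_derivative L' v) (at x)" "(X has_derivative X') (at x)"
  shows "((\<lambda>y. L y (X y)) has_derivative (\<lambda>u. L' (X x) u + L x (X' u))) (at x)"
proof -
  note ex = linear_family_expand[OF assms(3)]
  have sum: "((\<lambda>y. \<Sum>b\<in>Basis. (Y y \<bullet> b) *\<^sub>R L y b) has_derivative
      (\<lambda>u. (\<Sum>b\<in>Basis. (Y x \<bullet> b) *\<^sub>R L' b u + (Y' u \<bullet> b) *\<^sub>R L x b))) (at x)"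
    if "(Y has_derivative Y') (at x)" for Y Y'
    using that assms(4) by (auto intro!: derivative_eq_intros)
  \<comment> \<open>No linearity of \<open>L'\<close> in its first argument is given; it is
    recovered here from the uniqueness of the derivative.\<close>
  have "((\<lambda>y. L y (X x)) has_derivative
      (\<lambda>u. (\<Sum>b\<in>Basis. (X x \<bullet> b) *\<^sub>R L' b u + (0 \<bullet> b) *\<^sub>R L x b))) (at x)"
    by (rule has_derivative_transform_within_open[OF sum assms(1,2)]) (auto simp: ex[symmetric])
  then have L': "L' (X x) = (\<lambda>u. \<Sum>b\<in>Basis. (X x \<bullet> b) *\<^sub>R L' b u)"
    using has_derivative_unique assms(4) by fastforce
  have "((\<lambda>y. L y (X y)) has_derivative
      (\<lambda>u. (\<Sum>b\<in>Basis. (X x \<bullet> b) *\<^sub>R L' b u + (X' u \<bullet> b) *\<^sub>R L x b))) (at x)"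
    by (rule has_derivative_transform_within_open[OF sum[OF assms(5)] assms(1,2)])
      (auto simp: ex[symmetric])
  then show ?thesis
    by (simp add: L' sum.distrib flip: ex[OF assms(2)])
qed

lemma has_derivative_bilinear_family:
  fixes B :: "'a::real_normed_vector \<Rightarrow> 'e::euclidean_space \<Rightarrow> 'f::euclidean_space \<Rightarrow> 'b::real_normed_vector"
  assumes "open S" "x \<in> S" "\<And>y. y \<in> S \<Longrightarrow> bilinear (B y)"
    "\<And>v w. (\<lambda>y. B y v w) differentiable (at x)"
    "(X has_derivative X') (at x)" "(Y has_derivative Y') (at x)"
  shows "((\<lambda>y. B y (X y) (Y y)) has_derivative
    (\<lambda>u. frechet_derivative (\<lambda>y. B y (X x) (Y x)) (at x) u + B x (X' u) (Y x) + B x (X x) (Y' u))) (at x)"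
proof -
  have lin: "linear (\<lambda>v. B y v w)" "linear (B y v)" if "y \<in> S" for y v w
    using assms(3)[OF that] by (auto simp: bilinear_def)
  have 1: "((\<lambda>y. B y (X y) w) has_derivative
      (\<lambda>u. frechet_derivative (\<lambda>y. B y (X x) w) (at x) u + B x (X' u) w)) (at x)" for w
    by (rule has_derivative_linear_family[where L = "\<lambda>y v. B y v w", OF assms(1,2) lin(1) _ assms(5)])
      (use assms(4) frechet_derivative_works in auto)
  show ?thesis
    by (rule has_derivative_linear_family[OF assms(1,2) lin(2) 1 assms(6)])
qed

lemma smooth_on_linear_family:
  fixes L :: "'a::real_normed_vector \<Rightarrow> 'e::euclidean_space \<Rightarrow> 'b::real_normed_vector"
  assumes "open S" "\<And>y. y \<in> S \<Longrightarrow> linear (L y)"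
    "\<And>v. smooth_on S (\<lambda>y. L y v)" "smooth_on S X"
  shows "smooth_on S (\<lambda>y. L y (X y))"
proof -
  have "smooth_on S (\<lambda>y. \<Sum>b\<in>Basis. (X y \<bullet> b) *\<^sub>R L y b)"
    by (intro smooth_on_intros assms)
  then show ?thesis
    using linear_family_expand[OF assms(2)] by (subst smooth_on_cong[OF assms(1)]) auto
qed

lemma smooth_on_bilinear_family:
  fixes B :: "'a::real_normed_vector \<Rightarrow> 'e::euclidean_space \<Rightarrow> 'f::euclidean_space \<Rightarrow> 'b::real_normed_vector"
  assumes "open S" "\<And>y. y \<in> S \<Longrightarrow> bilinear (B y)"
    "\<And>v w. smooth_on S (\<lambda>y. B y v w)" "smooth_on S X" "smooth_on S Y"
  shows "smooth_on S (\<lambda>y. B y (X y) (Y y))"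
proof -
  have lin: "linear (\<lambda>v. B y v w)" "linear (B y v)" if "y \<in> S" for y v w
    using assms(2)[OF that] by (auto simp: bilinear_def)
  have "smooth_on S (\<lambda>y. B y (X y) w)" for w
    by (rule smooth_on_linear_family[where L = "\<lambda>y v. B y v w", OF assms(1) lin(1) assms(3,4)])
  then show ?thesis
    using smooth_on_linear_family[where L = "\<lambda>y. B y (X y)", OF assms(1) lin(2) _ assms(5)] by blast
qed

subsection \<open>Kaehler geometry in one chart\<close>

lemma linear_frechet_derivative_family:
  fixes L :: "'a::real_normed_vector \<Rightarrow> 'e::real_vector \<Rightarrow> 'b::real_normed_vector"
  assumes "open S" "x \<in> S" and lin: "\<And>y. y \<in> S \<Longrightarrow> linear (L y)"
    and diff: "\<And>v. (\<lambda>y. L y v) differentiable (at x)"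
  shows "linear (\<lambda>v. frechet_derivative (\<lambda>y. L y v) (at x) u)"
proof (rule linearI)
  note d = diff[unfolded frechet_derivative_works]
  have t: "frechet_derivative (\<lambda>y. L y v) (at x) = frechet_derivative g (at x)"
    if "\<And>y. y \<in> S \<Longrightarrow> L y v = g y" for v g
    by (rule frechet_derivative_transform_within_open[OF diff assms(1,2) that])
  show "frechet_derivative (\<lambda>y. L y (v + w)) (at x) u =
      frechet_derivative (\<lambda>y. L y v) (at x) u + frechet_derivative (\<lambda>y. L y w) (at x) u" for v w
    using frechet_derivative_eq[OF has_derivative_add[OF d d], of v w]
    by (simp add: t[of "v + w" "\<lambda>y. L y v + L y w"] linear_add[OF lin])
  show "frechet_derivative (\<lambda>y. L y (c *\<^sub>R v)) (at x) u =
      c *\<^sub>R frechet_derivative (\<lambda>y. L y v) (at x) u" for c v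
    using frechet_derivative_eq[OF has_derivative_scaleR_right[OF d], of c v]
    by (simp add: t[of "c *\<^sub>R v" "\<lambda>y. c *\<^sub>R L y v"] linear_scale[OF lin])
qed

lemma covd_const: "covd \<Gamma> (\<lambda>_. u) Z x = frechet_derivative Z (at x) u + \<Gamma> x u (Z x)"
  by (simp add: covd_def)

lemma riem_eq:
  assumes "bilinear (\<Gamma> x)"
  shows "riem \<Gamma> x u v w = frechet_derivative (\<lambda>y. \<Gamma> y v w) (at x) u -
    frechet_derivative (\<lambda>y. \<Gamma> y u w) (at x) v + \<Gamma> x u (\<Gamma> x v w) - \<Gamma> x v (\<Gamma> x u w)"
proof -
  have "covd \<Gamma> (\<lambda>_. v) (\<lambda>_. w) = (\<lambda>y. \<Gamma> y v w)" for v w by (simp add: covd_def fun_eq_iff)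
  then show ?thesis
    using bilinear_lzero[OF assms] by (simp add: riem_def curvature_def covd_def lie_bracket_def)
qed

text \<open>Second derivatives of \<open>Z\<close> cancel by symmetry and constant fields have no
  bracket, which leaves the curvature. Stated for arbitrary bilinear symbols because it serves two
  connections: that of a chart and the pullback connection of a chart change.\<close>

lemma covd_commutator:
  fixes \<Gamma> :: "'e::euclidean_space \<Rightarrow> 'e \<Rightarrow> 'e \<Rightarrow> 'e"
  assumes S: "open S" "x \<in> S" and bil: "\<And>y. y \<in> S \<Longrightarrow> bilinear (\<Gamma> y)"
    and diff: "\<And>u v. (\<lambda>y. \<Gamma> y u v) differentiable (at x)" and Z: "smooth_on S Z"
  shows "covd \<Gamma> (\<lambda>_. u) (covd \<Gamma> (\<lambda>_. v) Z) x - covd \<Gamma> (\<lambda>_. v) (covd \<Gamma> (\<lambda>_. u) Z) x =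
    riem \<Gamma> x u v (Z x)"
proof -
  have lin: "linear (\<Gamma> y v)" if "y \<in> S" for y v
    using bil[OF that] by (simp add: bilinear_def)
  have d: "frechet_derivative (covd \<Gamma> (\<lambda>_. v) Z) (at x) =
      (\<lambda>u. frechet_derivative (\<lambda>y. frechet_derivative Z (at y) v) (at x) u +
        (frechet_derivative (\<lambda>y. \<Gamma> y v (Z x)) (at x) u + \<Gamma> x v (frechet_derivative Z (at x) u)))" for v
    unfolding covd_const
    by (intro frechet_derivative_eq has_derivative_add has_derivative_linear_family[OF S lin]
        smooth_on_has_derivative[OF smooth_on_frechet_derivative[OF Z] S(2)]
        smooth_on_has_derivative[OF Z S(2)] diff[unfolded frechet_derivative_works])
  show ?thesis
    unfolding covd_const[of \<Gamma> _ "covd \<Gamma> _ Z"] d unfolding covd_const riem_eq[where \<Gamma> = \<Gamma>, OF bil[OF S(2)]]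
    using second_derivative_symmetric[OF S(1) Z S(2), of u v]
    by (simp add: linear_add[OF lin[OF S(2)]])
qed

text \<open>The conditions on a Kaehler manifold in one chart, each evaluated on constant vector
  fields: absence of torsion becomes symmetry of the symbols, and the parallelism of metric and
  complex structure becomes an identity for the derivatives of their components. The statements for
  varying fields are recovered from the product rule.\<close>

locale kaehler_chart =
  fixes S :: "'e::euclidean_space set" and G :: "'e \<Rightarrow> 'e \<Rightarrow> 'e \<Rightarrow> real"
    and J :: "'e \<Rightarrow> 'e \<Rightarrow> 'e" and \<Gamma> :: "'e \<Rightarrow> 'e \<Rightarrow> 'e \<Rightarrow> 'e"
  assumes open_S: "open S"
    and G_smooth: "\<And>u v. smooth_on S (\<lambda>x. G x u v)"
    and G_bilinear: "\<And>x. x \<in> S \<Longrightarrow> bilinear (G x)"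
    and G_sym: "\<And>x u v. x \<in> S \<Longrightarrow> G x u v = G x v u"
    and G_pos: "\<And>x u. x \<in> S \<Longrightarrow> u \<noteq> 0 \<Longrightarrow> G x u u > 0"
    and J_smooth: "\<And>u. smooth_on S (\<lambda>x. J x u)"
    and J_linear: "\<And>x. x \<in> S \<Longrightarrow> linear (J x)"
    and J_J: "\<And>x u. x \<in> S \<Longrightarrow> J x (J x u) = - u"
    and \<Gamma>_smooth: "\<And>u v. smooth_on S (\<lambda>x. \<Gamma> x u v)"
    and \<Gamma>_bilinear: "\<And>x. x \<in> S \<Longrightarrow> bilinear (\<Gamma> x)"
    and \<Gamma>_sym: "\<And>x u v. x \<in> S \<Longrightarrow> \<Gamma> x u v = \<Gamma> x v u"
    and G_parallel: "\<And>x u v w. x \<in> S \<Longrightarrow>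
      frechet_derivative (\<lambda>y. G y v w) (at x) u = G x (\<Gamma> x u v) w + G x v (\<Gamma> x u w)"
    and G_J_J: "\<And>x u v. x \<in> S \<Longrightarrow> G x (J x u) (J x v) = G x u v"
    and J_parallel: "\<And>x u v. x \<in> S \<Longrightarrow>
      frechet_derivative (\<lambda>y. J y v) (at x) u + \<Gamma> x u (J x v) = J x (\<Gamma> x u v)"
begin

lemma G_lin:
  assumes "x \<in> S"
  shows "G x (u + v) w = G x u w + G x v w" "G x w (u + v) = G x w u + G x w v"
    "G x (u - v) w = G x u w - G x v w" "G x w (u - v) = G x w u - G x w v"
    "G x (- u) w = - G x u w" "G x w (- u) = - G x w u"
    "G x (c *\<^sub>R u) w = c * G x u w" "G x w (c *\<^sub>R u) = c * G x w u"
    "G x 0 w = 0" "G x w 0 = 0"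
  using G_bilinear[OF assms]
  by (simp_all add: bilinear_ladd bilinear_radd bilinear_lsub bilinear_rsub bilinear_lneg
      bilinear_rneg bilinear_lmul bilinear_rmul bilinear_lzero bilinear_rzero)

lemma G_sum:
  assumes "x \<in> S"
  shows "G x (sum f I) w = (\<Sum>i\<in>I. G x (f i) w)" "G x w (sum f I) = (\<Sum>i\<in>I. G x w (f i))"
  using G_bilinear[OF assms] linear_sum unfolding bilinear_def by blast+

lemma J_lin:
  assumes "x \<in> S"
  shows "J x (u + v) = J x u + J x v" "J x (u - v) = J x u - J x v" "J x (- u) = - J x u"
    "J x (c *\<^sub>R u) = c *\<^sub>R J x u" "J x 0 = 0"
  using J_linear[OF assms] by (simp_all add: linear_add linear_diff linear_neg linear_scale linear_0)

lemma \<Gamma>_lin: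
  assumes "x \<in> S"
  shows "\<Gamma> x (u + v) w = \<Gamma> x u w + \<Gamma> x v w" "\<Gamma> x w (u + v) = \<Gamma> x w u + \<Gamma> x w v"
    "\<Gamma> x (u - v) w = \<Gamma> x u w - \<Gamma> x v w" "\<Gamma> x w (u - v) = \<Gamma> x w u - \<Gamma> x w v"
    "\<Gamma> x (- u) w = - \<Gamma> x u w" "\<Gamma> x w (- u) = - \<Gamma> x w u"
    "\<Gamma> x (c *\<^sub>R u) w = c *\<^sub>R \<Gamma> x u w" "\<Gamma> x w (c *\<^sub>R u) = c *\<^sub>R \<Gamma> x w u"
    "\<Gamma> x 0 w = 0" "\<Gamma> x w 0 = 0"
  using \<Gamma>_bilinear[OF assms]
  by (simp_all add: bilinear_ladd bilinear_radd bilinear_lsub bilinear_rsub bilinear_lneg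
      bilinear_rneg bilinear_lmul bilinear_rmul bilinear_lzero bilinear_rzero)

lemma \<Gamma>_linear: "x \<in> S \<Longrightarrow> linear (\<Gamma> x u)" "x \<in> S \<Longrightarrow> linear (\<lambda>u. \<Gamma> x u v)"
  using \<Gamma>_bilinear by (auto simp: bilinear_def)

lemma G_eqI: "x \<in> S \<Longrightarrow> (\<And>w. G x u w = G x v w) \<Longrightarrow> u = v"
  using G_pos[of x "u - v"] by (fastforce simp: G_lin)

lemma G_J: "x \<in> S \<Longrightarrow> G x (J x u) v = - G x u (J x v)"
  using G_J_J[of x u "J x v"] by (simp add: J_J G_lin)

lemma G_J_self: "x \<in> S \<Longrightarrow> G x (J x u) u = 0" "x \<in> S \<Longrightarrow> G x u (J x u) = 0"
  using G_J[of x u u] G_sym[of x "J x u" u] by auto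

lemma G_nonneg: "x \<in> S \<Longrightarrow> G x u u \<ge> 0"
  using G_pos[of x u] by (cases "u = 0") (auto simp: G_lin)

lemma J_inj: "x \<in> S \<Longrightarrow> J x u = 0 \<longleftrightarrow> u = 0"
  by (metis J_J J_lin(5) neg_0_equal_iff_equal)

lemma smooth_G: "smooth_on S X \<Longrightarrow> smooth_on S Y \<Longrightarrow> smooth_on S (\<lambda>y. G y (X y) (Y y))"
  by (rule smooth_on_bilinear_family[OF open_S G_bilinear G_smooth])

lemma smooth_\<Gamma>: "smooth_on S X \<Longrightarrow> smooth_on S Y \<Longrightarrow> smooth_on S (\<lambda>y. \<Gamma> y (X y) (Y y))"
  by (rule smooth_on_bilinear_family[OF open_S \<Gamma>_bilinear \<Gamma>_smooth])

lemma smooth_J: "smooth_on S X \<Longrightarrow> smooth_on S (\<lambda>y. J y (X y))"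
  by (rule smooth_on_linear_family[OF open_S J_linear J_smooth])

lemma smooth_directional:
  fixes f :: "'e \<Rightarrow> 'b::real_normed_vector"
  assumes "smooth_on S f" "smooth_on S X"
  shows "smooth_on S (\<lambda>y. frechet_derivative f (at y) (X y))"
  by (rule smooth_on_linear_family[OF open_S _ smooth_on_frechet_derivative[OF assms(1)] assms(2)])
    (intro linear_frechet_derivative smooth_on_differentiable[OF assms(1)])

lemma smooth_covd: "smooth_on S X \<Longrightarrow> smooth_on S Y \<Longrightarrow> smooth_on S (covd \<Gamma> X Y)"
  unfolding covd_def by (intro smooth_on_add open_S smooth_directional smooth_\<Gamma>)

lemma linear_\<Gamma>_derivative:
  assumes "x \<in> S"
  shows "linear (\<lambda>w. frechet_derivative (\<lambda>z. \<Gamma> z v w) (at x) u)"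
    "linear (\<lambda>v. frechet_derivative (\<lambda>z. \<Gamma> z v w) (at x) u)"
  using linear_frechet_derivative_family[where L = "\<lambda>z w. \<Gamma> z v w", OF open_S assms \<Gamma>_linear(1)]
    linear_frechet_derivative_family[where L = "\<lambda>z v. \<Gamma> z v w", OF open_S assms \<Gamma>_linear(2)]
    smooth_on_differentiable[OF \<Gamma>_smooth assms] by blast+

lemma smooth_riem:
  assumes "smooth_on S X" "smooth_on S Y" "smooth_on S Z"
  shows "smooth_on S (\<lambda>y. riem \<Gamma> y (X y) (Y y) (Z y))"
proof -
  have D: "smooth_on S (\<lambda>y. frechet_derivative (\<lambda>z. \<Gamma> z (Y y) (Z y)) (at y) (X y))"
    if "smooth_on S X" "smooth_on S Y" "smooth_on S Z" for X Y Z
  proof -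
    note lin = linear_\<Gamma>_derivative
    have "smooth_on S (\<lambda>y. frechet_derivative (\<lambda>z. \<Gamma> z (Y y) (Z y)) (at y) u)" for u
      by (rule smooth_on_bilinear_family[where B = "\<lambda>y v w. frechet_derivative (\<lambda>z. \<Gamma> z v w) (at y) u",
            OF open_S _ smooth_on_frechet_derivative[OF \<Gamma>_smooth] that(2,3)])
        (simp add: bilinear_def lin)
    from smooth_on_linear_family[where L = "\<lambda>y. frechet_derivative (\<lambda>z. \<Gamma> z (Y y) (Z y)) (at y)",
            OF open_S _ this that(1)]
    show ?thesis using linear_frechet_derivative smooth_on_differentiable[OF \<Gamma>_smooth] by blast
  qed
  have "smooth_on S (\<lambda>x. frechet_derivative (\<lambda>y. \<Gamma> y (Y x) (Z x)) (at x) (X x) -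
    frechet_derivative (\<lambda>y. \<Gamma> y (X x) (Z x)) (at x) (Y x) + \<Gamma> x (X x) (\<Gamma> x (Y x) (Z x)) -
    \<Gamma> x (Y x) (\<Gamma> x (X x) (Z x)))"
    by (intro smooth_on_diff smooth_on_add open_S D smooth_\<Gamma> assms)
  then show ?thesis
    by (subst smooth_on_cong[OF open_S, OF riem_eq[where \<Gamma> = \<Gamma>, OF \<Gamma>_bilinear]])
qed

lemma smooth_riem4:
  "smooth_on S X \<Longrightarrow> smooth_on S Y \<Longrightarrow> smooth_on S Z \<Longrightarrow> smooth_on S W \<Longrightarrow>
    smooth_on S (\<lambda>y. riem4 G \<Gamma> y (X y) (Y y) (Z y) (W y))"
  unfolding riem4_def by (intro smooth_G smooth_riem)

lemma G_has_derivative: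
  assumes "x \<in> S" "X differentiable (at x)" "Y differentiable (at x)"
  shows "((\<lambda>y. G y (X y) (Y y)) has_derivative
    (\<lambda>u. G x (covd \<Gamma> (\<lambda>_. u) X x) (Y x) + G x (X x) (covd \<Gamma> (\<lambda>_. u) Y x))) (at x)"
  using has_derivative_bilinear_family[OF open_S assms(1) G_bilinear
      smooth_on_differentiable[OF G_smooth assms(1)] assms(2,3)[unfolded frechet_derivative_works]]
  by (simp add: G_parallel covd_const G_lin assms(1) algebra_simps)

lemma J_has_derivative:
  assumes "x \<in> S" "X differentiable (at x)"
  shows "((\<lambda>y. J y (X y)) has_derivative
    (\<lambda>u. J x (covd \<Gamma> (\<lambda>_. u) X x) - \<Gamma> x u (J x (X x)))) (at x)"
  using has_derivative_linear_family[OF open_S assms(1) J_linear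
      smooth_on_has_derivative[OF J_smooth assms(1)] assms(2)[unfolded frechet_derivative_works]]
    J_parallel[OF assms(1), of "X x", symmetric]
  by (simp add: covd_const J_lin assms(1) algebra_simps)

lemma covd_J:
  assumes "x \<in> S" "X differentiable (at x)"
  shows "covd \<Gamma> (\<lambda>_. u) (\<lambda>y. J y (X y)) x = J x (covd \<Gamma> (\<lambda>_. u) X x)"
  using frechet_derivative_eq[OF J_has_derivative[OF assms]] by (simp add: covd_const)

section \<open>Symmetries of the curvature tensor and the Bianchi identities\<close>

lemma riem_antisym: "x \<in> S \<Longrightarrow> riem \<Gamma> x u v w = - riem \<Gamma> x v u w"
  by (simp add: riem_eq \<Gamma>_bilinear)

lemma riem_first_bianchi: "x \<in> S \<Longrightarrow> riem \<Gamma> x u v w + riem \<Gamma> x v w u + riem \<Gamma> x w u v = 0"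
proof -
  assume x: "x \<in> S"
  have "frechet_derivative (\<lambda>y. \<Gamma> y v w) (at x) = frechet_derivative (\<lambda>y. \<Gamma> y w v) (at x)" for v w
    by (rule frechet_derivative_transform_within_open[OF smooth_on_differentiable[OF \<Gamma>_smooth x] open_S x])
      (rule \<Gamma>_sym)
  then show ?thesis
    using \<Gamma>_sym[OF x, of u v] \<Gamma>_sym[OF x, of u w] \<Gamma>_sym[OF x, of v w]
    by (simp add: riem_eq[where \<Gamma> = \<Gamma>, OF \<Gamma>_bilinear[OF x]])
qed

lemma linear_riem:
  assumes x: "x \<in> S"
  shows "linear (\<lambda>u. riem \<Gamma> x u v w)" "linear (\<lambda>v. riem \<Gamma> x u v w)" "linear (\<lambda>w. riem \<Gamma> x u v w)"
  unfolding riem_eq[where \<Gamma> = \<Gamma>, OF \<Gamma>_bilinear[OF x]]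
  by (intro linear_compose_sub linear_compose_add linear_\<Gamma>_derivative \<Gamma>_linear x
      linear_frechet_derivative smooth_on_differentiable[OF \<Gamma>_smooth]
      linear_compose[OF \<Gamma>_linear(1)[OF x] \<Gamma>_linear(1)[OF x], unfolded o_def]
      linear_compose[OF \<Gamma>_linear(2)[OF x] \<Gamma>_linear(1)[OF x], unfolded o_def]
      linear_compose[OF \<Gamma>_linear(1)[OF x] \<Gamma>_linear(2)[OF x], unfolded o_def])+

lemma riem4_lin:
  assumes "x \<in> S"
  shows "riem4 G \<Gamma> x (u + u') v w z = riem4 G \<Gamma> x u v w z + riem4 G \<Gamma> x u' v w z"
    "riem4 G \<Gamma> x u (v + v') w z = riem4 G \<Gamma> x u v w z + riem4 G \<Gamma> x u v' w z"
    "riem4 G \<Gamma> x u v (w + w') z = riem4 G \<Gamma> x u v w z + riem4 G \<Gamma> x u v w' z"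
    "riem4 G \<Gamma> x u v w (z + z') = riem4 G \<Gamma> x u v w z + riem4 G \<Gamma> x u v w z'"
    "riem4 G \<Gamma> x (c *\<^sub>R u) v w z = c * riem4 G \<Gamma> x u v w z"
    "riem4 G \<Gamma> x u (c *\<^sub>R v) w z = c * riem4 G \<Gamma> x u v w z"
    "riem4 G \<Gamma> x u v (c *\<^sub>R w) z = c * riem4 G \<Gamma> x u v w z"
    "riem4 G \<Gamma> x u v w (c *\<^sub>R z) = c * riem4 G \<Gamma> x u v w z"
    "riem4 G \<Gamma> x (- u) v w z = - riem4 G \<Gamma> x u v w z"
    "riem4 G \<Gamma> x u (- v) w z = - riem4 G \<Gamma> x u v w z"
    "riem4 G \<Gamma> x u v (- w) z = - riem4 G \<Gamma> x u v w z"
    "riem4 G \<Gamma> x u v w (- z) = - riem4 G \<Gamma> x u v w z"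
  unfolding riem4_def
  by (simp_all add: G_lin assms linear_add[OF linear_riem(1)] linear_add[OF linear_riem(2)]
      linear_add[OF linear_riem(3)] linear_scale[OF linear_riem(1)] linear_scale[OF linear_riem(2)]
      linear_scale[OF linear_riem(3)] linear_neg[OF linear_riem(1)] linear_neg[OF linear_riem(2)]
      linear_neg[OF linear_riem(3)])

lemma covd_cong:
  assumes "x \<in> S" "X differentiable (at x)" "\<And>y. y \<in> S \<Longrightarrow> X y = Y y"
  shows "covd \<Gamma> (\<lambda>_. u) X x = covd \<Gamma> (\<lambda>_. u) Y x"
  using frechet_derivative_transform_within_open[OF assms(2) open_S assms(1,3)] assms(1,3)
  by (simp add: covd_const)

lemma riem_covd:
  "x \<in> S \<Longrightarrow> smooth_on S Z \<Longrightarrow>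
    covd \<Gamma> (\<lambda>_. u) (covd \<Gamma> (\<lambda>_. v) Z) x - covd \<Gamma> (\<lambda>_. v) (covd \<Gamma> (\<lambda>_. u) Z) x =
    riem \<Gamma> x u v (Z x)"
  by (rule covd_commutator[OF open_S _ \<Gamma>_bilinear smooth_on_differentiable[OF \<Gamma>_smooth]])

text \<open>\<open>J\<close> commutes with each covariant derivative, hence with their
  commutator.\<close>

lemma riem_J:
  assumes x: "x \<in> S"
  shows "riem \<Gamma> x u v (J x w) = J x (riem \<Gamma> x u v w)"
proof -
  have sm: "smooth_on S (covd \<Gamma> (\<lambda>_. v) (\<lambda>_. w))" for v w by (intro smooth_covd smooth_on_const)
  have "covd \<Gamma> (\<lambda>_. u) (covd \<Gamma> (\<lambda>_. v) (\<lambda>y. J y w)) x =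
      J x (covd \<Gamma> (\<lambda>_. u) (covd \<Gamma> (\<lambda>_. v) (\<lambda>_. w)) x)" for u v
  proof -
    have "covd \<Gamma> (\<lambda>_. u) (covd \<Gamma> (\<lambda>_. v) (\<lambda>y. J y w)) x =
        covd \<Gamma> (\<lambda>_. u) (\<lambda>y. J y (covd \<Gamma> (\<lambda>_. v) (\<lambda>_. w) y)) x"
      by (rule covd_cong[OF x smooth_on_differentiable[OF _ x]])
        (auto intro!: smooth_covd smooth_J covd_J)
    then show ?thesis using covd_J[OF x smooth_on_differentiable[OF sm x]] by simp
  qed
  then show ?thesis
    using riem_covd[OF x smooth_J[OF smooth_on_const], of u v w, symmetric]
      riem_covd[OF x smooth_on_const, of u v w, symmetric]
    by (simp add: J_lin x)
qed

lemma riem4_antisym12: "x \<in> S \<Longrightarrow> riem4 G \<Gamma> x u v w z = - riem4 G \<Gamma> x v u w z"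
  unfolding riem4_def by (subst riem_antisym) (simp_all add: G_lin)

text \<open>The second derivatives of the function \<open>G y w z\<close> commute. Written with
  covariant derivatives, the products of first-order terms are symmetric in \<open>u\<close> and
  \<open>v\<close> and drop out.\<close>

lemma riem4_antisym34:
  assumes x: "x \<in> S"
  shows "riem4 G \<Gamma> x u v w z = - riem4 G \<Gamma> x u v z w"
proof -
  let ?c = "\<lambda>v w. covd \<Gamma> (\<lambda>_. v) (\<lambda>_. w)"
  have sm: "smooth_on S (?c v w)" for v w by (intro smooth_covd smooth_on_const)
  have d: "frechet_derivative (\<lambda>y. G y w z) (at y) v = G y (?c v w y) z + G y w (?c v z y)"
    if "y \<in> S" for y v
    using G_parallel[OF that] by (simp add: covd_def)
  have "frechet_derivative (\<lambda>y. frechet_derivative (\<lambda>y. G y w z) (at y) v) (at x) =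
      frechet_derivative (\<lambda>y. G y (?c v w y) z + G y w (?c v z y)) (at x)" for v
    by (rule frechet_derivative_transform_within_open[OF _ open_S x d])
      (rule smooth_on_differentiable[OF smooth_on_frechet_derivative[OF G_smooth] x])
  moreover have "frechet_derivative (\<lambda>y. G y (?c v w y) z + G y w (?c v z y)) (at x) u =
      G x (covd \<Gamma> (\<lambda>_. u) (?c v w) x) z + G x (?c v w x) (?c u z x) +
      (G x (?c u w x) (?c v z x) + G x w (covd \<Gamma> (\<lambda>_. u) (?c v z) x))" for u v
    by (subst frechet_derivative_eq[OF has_derivative_add[OF
            G_has_derivative[OF x smooth_on_differentiable[OF sm x] smooth_on_differentiable[OF smooth_on_const x]]
            G_has_derivative[OF x smooth_on_differentiable[OF smooth_on_const x] smooth_on_differentiable[OF sm x]]]]) simp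
  ultimately have "G x (covd \<Gamma> (\<lambda>_. u) (?c v w) x) z + G x w (covd \<Gamma> (\<lambda>_. u) (?c v z) x) =
      G x (covd \<Gamma> (\<lambda>_. v) (?c u w) x) z + G x w (covd \<Gamma> (\<lambda>_. v) (?c u z) x)"
    using second_derivative_symmetric[OF open_S G_smooth x, of w z u v] by simp
  then show ?thesis
    using riem_covd[OF x smooth_on_const, of u v w, symmetric]
      riem_covd[OF x smooth_on_const, of u v z, symmetric] G_sym[OF x]
    by (simp add: riem4_def G_lin x)
qed

lemma riem4_first_bianchi:
  "x \<in> S \<Longrightarrow> riem4 G \<Gamma> x u v w z + riem4 G \<Gamma> x v w u z + riem4 G \<Gamma> x w u v z = 0"
  unfolding riem4_def by (simp add: riem_first_bianchi G_lin flip: G_lin(1))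

text \<open>The classical octahedron argument: four cyclic identities combined with the skew
  symmetry in both pairs.\<close>

lemma riem4_pair_sym:
  assumes x: "x \<in> S"
  shows "riem4 G \<Gamma> x u v w z = riem4 G \<Gamma> x w z u v"
  using riem4_first_bianchi[OF x, of u v w z] riem4_first_bianchi[OF x, of v w z u]
    riem4_first_bianchi[OF x, of w z u v] riem4_first_bianchi[OF x, of z u v w]
    riem4_antisym12[OF x] riem4_antisym34[OF x]
  by (smt (verit))

lemma riem4_J34:
  "x \<in> S \<Longrightarrow> riem4 G \<Gamma> x u v (J x w) (J x z) = riem4 G \<Gamma> x u v w z"
  by (simp add: riem4_def riem_J G_J_J)

lemma riem4_J12:
  "x \<in> S \<Longrightarrow> riem4 G \<Gamma> x (J x u) (J x v) w z = riem4 G \<Gamma> x u v w z"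
  by (metis riem4_J34 riem4_pair_sym)

text \<open>The full covariant derivative of the curvature also has terms with a Christoffel symbol
  in the first two slots. They cancel in the cyclic sum by symmetry of the symbols and are left out
  from the start.\<close>

lemma riem_second_bianchi:
  assumes x: "x \<in> S"
  shows "frechet_derivative (\<lambda>y. riem \<Gamma> y v w z) (at x) u + \<Gamma> x u (riem \<Gamma> x v w z) - riem \<Gamma> x v w (\<Gamma> x u z) +
    (frechet_derivative (\<lambda>y. riem \<Gamma> y w u z) (at x) v + \<Gamma> x v (riem \<Gamma> x w u z) - riem \<Gamma> x w u (\<Gamma> x v z)) +
    (frechet_derivative (\<lambda>y. riem \<Gamma> y u v z) (at x) w + \<Gamma> x w (riem \<Gamma> x u v z) - riem \<Gamma> x u v (\<Gamma> x w z)) = 0"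
proof -
  have d: "frechet_derivative (\<lambda>y. riem \<Gamma> y v w z) (at x) u =
      frechet_derivative (\<lambda>y. frechet_derivative (\<lambda>y. \<Gamma> y w z) (at y) v) (at x) u -
      frechet_derivative (\<lambda>y. frechet_derivative (\<lambda>y. \<Gamma> y v z) (at y) w) (at x) u +
      (frechet_derivative (\<lambda>y. \<Gamma> y v (\<Gamma> x w z)) (at x) u + \<Gamma> x v (frechet_derivative (\<lambda>y. \<Gamma> y w z) (at x) u)) -
      (frechet_derivative (\<lambda>y. \<Gamma> y w (\<Gamma> x v z)) (at x) u + \<Gamma> x w (frechet_derivative (\<lambda>y. \<Gamma> y v z) (at x) u))"
    for u v w
  proof -
    have h: "((\<lambda>y. \<Gamma> y v w) has_derivative frechet_derivative (\<lambda>y. \<Gamma> y v w) (at x)) (at x)" for v w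
      by (rule smooth_on_has_derivative[OF \<Gamma>_smooth x])
    have "((\<lambda>y. frechet_derivative (\<lambda>y. \<Gamma> y w z) (at y) v - frechet_derivative (\<lambda>y. \<Gamma> y v z) (at y) w
        + \<Gamma> y v (\<Gamma> y w z) - \<Gamma> y w (\<Gamma> y v z)) has_derivative
        (\<lambda>u. frechet_derivative (\<lambda>y. frechet_derivative (\<lambda>y. \<Gamma> y w z) (at y) v) (at x) u -
      frechet_derivative (\<lambda>y. frechet_derivative (\<lambda>y. \<Gamma> y v z) (at y) w) (at x) u +
      (frechet_derivative (\<lambda>y. \<Gamma> y v (\<Gamma> x w z)) (at x) u + \<Gamma> x v (frechet_derivative (\<lambda>y. \<Gamma> y w z) (at x) u)) -
      (frechet_derivative (\<lambda>y. \<Gamma> y w (\<Gamma> x v z)) (at x) u + \<Gamma> x w (frechet_derivative (\<lambda>y. \<Gamma> y v z) (at x) u))))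
      (at x)"
      by (intro has_derivative_diff has_derivative_add
          smooth_on_has_derivative[OF smooth_on_frechet_derivative[OF \<Gamma>_smooth] x]
          has_derivative_linear_family[OF open_S x \<Gamma>_linear(1) h h])
    then have "((\<lambda>y. riem \<Gamma> y v w z) has_derivative
        (\<lambda>u. frechet_derivative (\<lambda>y. frechet_derivative (\<lambda>y. \<Gamma> y w z) (at y) v) (at x) u -
      frechet_derivative (\<lambda>y. frechet_derivative (\<lambda>y. \<Gamma> y v z) (at y) w) (at x) u +
      (frechet_derivative (\<lambda>y. \<Gamma> y v (\<Gamma> x w z)) (at x) u + \<Gamma> x v (frechet_derivative (\<lambda>y. \<Gamma> y w z) (at x) u)) -
      (frechet_derivative (\<lambda>y. \<Gamma> y w (\<Gamma> x v z)) (at x) u + \<Gamma> x w (frechet_derivative (\<lambda>y. \<Gamma> y v z) (at x) u))))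
      (at x)"
      by (rule has_derivative_transform_within_open[OF _ open_S x])
        (simp add: riem_eq[where \<Gamma> = \<Gamma>, OF \<Gamma>_bilinear])
    then show ?thesis by (simp add: frechet_derivative_eq)
  qed
  have sym: "frechet_derivative (\<lambda>y. frechet_derivative (\<lambda>y. \<Gamma> y v w) (at y) u) (at x) u' =
      frechet_derivative (\<lambda>y. frechet_derivative (\<lambda>y. \<Gamma> y v w) (at y) u') (at x) u" for v w u u'
    by (rule second_derivative_symmetric[OF open_S \<Gamma>_smooth x])
  show ?thesis
    unfolding d riem_eq[where \<Gamma> = \<Gamma>, OF \<Gamma>_bilinear[OF x]]
    by (simp add: \<Gamma>_lin x sym[of v z u w] sym[of w z u v] sym[of u z v w])
qed

lemma riem4_second_bianchi:
  fixes z t :: 'e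
  assumes x: "x \<in> S"
  defines "D \<equiv> \<lambda>u v w. frechet_derivative (\<lambda>y. riem4 G \<Gamma> y v w z t) (at x) u -
    riem4 G \<Gamma> x v w (\<Gamma> x u z) t - riem4 G \<Gamma> x v w z (\<Gamma> x u t)"
  shows "D u v w + D v w u + D w u v = 0"
proof -
  have "D u v w = G x (frechet_derivative (\<lambda>y. riem \<Gamma> y v w z) (at x) u +
      \<Gamma> x u (riem \<Gamma> x v w z) - riem \<Gamma> x v w (\<Gamma> x u z)) t" for u v w
  proof -
    have "(\<lambda>y. riem \<Gamma> y v w z) differentiable at x"
      by (intro smooth_on_differentiable[OF _ x] smooth_riem smooth_on_const)
    from frechet_derivative_eq[OF G_has_derivative[OF x this differentiable_const]]
    show ?thesis by (simp add: D_def riem4_def covd_const G_lin x)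
  qed
  then show ?thesis
    using riem_second_bianchi[OF x, of v w z u] by (simp add: G_lin(9) x flip: G_lin(1)[OF x])
qed

section \<open>Orthonormal bases, traces and smooth frames\<close>

lemma orthonormal_independent:
  assumes x: "x \<in> S" and B: "\<And>u v. u \<in> B \<Longrightarrow> v \<in> B \<Longrightarrow> G x u v = (if u = v then 1 else 0)"
  shows "independent B"
proof
  assume "dependent B"
  then obtain t c where t: "finite t" "t \<subseteq> B" "(\<Sum>v\<in>t. c v *\<^sub>R v) = 0" "\<exists>v\<in>t. c v \<noteq> 0"
    unfolding dependent_explicit by auto
  then obtain v where v: "v \<in> t" "c v \<noteq> 0" by blast
  have "0 = G x (\<Sum>u\<in>t. c u *\<^sub>R u) v" by (simp add: t(3) G_lin x)
  also have "\<dots> = (\<Sum>u\<in>t. if u = v then c u else 0)"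
    using t(2) v(1) by (auto simp: G_sum G_lin x B subset_iff intro!: sum.cong)
  also have "\<dots> = c v" using t(1) v(1) by simp
  finally show False using v(2) by simp
qed

lemma orthonormal_finite:
  assumes x: "x \<in> S" and B: "orthonormal_basis G x B"
  shows "finite B" "card B = DIM('e)"
proof -
  have i: "independent B"
    using B orthonormal_independent[OF x] by (simp add: orthonormal_basis_def)
  then show "finite B" by (rule independent_imp_finite)
  show "card B = DIM('e)"
    using i B dim_eq_card[of B UNIV] by (simp add: orthonormal_basis_def)
qed

lemma orthonormal_expand:
  assumes x: "x \<in> S" and B: "orthonormal_basis G x B"
  shows "v = (\<Sum>e\<in>B. G x v e *\<^sub>R e)"
proof -
  note f = orthonormal_finite[OF x B]
  have "v \<in> span B" using B by (simp add: orthonormal_basis_def)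
  then obtain c where c: "v = (\<Sum>e\<in>B. c e *\<^sub>R e)" unfolding span_finite[OF f(1)] by auto
  have "G x v e = c e" if e: "e \<in> B" for e
  proof -
    have "G x v e = (\<Sum>b\<in>B. if b = e then c b else 0)"
      using B e unfolding c orthonormal_basis_def
      by (auto simp: G_sum G_lin x intro!: sum.cong)
    then show ?thesis using f(1) e by simp
  qed
  then show ?thesis using c by simp
qed

lemma orthonormal_parseval:
  assumes x: "x \<in> S" and B: "orthonormal_basis G x B"
  shows "(\<Sum>e\<in>B. G x u e * G x v e) = G x u v"
  using arg_cong[OF orthonormal_expand[OF x B, of v], of "G x u"]
  by (simp add: G_sum G_lin x mult.commute)

text \<open>This replaces the basis chosen by \<open>SOME\<close> in \<open>ricci\<close> and
  \<open>scal\<close> by any convenient one. Both vectors are expanded in \<open>C\<close>, and the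
  sum over \<open>B\<close> collapses by Parseval.\<close>

lemma trace_eq:
  fixes \<beta> :: "'e \<Rightarrow> 'e \<Rightarrow> real"
  assumes x: "x \<in> S" and B: "orthonormal_basis G x B" and C: "orthonormal_basis G x C"
    and bil: "bilinear \<beta>"
  shows "(\<Sum>e\<in>B. \<beta> e e) = (\<Sum>e\<in>C. \<beta> e e)"
proof -
  note f = orthonormal_finite[OF x B] orthonormal_finite[OF x C]
  have "\<beta> e e = (\<Sum>a\<in>C. \<Sum>b\<in>C. (G x a e * G x b e) * \<beta> a b)" for e
  proof -
    have "\<beta> e e = \<beta> (\<Sum>a\<in>C. G x e a *\<^sub>R a) (\<Sum>b\<in>C. G x e b *\<^sub>R b)"
      by (intro arg_cong2[where f = \<beta>] orthonormal_expand[OF x C])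
    also have "\<dots> = (\<Sum>a\<in>C. \<Sum>b\<in>C. G x e a * (G x e b * \<beta> a b))"
      by (simp add: bilinear_sum[OF bil] bilinear_lmul[OF bil] bilinear_rmul[OF bil]
          sum.cartesian_product split_def mult.left_commute)
    finally show ?thesis by (simp add: G_sym[OF x, of e] mult.assoc)
  qed
  then have "(\<Sum>e\<in>B. \<beta> e e) = (\<Sum>e\<in>B. \<Sum>a\<in>C. \<Sum>b\<in>C. (G x a e * G x b e) * \<beta> a b)" by simp
  also have "\<dots> = (\<Sum>a\<in>C. \<Sum>b\<in>C. \<Sum>e\<in>B. (G x a e * G x b e) * \<beta> a b)"
    by (subst sum.swap) (intro sum.cong refl sum.swap)
  also have "\<dots> = (\<Sum>a\<in>C. \<Sum>b\<in>C. (if a = b then 1 else 0) * \<beta> a b)"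
    using C by (auto simp: sum_distrib_right[symmetric] orthonormal_parseval[OF x B]
        orthonormal_basis_def intro!: sum.cong)
  also have "\<dots> = (\<Sum>a\<in>C. \<beta> a a)"
    using f(3) by (intro sum.cong refl) (simp add: if_distrib[of "\<lambda>t. t * _"] cong: if_cong)
  finally show ?thesis .
qed

text \<open>Gram-Schmidt carried out at all points at once on the constant coordinate vectors.
  Keeping \<open>E a x\<close> in the span of \<open>I\<close> guarantees that the remainder
  \<open>W\<close> of the next vector vanishes nowhere, so it can be normalized smoothly.\<close>

lemma gram_schmidt:
  assumes "finite I" "I \<subseteq> (Basis :: 'e set)"
  shows "\<exists>E :: 'e \<Rightarrow> 'e \<Rightarrow> 'e. (\<forall>a\<in>I. smooth_on S (E a)) \<and>
    (\<forall>x\<in>S. \<forall>a\<in>I. E a x \<in> span I \<and> (\<forall>b\<in>I. G x (E a x) (E b x) = (if a = b then 1 else 0)))"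
  using assms
proof (induction I)
  case empty
  then show ?case by simp
next
  case (insert b I)
  then obtain E :: "'e \<Rightarrow> 'e \<Rightarrow> 'e" where "(\<forall>a\<in>I. smooth_on S (E a)) \<and>
    (\<forall>x\<in>S. \<forall>a\<in>I. E a x \<in> span I \<and> (\<forall>b\<in>I. G x (E a x) (E b x) = (if a = b then 1 else 0)))"
    by blast
  then have E: "\<And>a. a \<in> I \<Longrightarrow> smooth_on S (E a)"
    "\<And>x a. x \<in> S \<Longrightarrow> a \<in> I \<Longrightarrow> E a x \<in> span I"
    "\<And>x a c. x \<in> S \<Longrightarrow> a \<in> I \<Longrightarrow> c \<in> I \<Longrightarrow> G x (E a x) (E c x) = (if a = c then 1 else 0)"
    by blast+
  define W where "W x = b - (\<Sum>a\<in>I. G x b (E a x) *\<^sub>R E a x)" for x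
  have W: "smooth_on S W"
    unfolding W_def by (intro smooth_on_diff smooth_on_sum smooth_on_scaleR smooth_G smooth_on_const E open_S)
  have sp: "(\<Sum>a\<in>I. G x b (E a x) *\<^sub>R E a x) \<in> span I" if "x \<in> S" for x
    by (intro span_sum span_scale E that)
  have "b \<notin> span I"
    using insert.prems insert.hyps independent_Basis independent_mono independent_insert by metis
  then have W0: "W x \<noteq> 0" if "x \<in> S" for x using sp[OF that] by (auto simp: W_def)
  have WE: "G x (W x) (E a x) = 0" if "x \<in> S" "a \<in> I" for x a
    using that insert.hyps(1)
    by (simp add: W_def G_lin G_sum E if_distrib[of "\<lambda>t. _ * t"] cong: if_cong)
  define F where "F a x = (if a = b then (G x (W x) (W x) powr (-1/2)) *\<^sub>R W x else E a x)" for a x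
  have Fb: "F b x = (G x (W x) (W x) powr (-1/2)) *\<^sub>R W x" for x by (simp add: F_def)
  have Fa: "F a = E a" if "a \<in> I" for a using that insert.hyps(2) by (auto simp: F_def)
  have "smooth_on S (F b)"
    unfolding Fb by (intro smooth_on_scaleR smooth_on_powr smooth_G W open_S G_pos W0)
  moreover have "F a x \<in> span (insert b I)" if "a \<in> insert b I" "x \<in> S" for a x
  proof (cases "a = b")
    case True
    have "W x \<in> span (insert b I)"
      unfolding W_def using sp[OF that(2)] span_mono[of I "insert b I"]
      by (intro span_diff) (auto intro: span_base)
    then show ?thesis using True by (simp add: Fb span_scale)
  next
    case False
    then show ?thesis using that E(2)[of x a] Fa span_mono[of I "insert b I"] by auto
  qed
  moreover have "G x (F b x) (F b x) = 1" if "x \<in> S" for x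
  proof -
    have p: "G x (W x) (W x) > 0" using G_pos W0 that by blast
    have "G x (F b x) (F b x) = (G x (W x) (W x) powr (-1/2) * G x (W x) (W x) powr (-1/2)) * G x (W x) (W x)"
      by (simp add: Fb G_lin that)
    also have "\<dots> = 1" using p by (simp add: powr_neg_one flip: powr_add)
    finally show ?thesis .
  qed
  moreover have "G x (F b x) (F a x) = 0" "G x (F a x) (F b x) = 0" if "x \<in> S" "a \<in> I" for x a
    using WE[OF that] G_sym[OF that(1)] by (simp_all add: Fb Fa that G_lin)
  ultimately show ?case
    using E insert.hyps(2) Fa
    by (intro exI[of _ F]) auto
qed

text \<open>Orthonormal bases are sets that vary with the point; injectivity turns a sum over such a
  set into a sum over the fixed index set \<open>Basis\<close>, whose terms are smooth.\<close>

lemma smooth_frame_exists: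
  "\<exists>E :: 'e \<Rightarrow> 'e \<Rightarrow> 'e. (\<forall>a\<in>Basis. smooth_on S (E a)) \<and>
    (\<forall>x\<in>S. inj_on (\<lambda>a. E a x) Basis \<and> orthonormal_basis G x ((\<lambda>a. E a x) ` Basis))"
proof -
  obtain E :: "'e \<Rightarrow> 'e \<Rightarrow> 'e" where E: "\<And>a. a \<in> Basis \<Longrightarrow> smooth_on S (E a)"
    "\<And>x a c. x \<in> S \<Longrightarrow> a \<in> Basis \<Longrightarrow> c \<in> Basis \<Longrightarrow> G x (E a x) (E c x) = (if a = c then 1 else 0)"
    using gram_schmidt[OF finite_Basis order_refl] by metis
  have inj: "inj_on (\<lambda>a. E a x) Basis" if x: "x \<in> S" for x
    using E(2)[OF x] by (intro inj_onI) (metis zero_neq_one)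
  have on: "G x u v = (if u = v then 1 else 0)"
    if "x \<in> S" "u \<in> (\<lambda>a. E a x) ` Basis" "v \<in> (\<lambda>a. E a x) ` Basis" for x u v
    using that E(2)[OF that(1)] inj[OF that(1)] by (auto dest: inj_onD)
  have "span ((\<lambda>a. E a x) ` Basis) = UNIV" if x: "x \<in> S" for x
  proof -
    have "independent ((\<lambda>a. E a x) ` Basis)" by (rule orthonormal_independent[OF x on[OF x]])
    then have "dim ((\<lambda>a. E a x) ` Basis) = DIM('e)"
      using card_image[OF inj[OF x]] by (simp add: dim_eq_card_independent)
    then show ?thesis by (simp add: dim_eq_full)
  qed
  then show ?thesis using E(1) inj on unfolding orthonormal_basis_def by metis
qed

lemma bilinear_riem4:
  assumes "x \<in> S"
  shows "bilinear (\<lambda>e e'. riem4 G \<Gamma> x e v w e')"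
  by (simp add: bilinear_def linear_iff riem4_lin assms)

lemma orthonormal_basis_some: "x \<in> S \<Longrightarrow> orthonormal_basis G x (SOME B. orthonormal_basis G x B)"
  using smooth_frame_exists by (metis someI)

lemma ricci_eq:
  assumes "x \<in> S" "orthonormal_basis G x B"
  shows "ricci G \<Gamma> x v w = (\<Sum>e\<in>B. riem4 G \<Gamma> x e v w e)"
  unfolding ricci_def
  by (rule trace_eq[OF assms(1) orthonormal_basis_some[OF assms(1)] assms(2) bilinear_riem4[OF assms(1)]])

lemma ricci_bilinear: "x \<in> S \<Longrightarrow> bilinear (ricci G \<Gamma> x)"
  unfolding ricci_def bilinear_def linear_iff
  by (simp add: riem4_lin sum.distrib sum_distrib_left)

lemma scal_eq:
  assumes "x \<in> S" "orthonormal_basis G x B"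
  shows "scal G \<Gamma> x = (\<Sum>e\<in>B. ricci G \<Gamma> x e e)"
  unfolding scal_def
  by (rule trace_eq[OF assms(1) orthonormal_basis_some[OF assms(1)] assms(2) ricci_bilinear[OF assms(1)]])

lemma ricci_sym:
  assumes x: "x \<in> S"
  shows "ricci G \<Gamma> x v w = ricci G \<Gamma> x w v"
proof -
  have "riem4 G \<Gamma> x e v w e = riem4 G \<Gamma> x e w v e" for e
    using riem4_pair_sym[OF x, of e v w e] riem4_antisym12[OF x, of w e e v]
      riem4_antisym34[OF x, of e w e v] by simp
  then show ?thesis by (simp add: ricci_def)
qed

lemma orthonormal_J:
  assumes x: "x \<in> S" and B: "orthonormal_basis G x B"
  shows "orthonormal_basis G x (J x ` B)"
proof -
  have "surj (J x)" by (rule surjI[of _ "\<lambda>v. - J x v"]) (simp add: J_lin J_J x)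
  then have "span (J x ` B) = UNIV"
    using B by (simp add: span_linear_image[OF J_linear[OF x]] orthonormal_basis_def)
  then show ?thesis
    using B J_inj[OF x, of "_ - _"] by (force simp: orthonormal_basis_def G_J_J J_lin x)
qed

lemma ricci_J:
  assumes x: "x \<in> S"
  shows "ricci G \<Gamma> x (J x v) (J x w) = ricci G \<Gamma> x v w"
proof -
  obtain B where B: "orthonormal_basis G x B" using orthonormal_basis_some[OF x] by blast
  have "inj_on (J x) B" by (rule inj_onI) (metis J_J minus_minus x)
  then have "ricci G \<Gamma> x (J x v) (J x w) = (\<Sum>e\<in>B. riem4 G \<Gamma> x (J x e) (J x v) (J x w) (J x e))"
    unfolding ricci_eq[OF x orthonormal_J[OF x B]] by (simp add: sum.reindex)
  then show ?thesis by (simp add: ricci_eq[OF x B] riem4_J34 riem4_J12 x)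
qed

lemma smooth_ricci:
  assumes "smooth_on S X" "smooth_on S Y"
  shows "smooth_on S (\<lambda>y. ricci G \<Gamma> y (X y) (Y y))"
proof -
  obtain E :: "'e \<Rightarrow> 'e \<Rightarrow> 'e" where E: "\<And>a. a \<in> Basis \<Longrightarrow> smooth_on S (E a)"
    "\<And>x. x \<in> S \<Longrightarrow> inj_on (\<lambda>a. E a x) Basis"
    "\<And>x. x \<in> S \<Longrightarrow> orthonormal_basis G x ((\<lambda>a. E a x) ` Basis)"
    using smooth_frame_exists by metis
  have "smooth_on S (\<lambda>y. \<Sum>a\<in>Basis. riem4 G \<Gamma> y (E a y) (X y) (Y y) (E a y))"
    by (intro smooth_on_sum open_S smooth_riem4 assms E)
  then show ?thesis
    by (subst smooth_on_cong[OF open_S]) (use E in \<open>auto simp: ricci_eq[OF _ E(3)] sum.reindex\<close>)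
qed

lemma smooth_scal: "smooth_on S (scal G \<Gamma>)"
proof -
  obtain E :: "'e \<Rightarrow> 'e \<Rightarrow> 'e" where E: "\<And>a. a \<in> Basis \<Longrightarrow> smooth_on S (E a)"
    "\<And>x. x \<in> S \<Longrightarrow> inj_on (\<lambda>a. E a x) Basis"
    "\<And>x. x \<in> S \<Longrightarrow> orthonormal_basis G x ((\<lambda>a. E a x) ` Basis)"
    using smooth_frame_exists by metis
  have "smooth_on S (\<lambda>y. \<Sum>a\<in>Basis. ricci G \<Gamma> y (E a y) (E a y))"
    by (intro smooth_on_sum open_S smooth_ricci E)
  then show ?thesis
    by (subst smooth_on_cong[OF open_S]) (use E in \<open>auto simp: scal_eq[OF _ E(3)] sum.reindex\<close>)
qed

section \<open>Gradients\<close>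

lemma grad_unique:
  assumes "x \<in> S" "\<And>v. G x w v = frechet_derivative f (at x) v"
  shows "grad G f x = w"
  unfolding grad_def
  by (rule the_equality) (use assms G_eqI in auto)

lemma grad_eq:
  assumes x: "x \<in> S" and B: "orthonormal_basis G x B" and f: "f differentiable (at x)"
  shows "grad G f x = (\<Sum>e\<in>B. frechet_derivative f (at x) e *\<^sub>R e)"
proof (rule grad_unique[OF x])
  fix v
  note lin = linear_frechet_derivative[OF f]
  have "frechet_derivative f (at x) v = frechet_derivative f (at x) (\<Sum>e\<in>B. G x v e *\<^sub>R e)"
    by (rule arg_cong[OF orthonormal_expand[OF x B]])
  also have "\<dots> = (\<Sum>e\<in>B. G x v e * frechet_derivative f (at x) e)"
    by (simp add: linear_sum[OF lin] linear_scale[OF lin])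
  finally show "G x (\<Sum>e\<in>B. frechet_derivative f (at x) e *\<^sub>R e) v = frechet_derivative f (at x) v"
    by (simp add: G_sum G_lin x G_sym[OF x, of v] mult.commute)
qed

lemma G_grad:
  fixes f :: "'e \<Rightarrow> real"
  assumes x: "x \<in> S" and f: "f differentiable (at x)"
  shows "G x (grad G f x) v = frechet_derivative f (at x) v"
proof -
  note B = orthonormal_basis_some[OF x]
  note lin = linear_frechet_derivative[OF f]
  show ?thesis
    using arg_cong[OF orthonormal_expand[OF x B, of v], of "frechet_derivative f (at x)"]
    by (simp add: grad_eq[OF x B f] linear_sum[OF lin] linear_scale[OF lin] G_sum G_lin x
        G_sym[OF x, of v] mult.commute)
qed

lemma smooth_grad:
  fixes f :: "'e \<Rightarrow> real"
  assumes f: "smooth_on S f"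
  shows "smooth_on S (grad G f)"
proof -
  obtain E :: "'e \<Rightarrow> 'e \<Rightarrow> 'e" where E: "\<And>a. a \<in> Basis \<Longrightarrow> smooth_on S (E a)"
    "\<And>x. x \<in> S \<Longrightarrow> inj_on (\<lambda>a. E a x) Basis"
    "\<And>x. x \<in> S \<Longrightarrow> orthonormal_basis G x ((\<lambda>a. E a x) ` Basis)"
    using smooth_frame_exists by metis
  have "smooth_on S (\<lambda>y. \<Sum>a\<in>Basis. frechet_derivative f (at y) (E a y) *\<^sub>R E a y)"
    by (intro smooth_on_sum smooth_on_scaleR open_S smooth_directional f E)
  then show ?thesis
    by (subst smooth_on_cong[OF open_S])
      (use E in \<open>auto simp: grad_eq[OF _ E(3) smooth_on_differentiable[OF f]] sum.reindex\<close>)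
qed

end

subsection \<open>The Bochner condition in real terms\<close>

lemma module_cscale: "module (cscale :: complex \<Rightarrow> 'e::euclidean_space \<times> 'e \<Rightarrow> 'e \<times> 'e)"
  by standard (auto simp: cscale_def algebra_simps prod_eq_iff)

text \<open>The scaling hypothesis asks for some factor \<open>d\<close> rather than
  \<open>c\<close> itself, so that slots entered through \<open>cconj\<close>, which are conjugate
  linear, are covered too.\<close>

lemma zero_on_span_cscale:
  fixes f :: "'e::euclidean_space \<times> 'e \<Rightarrow> complex"
  assumes add: "\<And>y z. f (y + z) = f y + f z" and scale: "\<And>c z. \<exists>d. f (cscale c z) = d * f z"
    and B: "\<And>z. z \<in> B \<Longrightarrow> f z = 0" and z: "z \<in> module.span cscale B"
  shows "f z = 0"
proof (rule module.span_induct[OF module_cscale z])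
  have f0: "f 0 = 0" using add[of 0 0] by simp
  have fs: "f (cscale c z) = 0" if "f z = 0" for c z using scale[of c z] that by auto
  show "module.subspace cscale {z. f z = 0}"
    unfolding module.subspace_def[OF module_cscale] by (simp add: add f0 fs)
qed (rule B)

lemma cext_add: "linear f \<Longrightarrow> cext f (y + z) = cext f y + cext f z"
  by (simp add: cext_def linear_add algebra_simps)

lemma cext_cscale: "linear f \<Longrightarrow> cext f (cscale c z) = c * cext f z"
  by (cases c) (simp add: cext_def cscale_def linear_add linear_diff linear_scale complex_eq_iff algebra_simps)

lemma linear_cext:
  assumes "\<And>v. linear (\<lambda>u. F u v)"
  shows "linear (\<lambda>u. cext (F u) z)"
  using assms by (simp add: linear_iff cext_def algebra_simps)

lemma cconj_add: "cconj (y + z) = cconj y + cconj z"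
  by (simp add: cconj_def)

lemma cconj_cscale: "cconj (cscale c z) = cscale (cnj c) (cconj z)"
  by (simp add: cconj_def cscale_def algebra_simps)

text \<open>The Bochner condition is known on one complex basis. It spreads to all of
  \<open>T10\<close> one slot at a time, the other slots being held in the basis or already in its
  span.\<close>

lemma cext4_zero_on_span:
  fixes k :: "'e::euclidean_space \<Rightarrow> 'e \<Rightarrow> 'e \<Rightarrow> 'e \<Rightarrow> real"
  assumes lin: "\<And>v w z. linear (\<lambda>u. k u v w z)" "\<And>u w z. linear (\<lambda>v. k u v w z)"
      "\<And>u v z. linear (\<lambda>w. k u v w z)" "\<And>u v w. linear (k u v w)"
    and B: "\<And>\<alpha> \<beta> \<gamma> \<delta>. \<alpha> \<in> B \<Longrightarrow> \<beta> \<in> B \<Longrightarrow> \<gamma> \<in> B \<Longrightarrow> \<delta> \<in> B \<Longrightarrow>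
      cext4 k \<alpha> (cconj \<beta>) \<gamma> (cconj \<delta>) = 0"
    and mem: "\<alpha> \<in> module.span cscale B" "\<beta> \<in> module.span cscale B"
      "\<gamma> \<in> module.span cscale B" "\<delta> \<in> module.span cscale B"
  shows "cext4 k \<alpha> (cconj \<beta>) \<gamma> (cconj \<delta>) = 0"
proof -
  have of_real: "linear (\<lambda>u. complex_of_real (f u))" if "linear f" for f :: "'e \<Rightarrow> real"
    using that by (simp add: linear_iff scaleR_conv_of_real)
  note L = of_real[OF lin(1)] of_real[OF lin(2)] of_real[OF lin(3)] of_real[OF lin(4)]
  have 1: "cext4 k (a + a') b c d = cext4 k a b c d + cext4 k a' b c d"
    "cext4 k (cscale r a) b c d = r * cext4 k a b c d" for a a' b c d r
    unfolding cext4_def by (intro cext_add cext_cscale linear_cext L)+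
  have 2: "cext4 k a (b + b') c d = cext4 k a b c d + cext4 k a b' c d"
    "cext4 k a (cscale r b) c d = r * cext4 k a b c d" for a b b' c d r
  proof -
    have "linear (\<lambda>u2. cext (\<lambda>u3. cext (\<lambda>u4. complex_of_real (k u1 u2 u3 u4)) d) c)" for u1
      by (intro linear_cext L)
    note this[THEN cext_add] this[THEN cext_cscale]
    then show "cext4 k a (b + b') c d = cext4 k a b c d + cext4 k a b' c d"
      "cext4 k a (cscale r b) c d = r * cext4 k a b c d"
      unfolding cext4_def by (simp_all add: cext_def[of _ a] algebra_simps)
  qed
  have 3: "cext4 k a b (c + c') d = cext4 k a b c d + cext4 k a b c' d"
    "cext4 k a b (cscale r c) d = r * cext4 k a b c d" for a b c c' d r
  proof -
    have "linear (\<lambda>u3. cext (\<lambda>u4. complex_of_real (k u1 u2 u3 u4)) d)" for u1 u2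
      by (intro linear_cext L)
    note this[THEN cext_add] this[THEN cext_cscale]
    then show "cext4 k a b (c + c') d = cext4 k a b c d + cext4 k a b c' d"
      "cext4 k a b (cscale r c) d = r * cext4 k a b c d"
      unfolding cext4_def by (simp_all add: cext_def[of _ a] cext_def[of _ b] algebra_simps)
  qed
  have 4: "cext4 k a b c (d + d') = cext4 k a b c d + cext4 k a b c d'"
    "cext4 k a b c (cscale r d) = r * cext4 k a b c d" for a b c d d' r
    using L(4)[THEN cext_add] L(4)[THEN cext_cscale]
    unfolding cext4_def by (simp_all add: cext_def[of _ a] cext_def[of _ b] cext_def[of _ c] algebra_simps)
  note lin4 = 1 2 3 4 cconj_add cconj_cscale
  have s1: "cext4 k \<alpha> (cconj \<beta>) \<gamma> (cconj \<delta>) = 0"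
    if "\<alpha> \<in> module.span cscale B" "\<beta> \<in> B" "\<gamma> \<in> B" "\<delta> \<in> B" for \<alpha> \<beta> \<gamma> \<delta>
    by (rule zero_on_span_cscale[where f = "\<lambda>\<alpha>. cext4 k \<alpha> (cconj \<beta>) \<gamma> (cconj \<delta>)", OF _ _ _ that(1)])
      (use that B in \<open>auto simp: lin4\<close>)
  have s2: "cext4 k \<alpha> (cconj \<beta>) \<gamma> (cconj \<delta>) = 0"
    if "\<alpha> \<in> module.span cscale B" "\<beta> \<in> module.span cscale B" "\<gamma> \<in> B" "\<delta> \<in> B" for \<alpha> \<beta> \<gamma> \<delta>
    by (rule zero_on_span_cscale[where f = "\<lambda>\<beta>. cext4 k \<alpha> (cconj \<beta>) \<gamma> (cconj \<delta>)", OF _ _ _ that(2)])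
      (use that s1 in \<open>auto simp: lin4\<close>)
  have s3: "cext4 k \<alpha> (cconj \<beta>) \<gamma> (cconj \<delta>) = 0"
    if "\<alpha> \<in> module.span cscale B" "\<beta> \<in> module.span cscale B" "\<gamma> \<in> module.span cscale B" "\<delta> \<in> B"
    for \<alpha> \<beta> \<gamma> \<delta>
    by (rule zero_on_span_cscale[where f = "\<lambda>\<gamma>. cext4 k \<alpha> (cconj \<beta>) \<gamma> (cconj \<delta>)", OF _ _ _ that(3)])
      (use that s2 in \<open>auto simp: lin4\<close>)
  show ?thesis
    by (rule zero_on_span_cscale[where f = "\<lambda>\<delta>. cext4 k \<alpha> (cconj \<beta>) \<gamma> (cconj \<delta>)", OF _ _ _ mem(4)])
      (use mem s3 in \<open>auto simp: lin4\<close>)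
qed

text \<open>The pointwise clause of \<open>bochner_kaehler\<close>, isolated so that it can be an
  assumption about a single chart.\<close>

definition bochner_at ::
    "('e::euclidean_space \<Rightarrow> 'e \<Rightarrow> 'e \<Rightarrow> real) \<Rightarrow> ('e \<Rightarrow> 'e \<Rightarrow> 'e) \<Rightarrow> ('e \<Rightarrow> 'e \<Rightarrow> 'e \<Rightarrow> 'e) \<Rightarrow>
      nat \<Rightarrow> 'e \<Rightarrow> bool" where
  "bochner_at G J \<Gamma> n x \<longleftrightarrow> (\<exists>B. complex_basis J x B \<and>
        (\<forall>\<alpha>\<in>B. \<forall>\<beta>\<in>B. \<forall>\<gamma>\<in>B. \<forall>\<delta>\<in>B.
           let h = cext2 (G x); r = cext2 (ricci G \<Gamma> x);
               \<tau> = complex_of_real (scal G \<Gamma> x);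
               \<beta>' = cconj \<beta>; \<delta>' = cconj \<delta>
           in cext4 (riem4 G \<Gamma> x) \<alpha> \<beta>' \<gamma> \<delta>' =
                1 / (of_nat n + 2) *
                  (h \<alpha> \<beta>' * r \<gamma> \<delta>' + h \<gamma> \<beta>' * r \<alpha> \<delta>' + h \<gamma> \<delta>' * r \<alpha> \<beta>' + h \<alpha> \<delta>' * r \<gamma> \<beta>') -
                \<tau> / (2 * (of_nat n + 1) * (of_nat n + 2)) *
                  (h \<alpha> \<beta>' * h \<gamma> \<delta>' + h \<gamma> \<beta>' * h \<alpha> \<delta>')))"

context kaehler_chart begin

lemma riem4_J2:
  assumes x: "x \<in> S"
  shows "riem4 G \<Gamma> x (J x u) v w z = - riem4 G \<Gamma> x u (J x v) w z"
    "riem4 G \<Gamma> x u v (J x w) z = - riem4 G \<Gamma> x u v w (J x z)"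
  using riem4_J12[OF x, of u "J x v" w z] riem4_J34[OF x, of u v w "J x z"]
  by (simp_all add: J_J x riem4_lin)

lemma ricci_J2: "x \<in> S \<Longrightarrow> ricci G \<Gamma> x (J x v) w = - ricci G \<Gamma> x v (J x w)"
  using ricci_J[of x v "J x w"] ricci_bilinear[of x] by (simp add: J_J bilinear_rneg)

text \<open>Real part of the complex identity at \<open>u - iJu\<close>, \<open>v + iJv\<close>,
  \<open>w - iJw\<close>, \<open>z + iJz\<close>. Of the sixteen terms eight are real, and
  invariance under \<open>J\<close> folds them into the untwisted expression and the one with
  \<open>J\<close> on the second and fourth arguments.\<close>

lemma bochner_real:
  assumes x: "x \<in> S" and boch: "bochner_at G J \<Gamma> n x"
  defines "g \<equiv> G x" and "\<rho> \<equiv> ricci G \<Gamma> x" and "I \<equiv> J x"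
    and "p \<equiv> 1 / (real n + 2)" and "q \<equiv> scal G \<Gamma> x / (2 * (real n + 1) * (real n + 2))"
  shows "riem4 G \<Gamma> x u v w z - riem4 G \<Gamma> x u (I v) w (I z) =
    p * (g u v * \<rho> w z - g u (I v) * \<rho> w (I z) + g w v * \<rho> u z - g w (I v) * \<rho> u (I z) +
      g w z * \<rho> u v - g w (I z) * \<rho> u (I v) + g u z * \<rho> w v - g u (I z) * \<rho> w (I v)) -
    q * (g u v * g w z - g u (I v) * g w (I z) + g w v * g u z - g w (I v) * g u (I z))"
proof -
  \<comment> \<open>\<open>k\<close> is the defect of the Bochner identity as a real tensor; its
    complex extension vanishes on the given basis, hence on \<open>T10\<close>.\<close>
  define k where "k u v w z = riem4 G \<Gamma> x u v w z -
    p * (g u v * \<rho> w z + g w v * \<rho> u z + g w z * \<rho> u v + g u z * \<rho> w v) +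
    q * (g u v * g w z + g w v * g u z)" for u v w z
  obtain B where B: "complex_basis J x B"
    "\<And>\<alpha> \<beta> \<gamma> \<delta>. \<alpha> \<in> B \<Longrightarrow> \<beta> \<in> B \<Longrightarrow> \<gamma> \<in> B \<Longrightarrow> \<delta> \<in> B \<Longrightarrow>
      cext4 (riem4 G \<Gamma> x) \<alpha> (cconj \<beta>) \<gamma> (cconj \<delta>) =
        1 / (of_nat n + 2) *
          (cext2 g \<alpha> (cconj \<beta>) * cext2 \<rho> \<gamma> (cconj \<delta>) + cext2 g \<gamma> (cconj \<beta>) * cext2 \<rho> \<alpha> (cconj \<delta>) +
           cext2 g \<gamma> (cconj \<delta>) * cext2 \<rho> \<alpha> (cconj \<beta>) + cext2 g \<alpha> (cconj \<delta>) * cext2 \<rho> \<gamma> (cconj \<beta>)) -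
        complex_of_real (scal G \<Gamma> x) / (2 * (of_nat n + 1) * (of_nat n + 2)) *
          (cext2 g \<alpha> (cconj \<beta>) * cext2 g \<gamma> (cconj \<delta>) + cext2 g \<gamma> (cconj \<beta>) * cext2 g \<alpha> (cconj \<delta>))"
    using boch unfolding bochner_at_def Let_def g_def \<rho>_def by auto
  have pq: "1 / (of_nat n + 2) = complex_of_real p"
    "complex_of_real (scal G \<Gamma> x) / (2 * (of_nat n + 1) * (of_nat n + 2)) = complex_of_real q"
    by (simp_all add: p_def q_def)
  have lin: "linear (g u)" "linear (\<lambda>u. g u v)" "linear (\<rho> u)" "linear (\<lambda>u. \<rho> u v)" for u v
    using G_bilinear[OF x] ricci_bilinear[OF x] by (auto simp: g_def \<rho>_def bilinear_def)
  have k_cext: "cext4 k a b c d = cext4 (riem4 G \<Gamma> x) a b c d -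
      complex_of_real p * (cext2 g a b * cext2 \<rho> c d + cext2 g c b * cext2 \<rho> a d +
        cext2 g c d * cext2 \<rho> a b + cext2 g a d * cext2 \<rho> c b) +
      complex_of_real q * (cext2 g a b * cext2 g c d + cext2 g c b * cext2 g a d)" for a b c d
    unfolding cext4_def cext2_def cext_def k_def
    by (simp add: algebra_simps)
  have k_lin: "linear (\<lambda>u. k u v w z)" "linear (\<lambda>v. k u v w z)" "linear (\<lambda>w. k u v w z)" "linear (k u v w)"
    for u v w z
    using lin by (simp_all add: linear_iff k_def riem4_lin x algebra_simps)
  have kB: "cext4 k \<alpha> (cconj \<beta>) \<gamma> (cconj \<delta>) = 0"
    if "\<alpha> \<in> B" "\<beta> \<in> B" "\<gamma> \<in> B" "\<delta> \<in> B" for \<alpha> \<beta> \<gamma> \<delta>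
    unfolding k_cext B(2)[OF that] pq by simp
  have k0: "cext4 k \<alpha> (cconj \<beta>) \<gamma> (cconj \<delta>) = 0"
    if "\<alpha> \<in> T10 J x" "\<beta> \<in> T10 J x" "\<gamma> \<in> T10 J x" "\<delta> \<in> T10 J x" for \<alpha> \<beta> \<gamma> \<delta>
    using that B(1) unfolding complex_basis_def
    by (intro cext4_zero_on_span[OF k_lin kB]) auto
  have T10: "(u, - I u) \<in> T10 J x" for u
    by (simp add: T10_def cscale_def I_def J_lin J_J x)
  have "Re (cext4 k (u, - I u) (cconj (v, - I v)) (w, - I w) (cconj (z, - I z))) = 0"
    using k0[OF T10 T10 T10 T10] by simp
  then have "k u v w z + k (I u) (I v) w z - k (I u) v (I w) z + k (I u) v w (I z) + k u (I v) (I w) z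
    - k u (I v) w (I z) + k u v (I w) (I z) + k (I u) (I v) (I w) (I z) = 0"
    using linear_neg[OF k_lin(1)] linear_neg[OF k_lin(2)] linear_neg[OF k_lin(3)] linear_neg[OF k_lin(4)]
    by (simp add: cext4_def cext_def cconj_def algebra_simps)
  moreover have "g (I u) (I v) = g u v" "g (I u) v = - g u (I v)"
    "\<rho> (I u) (I v) = \<rho> u v" "\<rho> (I u) v = - \<rho> u (I v)"
    "g u (I (I v)) = - g u v" "\<rho> u (I (I v)) = - \<rho> u v" for u v
    using G_J_J[OF x] G_J[OF x] ricci_J[OF x] ricci_J2[OF x] linear_neg[OF lin(1)] linear_neg[OF lin(3)]
    by (simp_all add: g_def \<rho>_def I_def J_J x)
  moreover have "riem4 G \<Gamma> x (I u) (I v) w z = riem4 G \<Gamma> x u v w z"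
    "riem4 G \<Gamma> x u v (I w) (I z) = riem4 G \<Gamma> x u v w z"
    "riem4 G \<Gamma> x u (I (I v)) w z = - riem4 G \<Gamma> x u v w z"
    "riem4 G \<Gamma> x u v w (I (I z)) = - riem4 G \<Gamma> x u v w z"
    "riem4 G \<Gamma> x (I u) v w z = - riem4 G \<Gamma> x u (I v) w z"
    "riem4 G \<Gamma> x u v (I w) z = - riem4 G \<Gamma> x u v w (I z)" for u v w z
    using riem4_J12[OF x] riem4_J34[OF x] riem4_J2[OF x] by (simp_all add: I_def J_J riem4_lin x)
  ultimately show ?thesis
    unfolding k_def by (simp add: algebra_simps)
qed

text \<open>The product of \<open>G\<close> with a symmetric, \<open>J\<close>-invariant bilinear form, normalized so that
  a Bochner-Kaehler curvature tensor is the product of \<open>G\<close> with the modified Ricci form.\<close>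

definition kn :: "'e \<Rightarrow> ('e \<Rightarrow> 'e \<Rightarrow> real) \<Rightarrow> 'e \<Rightarrow> 'e \<Rightarrow> 'e \<Rightarrow> 'e \<Rightarrow> real" where
  "kn x h u v w z = (h v w * G x u z + G x v w * h u z - h u w * G x v z - G x u w * h v z +
    h (J x v) w * G x (J x u) z + G x (J x v) w * h (J x u) z -
    h (J x u) w * G x (J x v) z - G x (J x u) w * h (J x v) z -
    2 * h (J x u) v * G x (J x w) z - 2 * G x (J x u) v * h (J x w) z) / 2"

definition bochner_form :: "nat \<Rightarrow> 'e \<Rightarrow> 'e \<Rightarrow> 'e \<Rightarrow> real" where
  "bochner_form n x u v =
    (ricci G \<Gamma> x u v - scal G \<Gamma> x / (4 * (real n + 1)) * G x u v) / (real n + 2)"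

text \<open>The twisted term of \<open>bochner_real\<close> is symmetric in \<open>w\<close> and
  \<open>z\<close>, while the curvature is skew; skew-symmetrizing in \<open>w\<close>,
  \<open>z\<close> therefore leaves twice the curvature.\<close>

lemma riem4_bochner:
  assumes x: "x \<in> S" and boch: "bochner_at G J \<Gamma> n x"
  shows "riem4 G \<Gamma> x u v w z = kn x (bochner_form n x) u v w z"
proof -
  define p where "p = 1 / (real n + 2)"
  define q where "q = scal G \<Gamma> x / (2 * (real n + 1) * (real n + 2))"
  \<comment> \<open>In the four mixed products each product of two metrics arises twice, so half of
    \<open>q\<close> in the form absorbs the whole scalar curvature term.\<close>
  have h: "bochner_form n x u v = p * ricci G \<Gamma> x u v - q / 2 * G x u v" for u v
    by (simp add: bochner_form_def p_def q_def diff_divide_distrib)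
  have "riem4 G \<Gamma> x u (J x v) z (J x w) = riem4 G \<Gamma> x u (J x v) w (J x z)"
    using riem4_antisym34[OF x, of u "J x v" z "J x w"] riem4_J2(2)[OF x, of u "J x v" w z] by simp
  then have "2 * riem4 G \<Gamma> x u v w z =
    (riem4 G \<Gamma> x u v w z - riem4 G \<Gamma> x u (J x v) w (J x z)) -
    (riem4 G \<Gamma> x u v z w - riem4 G \<Gamma> x u (J x v) z (J x w))"
    using riem4_antisym34[OF x, of u v z w] by simp
  moreover have "G x z w = G x w z" "G x v u = G x u v" "G x z v = G x v z" "G x w v = G x v w"
    "ricci G \<Gamma> x z w = ricci G \<Gamma> x w z" "ricci G \<Gamma> x z v = ricci G \<Gamma> x v z"
    "ricci G \<Gamma> x w v = ricci G \<Gamma> x v w"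
    using G_sym[OF x] ricci_sym[OF x] by blast+
  moreover have "G x (J x a) b = - G x a (J x b)" "ricci G \<Gamma> x (J x a) b = - ricci G \<Gamma> x a (J x b)" for a b
    using G_J[OF x] ricci_J2[OF x] by blast+
  moreover have "G x z (J x w) = - G x w (J x z)" "G x v (J x w) = - G x w (J x v)"
    "G x z (J x v) = - G x v (J x z)"
    "ricci G \<Gamma> x z (J x w) = - ricci G \<Gamma> x w (J x z)" "ricci G \<Gamma> x v (J x w) = - ricci G \<Gamma> x w (J x v)"
    "ricci G \<Gamma> x z (J x v) = - ricci G \<Gamma> x v (J x z)"
    using G_J[OF x] ricci_J2[OF x] G_sym[OF x] ricci_sym[OF x] by metis+
  ultimately have "2 * riem4 G \<Gamma> x u v w z = 2 * kn x (bochner_form n x) u v w z"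
    unfolding bochner_real[OF x boch] h kn_def p_def[symmetric] q_def[symmetric]
    by (simp add: algebra_simps)
  then show ?thesis by simp
qed

lemma linear_covd: "x \<in> S \<Longrightarrow> X differentiable (at x) \<Longrightarrow> linear (\<lambda>v. covd \<Gamma> (\<lambda>_. v) X x)"
  unfolding covd_const
  by (intro linear_compose_add linear_frechet_derivative \<Gamma>_linear)

lemma covd_diff:
  assumes "x \<in> S" "X differentiable (at x)" "Y differentiable (at x)"
  shows "covd \<Gamma> (\<lambda>_. u) (\<lambda>y. X y - Y y) x = covd \<Gamma> (\<lambda>_. u) X x - covd \<Gamma> (\<lambda>_. u) Y x"
  using frechet_derivative_eq[OF has_derivative_diff[OF assms(2,3)[unfolded frechet_derivative_works]]]
  by (simp add: covd_const \<Gamma>_lin assms(1))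

lemma covd_scaleR:
  assumes "x \<in> S" "f differentiable (at x)" "X differentiable (at x)"
  shows "covd \<Gamma> (\<lambda>_. u) (\<lambda>y. f y *\<^sub>R X y) x =
    frechet_derivative f (at x) u *\<^sub>R X x + f x *\<^sub>R covd \<Gamma> (\<lambda>_. u) X x"
  using frechet_derivative_eq[OF has_derivative_scaleR[OF assms(2,3)[unfolded frechet_derivative_works]]]
  by (simp add: covd_const \<Gamma>_lin assms(1) scaleR_add_right)

lemma orthogonal_exists:
  assumes x: "x \<in> S" and F: "finite F" "card F < DIM('e)"
  shows "\<exists>v. v \<noteq> 0 \<and> (\<forall>w\<in>F. G x v w = 0)"
proof -
  \<comment> \<open>\<open>L w\<close> represents the functional \<open>\<lambda>v. G x v w\<close>
    in the Euclidean inner product, which reduces orthogonality for the metric to Euclidean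
    orthogonality.\<close>
  define L where "L w = (\<Sum>b\<in>Basis. G x b w *\<^sub>R b)" for w
  have GL: "G x v w = v \<bullet> L w" for v w
  proof -
    have "linear (\<lambda>v. G x v w)" using G_bilinear[OF x] by (simp add: bilinear_def)
    from linear_family_expand[OF this, of v] show ?thesis
      by (simp add: L_def inner_sum_right mult.commute)
  qed
  have "dim (L ` F) \<le> card (L ` F)" by (rule dim_le_card) (use F in \<open>auto intro: span_base\<close>)
  also have "\<dots> < DIM('e)" using F card_image_le[of F L] by linarith
  finally obtain v where v: "v \<noteq> 0" "\<And>y. y \<in> span (L ` F) \<Longrightarrow> orthogonal v y"
    using orthogonal_to_subspace_exists by blast
  then have "G x v w = 0" if "w \<in> F" for w
    using that by (auto simp: GL orthogonal_def intro: span_base)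
  then show ?thesis using v(1) by blast
qed

lemma bochner_form_bilinear:
  assumes "x \<in> S"
  shows "bilinear (bochner_form n x)"
  using G_bilinear[OF assms] ricci_bilinear[OF assms]
  by (simp add: bilinear_def linear_iff bochner_form_def add_divide_distrib diff_divide_distrib algebra_simps)

lemma bochner_form_sym: "x \<in> S \<Longrightarrow> bochner_form n x u v = bochner_form n x v u"
  unfolding bochner_form_def by (subst ricci_sym, assumption, subst G_sym, assumption, rule refl)

lemma bochner_form_J: "x \<in> S \<Longrightarrow> bochner_form n x (J x u) v = - bochner_form n x u (J x v)"
  unfolding bochner_form_def by (simp add: ricci_J2 G_J diff_divide_distrib)

end

subsection \<open>The scalar distribution\<close>

text \<open>The function \<open>k\<close> is half of the function \<open>k\<close> in the definition of a \<open>B\<^sub>0\<close>-distribution.\<close>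

locale scalar_chart = kaehler_chart S G J \<Gamma>
  for S :: "'e::euclidean_space set" and G J \<Gamma> +
  fixes n :: nat and k p :: "'e \<Rightarrow> real"
  assumes dim_eq: "DIM('e) = 2 * n" and n_ge: "2 * n \<ge> 6"
    and bochner: "\<And>x. x \<in> S \<Longrightarrow> bochner_at G J \<Gamma> n x"
    and dscal_nonzero: "\<And>x. x \<in> S \<Longrightarrow> frechet_derivative (scal G \<Gamma>) (at x) \<noteq> (\<lambda>v. 0)"
    and covd_xi_D: "\<And>x x0. x \<in> S \<Longrightarrow> x0 \<in> scalar_distribution G J \<Gamma> x \<Longrightarrow>
      covd \<Gamma> (\<lambda>_. x0) (xi G \<Gamma>) x = k x *\<^sub>R x0"
    and covd_xi_J: "\<And>x. x \<in> S \<Longrightarrow>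
      covd \<Gamma> (\<lambda>y. J y (xi G \<Gamma> y)) (xi G \<Gamma>) x = - p x *\<^sub>R J x (xi G \<Gamma> x)"
    and covd_xi_xi: "\<And>x. x \<in> S \<Longrightarrow> covd \<Gamma> (xi G \<Gamma>) (xi G \<Gamma>) x = 0"
begin

abbreviation \<xi> where "\<xi> \<equiv> xi G \<Gamma>"

lemma G_grad_scal: "x \<in> S \<Longrightarrow> G x (grad G (scal G \<Gamma>) x) v = frechet_derivative (scal G \<Gamma>) (at x) v"
  by (rule G_grad[OF _ smooth_on_differentiable[OF smooth_scal]])

lemma grad_scal_pos: "x \<in> S \<Longrightarrow> G x (grad G (scal G \<Gamma>) x) (grad G (scal G \<Gamma>) x) > 0"
proof (rule G_pos)
  assume x: "x \<in> S"
  show "grad G (scal G \<Gamma>) x \<noteq> 0"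
  proof
    assume "grad G (scal G \<Gamma>) x = 0"
    then have "frechet_derivative (scal G \<Gamma>) (at x) v = 0" for v
      using G_grad_scal[OF x, of v] by (simp add: G_lin x)
    then show False using dscal_nonzero[OF x] by blast
  qed
qed

text \<open>The square root in \<open>xi\<close> is rewritten as a power of a positive function, the
  form in which smoothness is available.\<close>

lemma xi_alt:
  "x \<in> S \<Longrightarrow> \<xi> x = (G x (grad G (scal G \<Gamma>) x) (grad G (scal G \<Gamma>) x) powr (-1/2)) *\<^sub>R grad G (scal G \<Gamma>) x"
  using grad_scal_pos by (simp add: xi_def Let_def powr_minus powr_half_sqrt inverse_eq_divide less_imp_le)

lemma smooth_xi: "smooth_on S \<xi>"
proof -
  have "smooth_on S (\<lambda>x. (G x (grad G (scal G \<Gamma>) x) (grad G (scal G \<Gamma>) x) powr (-1/2)) *\<^sub>R grad G (scal G \<Gamma>) x)"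
    by (intro smooth_on_scaleR smooth_on_powr smooth_G smooth_grad smooth_scal open_S grad_scal_pos)
  then show ?thesis by (subst smooth_on_cong[OF open_S xi_alt])
qed

lemma G_xi_xi [simp]: "x \<in> S \<Longrightarrow> G x (\<xi> x) (\<xi> x) = 1"
  using grad_scal_pos[of x] by (simp add: xi_def Let_def G_lin)

lemma dscal_xi:
  assumes "x \<in> S"
  obtains N where "N > 0" "\<And>v. frechet_derivative (scal G \<Gamma>) (at x) v = N * G x v (\<xi> x)"
proof
  let ?w = "grad G (scal G \<Gamma>) x"
  show "sqrt (G x ?w ?w) > 0" using grad_scal_pos[OF assms] by simp
  show "frechet_derivative (scal G \<Gamma>) (at x) v = sqrt (G x ?w ?w) * G x v (\<xi> x)" for v
    using grad_scal_pos[OF assms] G_grad_scal[OF assms, of v] G_sym[OF assms, of v ?w]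
    by (simp add: xi_def Let_def G_lin assms)
qed

lemma mem_scalar_distribution:
  assumes x: "x \<in> S"
  shows "v \<in> scalar_distribution G J \<Gamma> x \<longleftrightarrow> G x v (\<xi> x) = 0 \<and> G x v (J x (\<xi> x)) = 0"
proof
  assume "v \<in> scalar_distribution G J \<Gamma> x"
  then show "G x v (\<xi> x) = 0 \<and> G x v (J x (\<xi> x)) = 0"
    by (auto simp: scalar_distribution_def orth_compl_def intro: span_base)
next
  assume v: "G x v (\<xi> x) = 0 \<and> G x v (J x (\<xi> x)) = 0"
  have "G x v w = 0" if "w \<in> span {\<xi> x, J x (\<xi> x)}" for w
    using that
  proof (rule span_induct)
    show "subspace {w. G x v w = 0}" by (auto simp: subspace_def G_lin x)
  qed (use v in auto)
  then show "v \<in> scalar_distribution G J \<Gamma> x"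
    by (simp add: scalar_distribution_def orth_compl_def)
qed

definition proj :: "'e \<Rightarrow> 'e \<Rightarrow> 'e" where
  "proj x v = v - G x v (\<xi> x) *\<^sub>R \<xi> x - G x v (J x (\<xi> x)) *\<^sub>R J x (\<xi> x)"

lemma proj_mem: "x \<in> S \<Longrightarrow> proj x v \<in> scalar_distribution G J \<Gamma> x"
  by (simp add: mem_scalar_distribution proj_def G_lin G_J_J G_J_self)

lemma smooth_proj: "smooth_on S (\<lambda>y. proj y v)"
  unfolding proj_def
  by (intro smooth_on_diff smooth_on_scaleR smooth_G smooth_J smooth_xi smooth_on_const open_S)

text \<open>At a point the covariant derivative depends only on the value of the direction,
  linearly; so the three B0 equations, one for each part of \<open>v\<close>, combine to a formula
  for every direction.\<close>

lemma covd_xi: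
  assumes x: "x \<in> S"
  shows "covd \<Gamma> (\<lambda>_. v) \<xi> x = k x *\<^sub>R proj x v - (p x * G x v (J x (\<xi> x))) *\<^sub>R J x (\<xi> x)"
proof -
  note lin = linear_covd[OF x smooth_on_differentiable[OF smooth_xi x]]
  have v: "v = proj x v + G x v (\<xi> x) *\<^sub>R \<xi> x + G x v (J x (\<xi> x)) *\<^sub>R J x (\<xi> x)"
    by (simp add: proj_def)
  have "covd \<Gamma> (\<lambda>_. \<xi> x) \<xi> x = 0" "covd \<Gamma> (\<lambda>_. J x (\<xi> x)) \<xi> x = - p x *\<^sub>R J x (\<xi> x)"
    using covd_xi_J[OF x] covd_xi_xi[OF x] by (simp_all add: covd_def)
  with covd_xi_D[OF x proj_mem[OF x, of v]] show ?thesis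
    by (subst v) (simp add: linear_add[OF lin] linear_scale[OF lin])
qed

text \<open>Projecting a fixed vector to the distribution gives a smooth section \<open>Z\<close>,
  nonzero near \<open>x\<close>, and there \<open>k\<close> is the quotient of the smooth functions
  \<open>G (covd Z xi) Z\<close> and \<open>G Z Z\<close>.\<close>

lemma k_differentiable:
  assumes x: "x \<in> S"
  shows "k differentiable (at x)"
proof -
  have "card {\<xi> x, J x (\<xi> x)} < DIM('e)"
    using dim_eq n_ge card_insert_le_m1[of 2 "{J x (\<xi> x)}" "\<xi> x"] by simp
  then obtain v where v: "v \<noteq> 0" "G x v (\<xi> x) = 0" "G x v (J x (\<xi> x)) = 0"
    using orthogonal_exists[OF x, of "{\<xi> x, J x (\<xi> x)}"] by auto
  define Z where "Z y = proj y v" for y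
  have Z: "smooth_on S Z" unfolding Z_def by (rule smooth_proj)
  have Zx: "Z x = v" using v by (simp add: Z_def proj_def)
  have e: "G y (covd \<Gamma> Z \<xi> y) (Z y) = k y * G y (Z y) (Z y)" if "y \<in> S" for y
    using covd_xi_D[OF that proj_mem[OF that, of v]] by (simp add: Z_def covd_def G_lin that)
  let ?f = "\<lambda>y. G y (covd \<Gamma> Z \<xi> y) (Z y) / G y (Z y) (Z y)"
  define U where "U = S \<inter> (\<lambda>y. G y (Z y) (Z y)) -` (- {0})"
  have U: "open U"
    unfolding U_def
    by (intro continuous_open_preimage smooth_on_continuous smooth_G Z open_S) auto
  have xU: "x \<in> U" using x G_pos[OF x v(1)] by (simp add: U_def Zx)
  have "?f differentiable (at x)"
    using G_pos[OF x v(1)]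
    by (intro differentiable_divide smooth_on_differentiable[OF _ x] smooth_G smooth_covd Z smooth_xi)
      (simp add: Zx)
  then obtain f' where "(?f has_derivative f') (at x)" unfolding differentiable_def by blast
  then have "(k has_derivative f') (at x)"
    by (rule has_derivative_transform_within_open[OF _ U xU]) (auto simp: U_def e)
  then show ?thesis unfolding differentiable_def by blast
qed

text \<open>\<open>J xi\<close> has length one, so pairing the B0 equation along \<open>J xi\<close>
  with \<open>J xi\<close> expresses \<open>p\<close> through smooth functions.\<close>

lemma p_differentiable:
  assumes x: "x \<in> S"
  shows "p differentiable (at x)"
proof -
  have "smooth_on S (\<lambda>y. - G y (covd \<Gamma> (\<lambda>y. J y (\<xi> y)) \<xi> y) (J y (\<xi> y)))"
    by (intro smooth_on_minus smooth_G smooth_covd smooth_J smooth_xi open_S)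
  then have "smooth_on S p"
    by (subst smooth_on_cong[OF open_S, of p]) (auto simp: covd_xi_J G_lin G_J_J)
  then show ?thesis using x by (rule smooth_on_differentiable)
qed

text \<open>The curvature is the commutator of derivatives of \<open>xi\<close> along the constant
  extensions of \<open>v\<close> and \<open>xi x\<close>. In the difference the parts along
  \<open>xi\<close> and \<open>J xi\<close> cancel because the symbols are symmetric; the factor
  that remains is the Riccati expression in \<open>k\<close>.\<close>

lemma riem_D_xi:
  assumes x: "x \<in> S" and v: "v \<in> scalar_distribution G J \<Gamma> x"
  shows "riem \<Gamma> x v (\<xi> x) (\<xi> x) = - (frechet_derivative k (at x) (\<xi> x) + (k x)\<^sup>2) *\<^sub>R v"
proof -
  let ?D = "\<lambda>u. covd \<Gamma> (\<lambda>_. u) \<xi> x"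
  define \<eta> where "\<eta> v y = G y v (\<xi> y)" for v y
  define \<theta> where "\<theta> v y = G y v (J y (\<xi> y))" for v y
  have d: "\<xi> differentiable at x" "(\<lambda>y. J y (\<xi> y)) differentiable at x"
    "\<eta> v differentiable at x" "\<theta> v differentiable at x" for v
    unfolding \<eta>_def \<theta>_def
    by (intro smooth_on_differentiable[OF _ x] smooth_G smooth_J smooth_xi smooth_on_const)+
  have d\<eta>: "frechet_derivative (\<eta> v) (at x) u = G x (\<Gamma> x u v) (\<xi> x) + G x v (?D u)"
    "frechet_derivative (\<theta> v) (at x) u = G x (\<Gamma> x u v) (J x (\<xi> x)) + G x v (J x (?D u))" for u v
    unfolding \<eta>_def \<theta>_def
    using frechet_derivative_eq[OF G_has_derivative[OF x differentiable_const[of v] d(1)]]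
      frechet_derivative_eq[OF G_has_derivative[OF x differentiable_const[of v] d(2)]]
    by (simp_all add: covd_J[OF x d(1)] covd_const[of \<Gamma> u "\<lambda>_. v"])
  \<comment> \<open>\<open>covd_xi\<close> holds on the whole chart, so it may be differentiated
    once more by the product rule; the projection is written out through \<open>\<eta>\<close> and
    \<open>\<theta>\<close>.\<close>
  have c: "covd \<Gamma> (\<lambda>_. u) (covd \<Gamma> (\<lambda>_. v) \<xi>) x =
      frechet_derivative k (at x) u *\<^sub>R proj x v +
      k x *\<^sub>R (\<Gamma> x u v - (frechet_derivative (\<eta> v) (at x) u *\<^sub>R \<xi> x + \<eta> v x *\<^sub>R ?D u)
        - (frechet_derivative (\<theta> v) (at x) u *\<^sub>R J x (\<xi> x) + \<theta> v x *\<^sub>R J x (?D u))) -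
      ((frechet_derivative p (at x) u * \<theta> v x + p x * frechet_derivative (\<theta> v) (at x) u) *\<^sub>R J x (\<xi> x) +
        (p x * \<theta> v x) *\<^sub>R J x (?D u))" for u v
  proof -
    have "covd \<Gamma> (\<lambda>_. u) (covd \<Gamma> (\<lambda>_. v) \<xi>) x = covd \<Gamma> (\<lambda>_. u)
        (\<lambda>y. k y *\<^sub>R (v - \<eta> v y *\<^sub>R \<xi> y - \<theta> v y *\<^sub>R J y (\<xi> y)) - (p y * \<theta> v y) *\<^sub>R J y (\<xi> y)) x"
      by (rule covd_cong[OF x smooth_on_differentiable[OF smooth_covd[OF smooth_on_const smooth_xi] x]])
        (simp add: covd_xi proj_def \<eta>_def \<theta>_def)
    moreover have "frechet_derivative (\<lambda>y. p y * \<theta> v y) (at x) u =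
        frechet_derivative p (at x) u * \<theta> v x + p x * frechet_derivative (\<theta> v) (at x) u"
      using frechet_derivative_eq[OF has_derivative_mult[OF
            p_differentiable[OF x, unfolded frechet_derivative_works] d(4)[of v, unfolded frechet_derivative_works]]]
      by simp
    ultimately show ?thesis
      by (simp add: covd_diff covd_scaleR x d k_differentiable p_differentiable covd_J covd_const[of \<Gamma> u "\<lambda>_. v"]
          differentiable_diff differentiable_scaleR differentiable_mult \<eta>_def[symmetric] \<theta>_def[symmetric])
        (simp add: proj_def \<eta>_def \<theta>_def)
  qed
  have v0: "G x v (\<xi> x) = 0" "G x v (J x (\<xi> x)) = 0"
    using v by (simp_all add: mem_scalar_distribution x)
  have Dv: "?D v = k x *\<^sub>R v" by (rule covd_xi_D[OF x v])
  have Dxi: "?D (\<xi> x) = 0" using covd_xi_xi[OF x] by (simp add: covd_def)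
  have pr: "proj x v = v" "proj x (\<xi> x) = 0" using v0 x by (simp_all add: proj_def G_J_self)
  have "G x (\<xi> x) v = 0" "G x (\<xi> x) (J x v) = 0"
    using v0 G_sym[OF x] G_J[OF x, of "\<xi> x" v] by (simp_all add: G_sym[OF x, of "\<xi> x"] G_J x)
  then show ?thesis
    unfolding riem_covd[OF x smooth_xi, symmetric] c d\<eta> Dv Dxi pr
    using v0 x \<Gamma>_sym[OF x, of v "\<xi> x"]
    by (simp add: \<eta>_def \<theta>_def G_lin J_lin G_J_self algebra_simps power2_eq_square)
qed

end

subsection \<open>Shape of the curvature and second Bianchi identity\<close>

context scalar_chart begin

text \<open>The metric on the plane of \<open>xi\<close> and \<open>J xi\<close>, extended by zero
  on the scalar distribution.\<close>

definition qform :: "'e \<Rightarrow> 'e \<Rightarrow> 'e \<Rightarrow> real" where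
  "qform x u v = G x u (\<xi> x) * G x v (\<xi> x) + G x u (J x (\<xi> x)) * G x v (J x (\<xi> x))"

lemma kn_combination:
  assumes "\<And>u v. h u v = l * h1 u v + m * h2 u v"
  shows "kn x h u v w z = l * kn x h1 u v w z + m * kn x h2 u v w z"
  unfolding kn_def assms by (simp add: field_simps)

text \<open>For the metric itself every product in \<open>kn\<close> occurs twice, which cancels the
  factor 1/2 and leaves the bracket of \<open>pi_tensor\<close>, normalized by 1/4. For
  \<open>qform\<close> half of the bracket of \<open>Phi_tensor\<close> is left, normalized by 1/8;
  so 4 appears both times.\<close>

lemma kn_G: "x \<in> S \<Longrightarrow> kn x (G x) u v w z = 4 * G x (pi_tensor G J x u v w) z"
  by (simp add: kn_def pi_tensor_def G_lin)

lemma kn_qform: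
  assumes x: "x \<in> S"
  shows "kn x (qform x) u v w z = 4 * G x (Phi_tensor G J \<Gamma> x u v w) z"
proof -
  define e where "e = \<xi> x"
  have q: "qform x (J x u) v = G x u e * G x v (J x e) - G x u (J x e) * G x v e" for u v
    by (simp add: qform_def e_def G_J J_J G_lin x)
  have s: "G x e z = G x z e" "G x (J x e) z = G x z (J x e)"
    using G_sym[OF x] by blast+
  show ?thesis
    unfolding kn_def q Phi_tensor_def Let_def
    unfolding qform_def e_def[symmetric] by (simp add: G_lin x s field_simps)
qed

text \<open>Knowing the curvature on the arguments \<open>v, xi, xi, z\<close> with \<open>v\<close>
  in the distribution determines the form on the distribution up to \<open>s\<close> and kills its
  mixed part; on the plane of \<open>xi\<close> and \<open>J xi\<close> symmetry and invariance
  under \<open>J\<close> leave only \<open>s\<close>.\<close>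

lemma bochner_form_eq:
  assumes x: "x \<in> S"
  obtains l m where "\<And>u v. bochner_form n x u v = l * G x u v + m * qform x u v"
proof -
  define h where "h = bochner_form n x"
  define e where "e = \<xi> x"
  define f where "f = - (frechet_derivative k (at x) e + (k x)\<^sup>2)"
  define s where "s = h e e"
  note R = riem4_bochner[OF x bochner[OF x], folded h_def]
  have bil: "bilinear h" using bochner_form_bilinear[OF x] by (simp add: h_def)
  have hs: "h u v = h v u" and hJ: "h (J x u) v = - h u (J x v)" for u v
    unfolding h_def by (rule bochner_form_sym[OF x], rule bochner_form_J[OF x])
  have hself: "h (J x u) u = 0" "h u (J x u) = 0" for u
    using hs[of u "J x u"] hJ[of u u] by linarith+
  have hJJ: "h (J x u) (J x v) = h u v" for u v
    by (simp add: hJ J_J x bilinear_rneg[OF bil])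
  have Ge: "G x e e = 1" using x by (simp add: e_def)
  have D: "h v w = (2 * f - s) * G x v w" "h v (J x e) = 0"
    if v: "v \<in> scalar_distribution G J \<Gamma> x" and w: "w \<in> scalar_distribution G J \<Gamma> x" for v w
  proof -
    have v0: "G x v e = 0" "G x v (J x e) = 0" "G x w e = 0" "G x w (J x e) = 0"
      using v w by (simp_all add: mem_scalar_distribution x e_def)
    have v1: "G x e v = 0" "G x (J x e) v = 0" "G x e w = 0" "G x (J x e) w = 0" "G x e (J x v) = 0"
      using v0 G_sym[OF x, of e v] G_sym[OF x, of "J x e" v] G_sym[OF x, of e w]
        G_sym[OF x, of "J x e" w] G_J[OF x, of e v] by linarith+
    have Rv: "riem4 G \<Gamma> x v e e z = f * G x v z" for z
      using riem_D_xi[OF x v] by (simp add: riem4_def G_lin x f_def e_def)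
    \<comment> \<open>At \<open>(v, e, e, w)\<close> the product \<open>kn\<close> reduces to
      \<open>(s * G x v w + h v w) / 2\<close>; at \<open>(v, e, e, J x e)\<close> it reduces to
      \<open>2 * h v (J x e)\<close>, while \<open>G x v (J x e)\<close> is 0.\<close>
    show "h v w = (2 * f - s) * G x v w"
      using Rv[of w] v0 v1 by (simp add: R kn_def Ge s_def[symmetric] hself G_J G_J_self x algebra_simps)
    show "h v (J x e) = 0"
      using Rv[of "J x e"] v0 v1
      by (simp add: R kn_def Ge s_def[symmetric] hself hJ G_J G_J_self G_lin J_J x)
  qed
  have De: "h v e = 0" if v: "v \<in> scalar_distribution G J \<Gamma> x" for v
  proof -
    have "J x v \<in> scalar_distribution G J \<Gamma> x"
      using v by (simp add: mem_scalar_distribution x G_J G_J_J G_lin J_J)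
    from D(2)[OF this this] show ?thesis by (simp add: hJJ)
  qed
  have "h u v = (2 * f - s) * G x u v + (2 * s - 2 * f) * qform x u v" for u v
  proof -
    have dec: "w = proj x w + G x w e *\<^sub>R e + G x w (J x e) *\<^sub>R J x e" for w
      by (simp add: proj_def e_def)
    note pm = proj_mem[OF x]
    have z: "h (proj x a) e = 0" "h (proj x a) (J x e) = 0" "h e (proj x a) = 0" "h (J x e) (proj x a) = 0" for a
      using D(2)[OF pm pm] De[OF pm] hs by metis+
    have "h u v = h (proj x u + G x u e *\<^sub>R e + G x u (J x e) *\<^sub>R J x e)
        (proj x v + G x v e *\<^sub>R e + G x v (J x e) *\<^sub>R J x e)"
      by (rule arg_cong2[where f = h, OF dec dec])
    also have "\<dots> = h (proj x u) (proj x v) + s * qform x u v"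
      by (simp add: z bilinear_ladd[OF bil] bilinear_radd[OF bil] bilinear_lmul[OF bil] bilinear_rmul[OF bil]
          hself hJJ s_def[symmetric] qform_def e_def[symmetric] algebra_simps)
    also have "G x (proj x u) (proj x v) = G x u v - qform x u v"
    proof -
      have s: "G x e v = G x v e" "G x (J x e) v = G x v (J x e)" using G_sym[OF x] by blast+
      show ?thesis
        by (simp add: proj_def qform_def G_lin x e_def[symmetric] G_J_self G_J_J Ge s)
    qed
    with D(1)[OF pm pm, of u v] have "h (proj x u) (proj x v) = (2 * f - s) * (G x u v - qform x u v)"
      by simp
    finally show ?thesis by (simp add: algebra_simps)
  qed
  then show ?thesis using that by (simp add: h_def)
qed

text \<open>With trace \<open>2n\<close> for the metric and 2 for \<open>qform\<close>, the three
  scalars are \<open>\<tau> = 4(n+1)(nl+m)\<close>, \<open>\<sigma> = (2n+2)l + (n+3)m\<close> and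
  \<open>\<kappa> = 4l + 4m\<close>. The numerators of \<open>coeff_a\<close> and
  \<open>coeff_b\<close> are the combinations that eliminate \<open>m\<close> and \<open>l\<close>
  respectively, up to \<open>4n(n-1)\<close>.\<close>

lemma coefficients:
  assumes x: "x \<in> S" and h: "\<And>u v. bochner_form n x u v = l * G x u v + m * qform x u v"
  shows "coeff_a n G J \<Gamma> x = 4 * l" "coeff_b n G J \<Gamma> x = 4 * m"
    "scal G \<Gamma> x = 4 * (real n + 1) * (real n * l + m)"
proof -
  define \<tau> where "\<tau> = scal G \<Gamma> x"
  define N where "N = real n"
  have N: "N \<ge> 3" using n_ge by (simp add: N_def)
  have \<rho>: "ricci G \<Gamma> x u v = ((N + 2) * l + \<tau> / (4 * (N + 1))) * G x u v + (N + 2) * m * qform x u v" for u v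
  proof -
    have "(N + 2) * bochner_form n x u v = ricci G \<Gamma> x u v - \<tau> / (4 * (N + 1)) * G x u v"
      using N by (simp add: bochner_form_def \<tau>_def N_def)
    then show ?thesis unfolding h by (simp add: algebra_simps)
  qed
  obtain B where B: "orthonormal_basis G x B" using orthonormal_basis_some[OF x] by blast
  have "(\<Sum>e\<in>B. G x e e) = 2 * N"
    using B orthonormal_finite[OF x B] by (simp add: orthonormal_basis_def dim_eq N_def)
  moreover have "(\<Sum>e\<in>B. qform x e e) = 2"
  proof -
    have "(\<Sum>e\<in>B. G x e c * G x e c) = (\<Sum>e\<in>B. G x c e * G x c e)" for c
      by (intro sum.cong refl arg_cong2[where f = times] G_sym x)
    then show ?thesis
      by (simp add: qform_def sum.distrib orthonormal_parseval[OF x B] G_J_J x)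
  qed
  moreover have sum: "\<tau> = ((N + 2) * l + \<tau> / (4 * (N + 1))) * (\<Sum>e\<in>B. G x e e) +
      (N + 2) * m * (\<Sum>e\<in>B. qform x e e)"
  proof -
    have "\<tau> = (\<Sum>e\<in>B. ricci G \<Gamma> x e e)" unfolding \<tau>_def by (rule scal_eq[OF x B])
    then show ?thesis unfolding \<rho> by (simp only: sum.distrib sum_distrib_left)
  qed
  ultimately have "\<tau> = ((N + 2) * l + \<tau> / (4 * (N + 1))) * (2 * N) + (N + 2) * m * 2"
    using sum by simp
  \<comment> \<open>The scalar curvature occurs on both sides of the trace, since the Bochner form
    contains it; this solves for it.\<close>
  then have "(N + 2) * \<tau> = (N + 2) * (4 * (N + 1) * (N * l + m))"
    using N by (simp add: field_simps)
  then have \<tau>: "\<tau> = 4 * (N + 1) * (N * l + m)" using N by simp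
  have \<rho>': "ricci G \<Gamma> x u v = ((2 * N + 2) * l + m) * G x u v + (N + 2) * m * qform x u v" for u v
  proof -
    have "\<tau> / (4 * (N + 1)) = N * l + m" using N by (simp add: \<tau>)
    then show ?thesis unfolding \<rho> by (simp add: algebra_simps)
  qed
  have \<sigma>: "sigma G \<Gamma> x = (2 * N + 2) * l + (N + 3) * m"
    using x by (simp add: sigma_def \<rho>' qform_def G_J_self algebra_simps)
  have \<kappa>: "kappa G J \<Gamma> x = 4 * l + 4 * m"
    unfolding kappa_def Let_def riem4_bochner[OF x bochner[OF x]] kn_combination[OF h]
    using x by (simp add: kn_def qform_def G_J_self G_J G_J_J J_J G_lin)
  have NN: "N * (N - 1) \<noteq> 0" using N by simp
  have "\<tau> - 4 * sigma G \<Gamma> x + 2 * kappa G J \<Gamma> x = 4 * l * (N * (N - 1))"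
    unfolding \<tau> \<sigma> \<kappa> by (simp add: algebra_simps)
  then show "coeff_a n G J \<Gamma> x = 4 * l"
    using NN by (simp add: coeff_a_def \<tau>_def[symmetric] N_def[symmetric])
  have "- 2 * \<tau> + 4 * (N + 2) * sigma G \<Gamma> x - 4 * (N + 1) * kappa G J \<Gamma> x = 4 * m * (N * (N - 1))"
    unfolding \<tau> \<sigma> \<kappa> by (simp add: algebra_simps)
  then show "coeff_b n G J \<Gamma> x = 4 * m"
    using NN by (simp add: coeff_b_def \<tau>_def[symmetric] N_def[symmetric])
  show "scal G \<Gamma> x = 4 * (real n + 1) * (real n * l + m)"
    using \<tau> by (simp add: \<tau>_def N_def)
qed

lemma riem4_kn:
  assumes x: "x \<in> S"
  shows "riem4 G \<Gamma> x u v w z =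
    coeff_a n G J \<Gamma> x / 4 * kn x (G x) u v w z + coeff_b n G J \<Gamma> x / 4 * kn x (qform x) u v w z"
proof -
  obtain l m where h: "\<And>u v. bochner_form n x u v = l * G x u v + m * qform x u v"
    using bochner_form_eq[OF x] by blast
  show ?thesis
    unfolding riem4_bochner[OF x bochner[OF x]] kn_combination[OF h] coefficients[OF x h] by simp
qed

lemma scal_coeff:
  assumes x: "x \<in> S"
  shows "scal G \<Gamma> x = (real n + 1) * (real n * coeff_a n G J \<Gamma> x + coeff_b n G J \<Gamma> x)"
proof -
  obtain l m where h: "\<And>u v. bochner_form n x u v = l * G x u v + m * qform x u v"
    using bochner_form_eq[OF x] by blast
  show ?thesis unfolding coefficients[OF x h] by (simp add: algebra_simps)
qed

lemma riem_pi_Phi: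
  assumes x: "x \<in> S"
  shows "riem \<Gamma> x u v w =
    coeff_a n G J \<Gamma> x *\<^sub>R pi_tensor G J x u v w + coeff_b n G J \<Gamma> x *\<^sub>R Phi_tensor G J \<Gamma> x u v w"
proof (rule G_eqI[OF x])
  fix z
  show "G x (riem \<Gamma> x u v w) z = G x (coeff_a n G J \<Gamma> x *\<^sub>R pi_tensor G J x u v w +
      coeff_b n G J \<Gamma> x *\<^sub>R Phi_tensor G J \<Gamma> x u v w) z"
    using riem4_kn[OF x, of u v w z] by (simp add: riem4_def kn_G kn_qform G_lin x)
qed

lemma smooth_coeff: "smooth_on S (coeff_a n G J \<Gamma>)" "smooth_on S (coeff_b n G J \<Gamma>)"
proof -
  have s: "smooth_on S (kappa G J \<Gamma>)" "smooth_on S (sigma G \<Gamma>)"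
    unfolding kappa_def sigma_def Let_def
    by (intro smooth_riem4 smooth_ricci smooth_J smooth_xi)+
  show "smooth_on S (coeff_a n G J \<Gamma>)" "smooth_on S (coeff_b n G J \<Gamma>)"
    unfolding coeff_a_def coeff_b_def divide_inverse
    by (intro smooth_on_mult smooth_on_add smooth_on_diff smooth_on_const s smooth_scal open_S)+
qed

text \<open>The tensor is built from \<open>G\<close> and \<open>J\<close>, which are parallel, so
  its component derivatives consist of Christoffel terms only.\<close>

lemma kn_G_derivative:
  assumes x: "x \<in> S"
  shows "((\<lambda>y. kn y (G y) v w z t) has_derivative (\<lambda>u. kn x (G x) (\<Gamma> x u v) w z t +
    kn x (G x) v (\<Gamma> x u w) z t + kn x (G x) v w (\<Gamma> x u z) t + kn x (G x) v w z (\<Gamma> x u t))) (at x)"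
proof -
  have g: "((\<lambda>y. G y v w) has_derivative (\<lambda>u. G x (\<Gamma> x u v) w + G x v (\<Gamma> x u w))) (at x)" for v w
    using G_has_derivative[OF x differentiable_const[of v] differentiable_const[of w]]
    by (simp add: covd_const)
  have j: "((\<lambda>y. G y (J y v) w) has_derivative (\<lambda>u. G x (J x (\<Gamma> x u v)) w + G x (J x v) (\<Gamma> x u w))) (at x)"
    for v w
    using G_has_derivative[OF x smooth_on_differentiable[OF J_smooth x, of v] differentiable_const[of w]]
      covd_J[OF x differentiable_const[of v]]
    by (simp add: covd_const)
  show ?thesis
    unfolding kn_def divide_inverse
    by (rule has_derivative_eq_rhs, rule has_derivative_mult,
        (rule has_derivative_diff has_derivative_add has_derivative_mult has_derivative_const g j)+)
      (simp add: fun_eq_iff algebra_simps)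
qed

lemma coeff_b_nonzero:
  assumes x: "x \<in> S"
  shows "coeff_b n G J \<Gamma> x \<noteq> 0"
proof
  assume b0: "coeff_b n G J \<Gamma> x = 0"
  define a where "a y = coeff_a n G J \<Gamma> y / 4" for y
  define b where "b y = coeff_b n G J \<Gamma> y / 4" for y
  define A where "A = frechet_derivative a (at x)"
  define B where "B = frechet_derivative b (at x)"
  define P where "P y = kn y (G y)" for y
  define Q where "Q y = kn y (qform y)" for y
  have R: "riem4 G \<Gamma> y u v w z = a y * P y u v w z + b y * Q y u v w z" if "y \<in> S" for y u v w z
    using riem4_kn[OF that] by (simp add: a_def b_def P_def Q_def)
  have bx: "b x = 0" by (simp add: b_def b0)
  have da: "(a has_derivative A) (at x)" "(b has_derivative B) (at x)"
    unfolding A_def B_def a_def b_def divide_inverse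
    by (intro smooth_on_has_derivative[OF _ x] smooth_on_mult smooth_coeff smooth_on_const open_S)+
  have dR: "frechet_derivative (\<lambda>y. riem4 G \<Gamma> y v w z t) (at x) u =
      A u * P x v w z t + B u * Q x v w z t + a x * (P x (\<Gamma> x u v) w z t +
      P x v (\<Gamma> x u w) z t + P x v w (\<Gamma> x u z) t + P x v w z (\<Gamma> x u t))" for u v w z t
  proof -
    \<comment> \<open>Mere existence of a derivative of \<open>Q\<close> is enough: in the product
      rule for \<open>b y * Q y\<close> it is multiplied by \<open>b x = 0\<close>.\<close>
    have "smooth_on S (\<lambda>y. Q y v w z t)"
      unfolding Q_def kn_def qform_def divide_inverse
      by (intro smooth_on_add smooth_on_diff smooth_on_mult smooth_G smooth_J smooth_xi smooth_on_const open_S)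
    then obtain Q' where Q': "((\<lambda>y. Q y v w z t) has_derivative Q') (at x)"
      using smooth_on_has_derivative x by blast
    have "((\<lambda>y. riem4 G \<Gamma> y v w z t) has_derivative (\<lambda>u. A u * P x v w z t + B u * Q x v w z t +
        a x * (P x (\<Gamma> x u v) w z t +
        P x v (\<Gamma> x u w) z t + P x v w (\<Gamma> x u z) t + P x v w z (\<Gamma> x u t)))) (at x)"
      by (rule has_derivative_transform_within_open[OF _ open_S x R[symmetric]])
        (auto intro!: derivative_eq_intros da Q' kn_G_derivative[OF x, folded P_def] simp: bx algebra_simps)
    then show ?thesis by (simp add: frechet_derivative_eq)
  qed
  have Pas: "P x u v z t = - P x v u z t" for u v z t
  proof -
    have "G x (J x v) u = - G x (J x u) v" using G_J[OF x, of v u] G_sym[OF x, of v "J x u"] by linarith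
    then show ?thesis by (simp add: P_def kn_def field_simps)
  qed
  txt \<open>Since \<open>P\<close> is parallel and \<open>b x = 0\<close>, only the differentials of the coefficients survive
    in the second Bianchi identity.\<close>
  have bianchi: "A u * P x v w z t + B u * Q x v w z t + (A v * P x w u z t + B v * Q x w u z t) +
      (A w * P x u v z t + B w * Q x u v z t) = 0" for u v w z t
  proof -
    have "A u * P x v w z t + B u * Q x v w z t + a x * (P x (\<Gamma> x u v) w z t + P x v (\<Gamma> x u w) z t) +
      (A v * P x w u z t + B v * Q x w u z t + a x * (P x (\<Gamma> x v w) u z t + P x w (\<Gamma> x v u) z t)) +
      (A w * P x u v z t + B w * Q x u v z t + a x * (P x (\<Gamma> x w u) v z t + P x u (\<Gamma> x w v) z t)) = 0"
      using riem4_second_bianchi[OF x, of v w z t u] unfolding dR R[OF x] bx by (simp add: algebra_simps)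
    \<comment> \<open>The Christoffel terms in the first two slots, which the constant fields bring
      in, cancel in pairs by skew symmetry of \<open>P\<close> and symmetry of the symbols.\<close>
    moreover have "P x v (\<Gamma> x u w) z t = - P x (\<Gamma> x w u) v z t" "P x w (\<Gamma> x v u) z t = - P x (\<Gamma> x u v) w z t"
      "P x u (\<Gamma> x w v) z t = - P x (\<Gamma> x v w) u z t"
      using Pas \<Gamma>_sym[OF x] by metis+
    ultimately show ?thesis by (simp add: algebra_simps)
  qed
  define e where "e = \<xi> x"
  have Ge: "G x e e = 1" "G x (J x e) (J x e) = 1" using x by (simp_all add: e_def G_J_J)
  have c1: "card {e, J x e} < DIM('e)"
    using dim_eq n_ge card_insert_le_m1[of 2 "{J x e}" e] by simp
  obtain v where v: "v \<noteq> 0" "G x v e = 0" "G x v (J x e) = 0"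
    using orthogonal_exists[OF x _ c1] by auto
  \<comment> \<open>Dimension at least 6 leaves room for \<open>w\<close> in the distribution
    orthogonal to both \<open>v\<close> and \<open>J x v\<close>.\<close>
  have "card {e, J x e, v, J x v} \<le> 4" by (simp add: card_insert_if)
  then have c2: "card {e, J x e, v, J x v} < DIM('e)" using dim_eq n_ge by linarith
  obtain w where w: "w \<noteq> 0" "G x w e = 0" "G x w (J x e) = 0" "G x w v = 0" "G x w (J x v) = 0"
    using orthogonal_exists[OF x _ c2] by auto
  have sym: "G x e v = 0" "G x e w = 0" "G x v w = 0" "G x e (J x v) = 0" "G x e (J x w) = 0" "G x v (J x w) = 0"
    using v w G_sym[OF x, of e v] G_sym[OF x, of e w] G_sym[OF x, of v w] G_sym[OF x, of v "J x w"]
      G_sym[OF x, of "J x e" v] G_sym[OF x, of "J x e" w]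
      G_J[OF x, of e v] G_J[OF x, of e w] G_J[OF x, of w v] by linarith+
  have pos: "G x v v > 0" "G x w w > 0" using v w G_pos[OF x] by auto
  note ev = P_def Q_def kn_def qform_def e_def[symmetric] G_J_self G_J G_J_J J_J G_lin x sym v w Ge
  \<comment> \<open>Against \<open>J x w\<close>, \<open>w\<close> only the term with the pair
    \<open>v\<close>, \<open>J x v\<close> survives, and there \<open>Q\<close> vanishes since
    \<open>qform\<close> is zero on the distribution: this isolates \<open>A e\<close>.\<close>
  have "A e * (2 * G x v v * G x w w) = 0"
    using bianchi[of e v "J x v" "J x w" w] by (simp add: ev)
  then have Ae: "A e = 0" using pos by simp
  \<comment> \<open>Replacing \<open>J x w\<close>, \<open>w\<close> by \<open>J x e\<close>,
    \<open>e\<close> makes \<open>Q\<close> nonzero on the surviving term, and \<open>A e\<close> is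
    already 0.\<close>
  have "B e * G x v v = 0"
    using bianchi[of e v "J x v" "J x e" e] Ae by (simp add: ev)
  then have Be: "B e = 0" using pos by simp
  have "((\<lambda>y. (real n + 1) * (real n * (4 * a y) + 4 * b y)) has_derivative
      (\<lambda>u. (real n + 1) * (real n * (4 * A u) + 4 * B u))) (at x)"
    by (intro has_derivative_mult_right has_derivative_add da)
  then have "(scal G \<Gamma> has_derivative (\<lambda>u. (real n + 1) * (real n * (4 * A u) + 4 * B u))) (at x)"
    by (rule has_derivative_transform_within_open[OF _ open_S x]) (simp add: scal_coeff a_def b_def)
  then have "frechet_derivative (scal G \<Gamma>) (at x) e = 0"
    using Ae Be by (simp add: frechet_derivative_eq)
  moreover obtain N where "N > 0" "\<And>v. frechet_derivative (scal G \<Gamma>) (at x) v = N * G x v (\<xi> x)"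
    using dscal_xi[OF x] by blast
  ultimately show False using Ge by (simp add: e_def)
qed

end

subsection \<open>Change of charts\<close>

text \<open>\<open>U\<close> is the overlap in coordinates of the first chart and
  \<open>\<phi>\<close> the transition map. Surjectivity of \<open>D\<close> allows objects of the
  second chart to be tested on images of vectors of the first.\<close>

locale kaehler_chart_change =
  kaehler_chart S G J \<Gamma> + target: kaehler_chart S' G' J' \<Gamma>'
  for S S' :: "'e::euclidean_space set" and G J \<Gamma> G' J' \<Gamma>' +
  fixes U :: "'e set" and \<phi> :: "'e \<Rightarrow> 'e" and D :: "'e \<Rightarrow> 'e \<Rightarrow> 'e"
  assumes open_U: "open U" and U_subset: "U \<subseteq> S" and maps: "\<And>x. x \<in> U \<Longrightarrow> \<phi> x \<in> S'"
    and smooth_\<phi>: "smooth_on U \<phi>" and D_eq: "\<And>x. D x = frechet_derivative \<phi> (at x)"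
    and D_surj: "\<And>x. x \<in> U \<Longrightarrow> surj (D x)"
    and G_change: "\<And>x u v. x \<in> U \<Longrightarrow> G' (\<phi> x) (D x u) (D x v) = G x u v"
    and J_change: "\<And>x u. x \<in> U \<Longrightarrow> J' (\<phi> x) (D x u) = D x (J x u)"
    and \<Gamma>_change: "\<And>x u v. x \<in> U \<Longrightarrow>
      D x (\<Gamma> x u v) = frechet_derivative (\<lambda>y. D y v) (at x) u + \<Gamma>' (\<phi> x) (D x u) (D x v)"
begin

lemma D_derivative: "x \<in> U \<Longrightarrow> (\<phi> has_derivative D x) (at x)"
  unfolding D_eq by (rule smooth_on_has_derivative[OF smooth_\<phi>])

lemma D_linear: "x \<in> U \<Longrightarrow> linear (D x)"
  using D_derivative has_derivative_linear by blast

lemma smooth_D: "smooth_on U (\<lambda>y. D y v)"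
  unfolding D_eq by (rule smooth_on_frechet_derivative[OF smooth_\<phi>])

lemma D_inj: "x \<in> U \<Longrightarrow> D x u = D x v \<longleftrightarrow> u = v"
proof
  assume x: "x \<in> U" and e: "D x u = D x v"
  show "u = v"
    by (rule G_eqI[of x]) (use x U_subset e G_change[OF x] in \<open>auto simp flip: G_change[OF x]\<close>)
qed simp

text \<open>The curvature is compared through the pullback connection along the transition map,
  whose covariant derivative intertwines with that of the source chart.\<close>

definition pullback :: "'e \<Rightarrow> 'e \<Rightarrow> 'e \<Rightarrow> 'e" where
  "pullback y u w = \<Gamma>' (\<phi> y) (D y u) w"

lemma pullback_bilinear: "x \<in> U \<Longrightarrow> bilinear (pullback x)"
  using target.\<Gamma>_bilinear[OF maps] D_linear[of x]
  by (auto simp: bilinear_def pullback_def intro: linear_compose[unfolded o_def])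

lemma pullback_derivative:
  assumes x: "x \<in> U"
  shows "((\<lambda>y. pullback y u w) has_derivative
    (\<lambda>s. frechet_derivative (\<lambda>z. \<Gamma>' z (D x u) w) (at (\<phi> x)) (D x s) +
      \<Gamma>' (\<phi> x) (frechet_derivative (\<lambda>y. D y u) (at x) s) w)) (at x)"
  unfolding pullback_def
proof (rule has_derivative_linear_family[where L = "\<lambda>y v. \<Gamma>' (\<phi> y) v w", OF open_U x])
  show "linear (\<lambda>v. \<Gamma>' (\<phi> y) v w)" if "y \<in> U" for y
    by (rule target.\<Gamma>_linear(2)[OF maps[OF that]])
  show "((\<lambda>y. \<Gamma>' (\<phi> y) v w) has_derivative
      (\<lambda>s. frechet_derivative (\<lambda>z. \<Gamma>' z v w) (at (\<phi> x)) (D x s))) (at x)" for v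
    by (rule has_derivative_compose[OF D_derivative[OF x]
          smooth_on_has_derivative[OF target.\<Gamma>_smooth maps[OF x]]])
  show "((\<lambda>y. D y u) has_derivative frechet_derivative (\<lambda>y. D y u) (at x)) (at x)"
    by (rule smooth_on_has_derivative[OF smooth_D x])
qed

text \<open>Differentiating the first slot of \<open>pullback\<close> produces second derivatives of
  \<open>\<phi>\<close>; being symmetric, they cancel in the curvature.\<close>

lemma riem_pullback:
  assumes x: "x \<in> U"
  shows "riem pullback x u v w = riem \<Gamma>' (\<phi> x) (D x u) (D x v) w"
proof -
  have "frechet_derivative (\<lambda>y. D y v) (at x) u = frechet_derivative (\<lambda>y. D y u) (at x) v"
    unfolding D_eq by (rule second_derivative_symmetric[OF open_U smooth_\<phi> x])
  then show ?thesis
    unfolding riem_eq[where \<Gamma> = pullback, OF pullback_bilinear[OF x]]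
      riem_eq[where \<Gamma> = \<Gamma>', OF target.\<Gamma>_bilinear[OF maps[OF x]]]
      frechet_derivative_eq[OF pullback_derivative[OF x]]
    by (simp add: pullback_def)
qed

text \<open>The inhomogeneous term in the transformation law of the symbols is exactly the
  derivative of \<open>D\<close> in the product rule.\<close>

lemma covd_pullback:
  assumes x: "x \<in> U" and X: "X differentiable (at x)"
  shows "covd pullback (\<lambda>_. u) (\<lambda>y. D y (X y)) x = D x (covd \<Gamma> (\<lambda>_. u) X x)"
  unfolding covd_const pullback_def
  by (subst frechet_derivative_eq[OF has_derivative_linear_family[OF open_U x D_linear
          smooth_on_has_derivative[OF smooth_D x] X[unfolded frechet_derivative_works]]])
    (simp_all add: linear_add[OF D_linear[OF x]] \<Gamma>_change[OF x])

text \<open>The commutator of pullback derivatives of \<open>\<lambda>y. D y w\<close> is evaluated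
  twice: as curvature of \<open>pullback\<close>, which is that of the second chart, and by
  intertwining as the image of the commutator in the first.\<close>

lemma riem_change:
  assumes x: "x \<in> U"
  shows "riem \<Gamma>' (\<phi> x) (D x u) (D x v) (D x w) = D x (riem \<Gamma> x u v w)"
proof -
  have xS: "x \<in> S" using x U_subset by blast
  have sm: "smooth_on S (covd \<Gamma> (\<lambda>_. v) (\<lambda>_. w))" for v w by (intro smooth_covd smooth_on_const)
  have smU: "smooth_on U (covd pullback (\<lambda>_. v) (\<lambda>y. D y w))" for v
  proof -
    have "smooth_on U (\<lambda>y. D y (covd \<Gamma> (\<lambda>_. v) (\<lambda>_. w) y))"
      by (rule smooth_on_linear_family[OF open_U D_linear smooth_D smooth_on_subset[OF sm U_subset]])
    then show ?thesis
      by (subst smooth_on_cong[OF open_U covd_pullback[OF _ differentiable_const]])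
  qed
  have "covd pullback (\<lambda>_. u) (covd pullback (\<lambda>_. v) (\<lambda>y. D y w)) x =
      D x (covd \<Gamma> (\<lambda>_. u) (covd \<Gamma> (\<lambda>_. v) (\<lambda>_. w)) x)" for u v
  proof -
    have c: "covd pullback (\<lambda>_. v) (\<lambda>y. D y w) y = D y (covd \<Gamma> (\<lambda>_. v) (\<lambda>_. w) y)" if "y \<in> U" for y
      by (rule covd_pullback[OF that differentiable_const])
    have "covd pullback (\<lambda>_. u) (covd pullback (\<lambda>_. v) (\<lambda>y. D y w)) x =
        covd pullback (\<lambda>_. u) (\<lambda>y. D y (covd \<Gamma> (\<lambda>_. v) (\<lambda>_. w) y)) x"
      using frechet_derivative_transform_within_open[OF smooth_on_differentiable[OF smU x] open_U x c]
      by (simp add: covd_const[of _ _ "covd _ _ _"] covd_const[of _ _ "\<lambda>y. D y (covd _ _ _ y)"] c x)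
    then show ?thesis by (simp add: covd_pullback[OF x smooth_on_differentiable[OF sm xS]])
  qed
  moreover have "covd pullback (\<lambda>_. u) (covd pullback (\<lambda>_. v) (\<lambda>y. D y w)) x -
      covd pullback (\<lambda>_. v) (covd pullback (\<lambda>_. u) (\<lambda>y. D y w)) x = riem pullback x u v (D x w)"
    by (rule covd_commutator[OF open_U x pullback_bilinear _ smooth_D])
      (use pullback_derivative[OF x] differentiable_def in blast)+
  ultimately show ?thesis
    using arg_cong[OF riem_covd[OF xS smooth_on_const, of u v w], of "D x"]
    by (simp add: riem_pullback[OF x] linear_diff[OF D_linear[OF x]])
qed

lemma riem4_change:
  "x \<in> U \<Longrightarrow> riem4 G' \<Gamma>' (\<phi> x) (D x u) (D x v) (D x w) (D x z) = riem4 G \<Gamma> x u v w z"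
  by (simp add: riem4_def riem_change G_change)

lemma orthonormal_change:
  assumes x: "x \<in> U" and B: "orthonormal_basis G x B"
  shows "orthonormal_basis G' (\<phi> x) (D x ` B)"
proof -
  have "span (D x ` B) = UNIV"
    using D_surj[OF x] B by (simp add: span_linear_image[OF D_linear[OF x]] orthonormal_basis_def)
  then show ?thesis
    using B by (auto simp: orthonormal_basis_def G_change[OF x] D_inj[OF x])
qed

lemma ricci_change:
  assumes x: "x \<in> U"
  shows "ricci G' \<Gamma>' (\<phi> x) (D x u) (D x v) = ricci G \<Gamma> x u v"
proof -
  have xS: "x \<in> S" using x U_subset by blast
  obtain B where B: "orthonormal_basis G x B" using orthonormal_basis_some[OF xS] by blast
  have "inj_on (D x) B" by (rule inj_onI) (simp add: D_inj[OF x])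
  then show ?thesis
    by (simp add: target.ricci_eq[OF maps[OF x] orthonormal_change[OF x B]] ricci_eq[OF xS B]
        sum.reindex riem4_change[OF x])
qed

lemma scal_change:
  assumes x: "x \<in> U"
  shows "scal G' \<Gamma>' (\<phi> x) = scal G \<Gamma> x"
proof -
  have xS: "x \<in> S" using x U_subset by blast
  obtain B where B: "orthonormal_basis G x B" using orthonormal_basis_some[OF xS] by blast
  have "inj_on (D x) B" by (rule inj_onI) (simp add: D_inj[OF x])
  then show ?thesis
    by (simp add: target.scal_eq[OF maps[OF x] orthonormal_change[OF x B]] scal_eq[OF xS B]
        sum.reindex ricci_change[OF x])
qed

text \<open>Scalar curvature is invariant, so its differentials correspond by the chain rule; as
  \<open>D\<close> is isometric, so do the gradients and their lengths.\<close>

lemma xi_change: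
  assumes x: "x \<in> U"
  shows "xi G' \<Gamma>' (\<phi> x) = D x (xi G \<Gamma> x)"
proof -
  have xS: "x \<in> S" using x U_subset by blast
  note d' = smooth_on_has_derivative[OF target.smooth_scal maps[OF x]]
  have "(scal G \<Gamma> has_derivative (\<lambda>v. frechet_derivative (scal G' \<Gamma>') (at (\<phi> x)) (D x v))) (at x)"
    by (rule has_derivative_transform_within_open[OF
          has_derivative_compose[OF D_derivative[OF x] d'] open_U x]) (rule scal_change)
  then have ds: "frechet_derivative (scal G \<Gamma>) (at x) v =
      frechet_derivative (scal G' \<Gamma>') (at (\<phi> x)) (D x v)" for v
    by (simp add: frechet_derivative_eq)
  have "grad G' (scal G' \<Gamma>') (\<phi> x) = D x (grad G (scal G \<Gamma>) x)"
  proof (rule target.grad_unique[OF maps[OF x]])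
    fix v' obtain v where "v' = D x v" using D_surj[OF x] by blast
    then show "G' (\<phi> x) (D x (grad G (scal G \<Gamma>) x)) v' = frechet_derivative (scal G' \<Gamma>') (at (\<phi> x)) v'"
      by (simp add: G_change[OF x] G_grad[OF xS smooth_on_differentiable[OF smooth_scal xS]] ds)
  qed
  then show ?thesis
    by (simp add: xi_def Let_def G_change[OF x] linear_scale[OF D_linear[OF x]])
qed

lemma coeff_change:
  assumes x: "x \<in> U"
  shows "coeff_a n G' J' \<Gamma>' (\<phi> x) = coeff_a n G J \<Gamma> x" "coeff_b n G' J' \<Gamma>' (\<phi> x) = coeff_b n G J \<Gamma> x"
  by (simp_all add: coeff_a_def coeff_b_def sigma_def kappa_def Let_def xi_change[OF x] J_change[OF x]
      riem4_change[OF x] ricci_change[OF x] scal_change[OF x])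

lemma scalar_distribution_change:
  assumes x: "x \<in> U"
  shows "scalar_distribution G' J' \<Gamma>' (\<phi> x) = D x ` scalar_distribution G J \<Gamma> x"
proof -
  have span: "span {xi G' \<Gamma>' (\<phi> x), J' (\<phi> x) (xi G' \<Gamma>' (\<phi> x))} = D x ` span {xi G \<Gamma> x, J x (xi G \<Gamma> x)}"
    by (simp add: xi_change[OF x] J_change[OF x] flip: span_linear_image[OF D_linear[OF x]])
  show ?thesis
  proof (intro equalityI subsetI)
    fix v' assume v': "v' \<in> scalar_distribution G' J' \<Gamma>' (\<phi> x)"
    obtain v where v: "v' = D x v" using D_surj[OF x] by blast
    then have "v \<in> scalar_distribution G J \<Gamma> x"
      using v' by (auto simp: scalar_distribution_def orth_compl_def span G_change[OF x])
    then show "v' \<in> D x ` scalar_distribution G J \<Gamma> x" using v by blast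
  next
    fix v' assume "v' \<in> D x ` scalar_distribution G J \<Gamma> x"
    then show "v' \<in> scalar_distribution G' J' \<Gamma>' (\<phi> x)"
      by (auto simp: scalar_distribution_def orth_compl_def span G_change[OF x])
  qed
qed

end

subsection \<open>Holomorphic sectional curvatures\<close>

context scalar_chart begin

lemma J_scalar_distribution: "x \<in> S \<Longrightarrow> J x ` scalar_distribution G J \<Gamma> x \<subseteq> scalar_distribution G J \<Gamma> x"
  by (auto simp: mem_scalar_distribution G_J J_J G_lin)

lemma subspace_scalar_distribution: "x \<in> S \<Longrightarrow> subspace (scalar_distribution G J \<Gamma> x)"
  by (simp add: subspace_def mem_scalar_distribution G_lin)

lemma dim_scalar_distribution:
  assumes x: "x \<in> S"
  shows "dim (scalar_distribution G J \<Gamma> x) + 2 = DIM('e)"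
proof -
  let ?D = "scalar_distribution G J \<Gamma> x" and ?E = "span {\<xi> x, J x (\<xi> x)}"
  have ne: "\<xi> x \<noteq> J x (\<xi> x)" using G_J_self(2)[OF x, of "\<xi> x"] G_xi_xi[OF x] by auto
  have "independent {\<xi> x, J x (\<xi> x)}"
    by (rule orthonormal_independent[OF x]) (use ne in \<open>auto simp: x G_J_self G_J_J\<close>)
  then have dE: "dim ?E = 2" using ne by (simp add: dim_eq_card_independent)
  have "v = proj x v + (G x v (\<xi> x) *\<^sub>R \<xi> x + G x v (J x (\<xi> x)) *\<^sub>R J x (\<xi> x))" for v
    by (simp add: proj_def)
  moreover have "G x v (\<xi> x) *\<^sub>R \<xi> x + G x v (J x (\<xi> x)) *\<^sub>R J x (\<xi> x) \<in> ?E" for v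
    by (intro span_add span_scale span_base) auto
  ultimately have sum: "{y + z |y z. y \<in> ?D \<and> z \<in> ?E} = UNIV"
    using proj_mem[OF x] by blast
  have "v = 0" if "v \<in> ?D" "v \<in> ?E" for v
    using that G_pos[OF x, of v] by (auto simp: scalar_distribution_def orth_compl_def)
  then have "?D \<inter> ?E = {0}"
    using subspace_0[OF subspace_scalar_distribution[OF x]] span_zero by blast
  then show ?thesis
    using dim_sums_Int[OF subspace_scalar_distribution[OF x] subspace_span[of "{\<xi> x, J x (\<xi> x)}"]] sum dE
    by simp
qed

text \<open>The differential of the scalar curvature is a positive multiple of the metric dual of
  \<open>xi\<close>. It and its composition with \<open>J\<close> are thus smooth forms cutting out
  the distribution.\<close>

lemma scalar_distribution_kernel:
  assumes x: "x \<in> S"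
  shows "scalar_distribution G J \<Gamma> x =
    {v. frechet_derivative (scal G \<Gamma>) (at x) v = 0 \<and> frechet_derivative (scal G \<Gamma>) (at x) (J x v) = 0}"
proof -
  obtain N where "N > 0" "\<And>v. frechet_derivative (scal G \<Gamma>) (at x) v = N * G x v (\<xi> x)"
    using dscal_xi[OF x] by blast
  then show ?thesis by (auto simp: mem_scalar_distribution x G_J)
qed

lemma scalar_distribution_forms:
  assumes "x \<in> S"
  shows "\<exists>V w1 w2. open V \<and> x \<in> V \<and> V \<subseteq> S \<and>
    (\<forall>v. smooth_on V (\<lambda>y. w1 y v) \<and> smooth_on V (\<lambda>y. w2 y v)) \<and>
    (\<forall>y\<in>V. linear (w1 y) \<and> linear (w2 y) \<and>
      scalar_distribution G J \<Gamma> y = {v. w1 y v = (0::real) \<and> w2 y v = (0::real)})"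
proof (intro exI conjI allI ballI)
  show "open S" "x \<in> S" "S \<subseteq> S" using open_S assms by auto
  show "smooth_on S (\<lambda>y. frechet_derivative (scal G \<Gamma>) (at y) v)" for v
    by (rule smooth_on_frechet_derivative[OF smooth_scal])
  show "smooth_on S (\<lambda>y. frechet_derivative (scal G \<Gamma>) (at y) (J y v))" for v
    by (rule smooth_directional[OF smooth_scal J_smooth])
  show l: "linear (\<lambda>v. frechet_derivative (scal G \<Gamma>) (at y) v)" if "y \<in> S" for y
    by (rule linear_frechet_derivative[OF smooth_on_differentiable[OF smooth_scal that]])
  show "linear (\<lambda>v. frechet_derivative (scal G \<Gamma>) (at y) (J y v))" if "y \<in> S" for y
    by (rule linear_compose[OF J_linear[OF that] l[OF that], unfolded o_def])
qed (rule scalar_distribution_kernel)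

lemma orth_compl_scalar_distribution:
  assumes x: "x \<in> S"
  shows "orth_compl G x (scalar_distribution G J \<Gamma> x) = {c *\<^sub>R \<xi> x + d *\<^sub>R J x (\<xi> x) | c d. True}"
proof (intro equalityI subsetI)
  fix w assume w: "w \<in> orth_compl G x (scalar_distribution G J \<Gamma> x)"
  have "G x w (proj x w) = 0" using w proj_mem[OF x] by (simp add: orth_compl_def)
  moreover have "G x (\<xi> x) (proj x w) = 0" "G x (J x (\<xi> x)) (proj x w) = 0"
    using proj_mem[OF x, of w] G_sym[OF x] by (auto simp: mem_scalar_distribution x)
  ultimately have "G x (proj x w) (proj x w) = 0"
    by (subst (1) proj_def) (simp add: G_lin x)
  then have "proj x w = 0" using G_pos[OF x, of "proj x w"] by force
  then have "w = G x w (\<xi> x) *\<^sub>R \<xi> x + G x w (J x (\<xi> x)) *\<^sub>R J x (\<xi> x)"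
    by (simp add: proj_def algebra_simps)
  then show "w \<in> {c *\<^sub>R \<xi> x + d *\<^sub>R J x (\<xi> x) | c d. True}" by blast
next
  fix w assume "w \<in> {c *\<^sub>R \<xi> x + d *\<^sub>R J x (\<xi> x) | c d. True}"
  then obtain c d where w: "w = c *\<^sub>R \<xi> x + d *\<^sub>R J x (\<xi> x)" by blast
  have "G x w v = 0" if "v \<in> scalar_distribution G J \<Gamma> x" for v
    using that by (simp add: G_sym[OF x, of w v]) (simp add: w mem_scalar_distribution x G_lin)
  then show "w \<in> orth_compl G x (scalar_distribution G J \<Gamma> x)" by (simp add: orth_compl_def)
qed

text \<open>The difference is the squared length of the projection to the distribution.\<close>

lemma qform_le_G: "x \<in> S \<Longrightarrow> qform x u u \<le> G x u u"
proof -
  assume x: "x \<in> S"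
  have s: "G x (\<xi> x) u = G x u (\<xi> x)" "G x (J x (\<xi> x)) u = G x u (J x (\<xi> x))"
    using G_sym[OF x] by blast+
  have "G x (proj x u) (proj x u) = G x u u - qform x u u"
    by (simp add: proj_def qform_def G_lin x G_J_self G_J_J s)
  then show ?thesis using G_nonneg[OF x, of "proj x u"] by simp
qed

text \<open>A plane invariant under \<open>J\<close> contains \<open>u\<close> and
  \<open>J x u\<close>, which are orthogonal and nonzero, so they already span it.\<close>

lemma holomorphic_section_span:
  assumes x: "x \<in> S" and E: "holomorphic_section J x (span {u, v})"
  obtains c d where "u \<noteq> 0" "d \<noteq> 0" "v = c *\<^sub>R u + d *\<^sub>R J x u"
    "span {u, v} = {a *\<^sub>R u + b *\<^sub>R J x u | a b. True}"
proof -
  have dim: "dim {u, v} = 2" using E by (simp add: holomorphic_section_def)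
  have u0: "u \<noteq> 0"
  proof
    assume "u = 0"
    then have "dim {u, v} = dim {v}" by (simp add: dim_insert span_zero)
    also have "\<dots> \<le> 1" using dim_le_card'[of "{v}"] by simp
    finally show False using dim by simp
  qed
  have ne: "u \<noteq> J x u" using G_J_self(2)[OF x, of u] G_pos[OF x u0] by auto
  have ind: "independent {u, J x u}"
  proof -
    have "J x u \<notin> span {u}"
    proof
      assume "J x u \<in> span {u}"
      then obtain r where r: "J x u = r *\<^sub>R u" by (auto simp: span_singleton)
      then have "r * G x u u = 0" using G_J_self(2)[OF x, of u] by (simp add: G_lin x)
      then have "J x u = 0" using G_pos[OF x u0] r by simp
      then show False using u0 J_inj[OF x] by simp
    qed
    then show ?thesis using u0 ne by (simp add: independent_insert insert_commute[of u])
  qed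
  have "u \<in> span {u, v}" by (simp add: span_base)
  then have "J x u \<in> span {u, v}" using E by (auto simp: holomorphic_section_def)
  then have sub: "{u, J x u} \<subseteq> span {u, v}" by (simp add: span_base)
  have "span {u, J x u} = span {u, v}"
  proof (rule dim_eq_span[OF span_minimal[OF sub subspace_span], unfolded span_span])
    show "dim (span {u, v}) \<le> dim (span {u, J x u})"
      using dim ne dim_eq_card_independent[OF ind] by simp
  qed
  moreover have sp: "span {u, J x u} = {a *\<^sub>R u + b *\<^sub>R J x u | a b. True}"
  proof (intro equalityI subsetI)
    fix y assume "y \<in> span {u, J x u}"
    then obtain a b where "y - a *\<^sub>R u = b *\<^sub>R J x u"
      by (auto simp: span_insert[of u "{J x u}"] span_singleton)
    then have "y = a *\<^sub>R u + b *\<^sub>R J x u" by (simp add: diff_eq_eq add.commute)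
    then show "y \<in> {a *\<^sub>R u + b *\<^sub>R J x u | a b. True}" by blast
  qed (auto intro!: span_add span_scale intro: span_base)
  ultimately have eq: "span {u, v} = {a *\<^sub>R u + b *\<^sub>R J x u | a b. True}" by simp
  have "v \<in> span {u, v}" by (simp add: span_base)
  then obtain c d where v: "v = c *\<^sub>R u + d *\<^sub>R J x u" unfolding eq by blast
  have "d \<noteq> 0"
  proof
    assume "d = 0"
    then have "v \<in> span {u}" using v by (simp add: span_base span_scale)
    then have "dim (insert v {u}) = dim {u}" by (simp only: dim_insert if_True)
    also have "\<dots> \<le> 1" using dim_le_card'[of "{u}"] by simp
    finally show False using dim by (simp add: insert_commute)
  qed
  then show ?thesis using that u0 v eq by blast
qed

text \<open>The infimum is a minimum: it is attained by \<open>u\<close> itself and its projection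
  to the complement, and Cauchy-Schwarz bounds all other pairs.\<close>

lemma section_angle:
  assumes x: "x \<in> S" and u0: "u \<noteq> 0" and E: "E = {a *\<^sub>R u + b *\<^sub>R J x u | a b. True}"
  shows "subspace_angle G x E (orth_compl G x (scalar_distribution G J \<Gamma> x)) =
    arccos (sqrt (qform x u u / G x u u))"
  unfolding subspace_angle_def orth_compl_scalar_distribution[OF x]
proof (rule cInf_eq_minimum)
  define e where "e = \<xi> x"
  let ?F = "{c *\<^sub>R \<xi> x + d *\<^sub>R J x (\<xi> x) | c d. True}"
  let ?r = "\<lambda>(u, w). arccos (G x u w / (sqrt (G x u u) * sqrt (G x w w)))"
  define q where "q = qform x u u"
  define g where "g = G x u u"
  have g: "g > 0" using G_pos[OF x u0] by (simp add: g_def)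
  have q: "0 \<le> q" "q \<le> g" using qform_le_G[OF x, of u] by (simp_all add: q_def g_def qform_def)
  have Ge: "G x e e = 1" "G x (J x e) (J x e) = 1" "G x e (J x e) = 0" "G x (J x e) e = 0"
    using x by (simp_all add: e_def G_J_J G_J_self)
  have Gw: "G x (c *\<^sub>R e + d *\<^sub>R J x e) (c *\<^sub>R e + d *\<^sub>R J x e) = c\<^sup>2 + d\<^sup>2" for c d
    by (simp add: G_lin x Ge power2_eq_square)
  show "arccos (sqrt (qform x u u / G x u u)) \<in> ?r ` ((E - {0}) \<times> (?F - {0}))"
  proof -
    have "u = 1 *\<^sub>R u + 0 *\<^sub>R J x u" by simp
    then have "u \<in> E - {0}" using u0 unfolding E by blast
    \<comment> \<open>If the projection of \<open>u\<close> to the complement is zero, it is not an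
      admissible \<open>w\<close>; then \<open>e\<close> serves, with right angle.\<close>
    moreover have "\<exists>w \<in> ?F - {0}. G x u w / (sqrt (G x u u) * sqrt (G x w w)) = sqrt (q / g)"
    proof (cases "q = 0")
      case True
      have "G x u e = 0" using True by (simp add: q_def qform_def e_def add_nonneg_eq_0_iff)
      moreover have "e \<in> ?F - {0}"
      proof -
        have "e = 1 *\<^sub>R \<xi> x + 0 *\<^sub>R J x (\<xi> x)" by (simp add: e_def)
        moreover have "e \<noteq> 0" using Ge(1) G_lin(9)[OF x] by force
        ultimately show ?thesis by blast
      qed
      ultimately show ?thesis using True by (intro bexI[of _ e]) simp_all
    next
      case False
      define w where "w = G x u e *\<^sub>R e + G x u (J x e) *\<^sub>R J x e"
      have Gww: "G x w w = q" unfolding w_def Gw by (simp add: q_def qform_def e_def power2_eq_square)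
      have "G x u w = q" by (simp add: w_def G_lin x q_def qform_def e_def)
      then have "G x u w / (sqrt (G x u u) * sqrt (G x w w)) = q / (sqrt g * sqrt q)"
        by (simp add: Gww g_def)
      also have "\<dots> = sqrt (q / g)"
        using q False g by (simp add: real_sqrt_divide real_div_sqrt field_simps)
      finally have "G x u w / (sqrt (G x u u) * sqrt (G x w w)) = sqrt (q / g)" .
      moreover have "w \<noteq> 0" using Gww False G_lin(9)[OF x] by force
      then have "w \<in> ?F - {0}" unfolding w_def e_def by blast
      ultimately show ?thesis by blast
    qed
    then obtain w where w: "w \<in> ?F - {0}" "G x u w / (sqrt (G x u u) * sqrt (G x w w)) = sqrt (q / g)"
      by blast
    ultimately show ?thesis
      by (intro image_eqI[of _ _ "(u, w)"]) (auto simp: q_def g_def)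
  qed
  fix t assume "t \<in> ?r ` ((E - {0}) \<times> (?F - {0}))"
  then obtain y w where yw: "y \<in> E" "y \<noteq> 0" "w \<in> ?F" "w \<noteq> 0"
    and t: "t = arccos (G x y w / (sqrt (G x y y) * sqrt (G x w w)))" by auto
  obtain a b where y: "y = a *\<^sub>R u + b *\<^sub>R J x u" using yw(1) unfolding E by blast
  obtain c d where w: "w = c *\<^sub>R e + d *\<^sub>R J x e" using yw(3) by (auto simp: e_def)
  have gy: "G x y y = (a\<^sup>2 + b\<^sup>2) * g"
    by (simp add: y G_lin x G_J_self G_J_J g_def power2_eq_square algebra_simps)
  have Jue: "G x (J x u) e = - G x u (J x e)" "G x (J x u) (J x e) = G x u e"
    by (simp_all add: G_J G_J_J x J_J G_lin)
  define s1 where "s1 = G x y e"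
  define s2 where "s2 = G x y (J x e)"
  \<comment> \<open>Passing from \<open>u\<close> to another vector of the section scales
    \<open>G\<close> and \<open>qform\<close> by the same factor, so their quotient belongs to the
    section.\<close>
  have qy: "s1\<^sup>2 + s2\<^sup>2 = (a\<^sup>2 + b\<^sup>2) * q"
    by (simp add: s1_def s2_def y G_lin x Jue q_def qform_def e_def[symmetric] power2_eq_square algebra_simps)
  have pos: "G x y y > 0" "G x w w > 0" using G_pos[OF x] yw by auto
  have gw: "G x w w = c\<^sup>2 + d\<^sup>2" by (simp add: w Gw)
  have ab: "a\<^sup>2 + b\<^sup>2 > 0" using pos(1) g unfolding gy by (simp add: zero_less_mult_iff)
  have "G x y w = c * s1 + d * s2" by (simp add: w G_lin x s1_def s2_def)
  moreover have "(c * s1 + d * s2)\<^sup>2 \<le> (c\<^sup>2 + d\<^sup>2) * (s1\<^sup>2 + s2\<^sup>2)"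
  proof -
    have "(c\<^sup>2 + d\<^sup>2) * (s1\<^sup>2 + s2\<^sup>2) - (c * s1 + d * s2)\<^sup>2 = (c * s2 - d * s1)\<^sup>2"
      by (simp add: power2_eq_square algebra_simps)
    then show ?thesis by (metis zero_le_power2 diff_ge_0_iff_ge)
  qed
  ultimately have "(G x y w)\<^sup>2 \<le> G x w w * ((a\<^sup>2 + b\<^sup>2) * q)" by (simp add: gw qy)
  then have "\<bar>G x y w\<bar> \<le> sqrt (G x w w * ((a\<^sup>2 + b\<^sup>2) * q))"
    using real_sqrt_le_mono by fastforce
  also have "G x w w * ((a\<^sup>2 + b\<^sup>2) * q) = (G x y y * G x w w) * (q / g)"
    using g by (simp add: gy)
  also have "sqrt \<dots> = (sqrt (G x y y) * sqrt (G x w w)) * sqrt (q / g)"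
    by (simp only: real_sqrt_mult)
  finally have "\<bar>G x y w / (sqrt (G x y y) * sqrt (G x w w))\<bar> \<le> sqrt (q / g)"
    using pos by (simp add: abs_divide abs_mult divide_le_eq mult.commute)
  moreover have "sqrt (q / g) \<le> 1" using q g by simp
  ultimately have "arccos (sqrt (q / g)) \<le> t"
    unfolding t by (intro arccos_le_arccos) linarith+
  then show "arccos (sqrt (qform x u u / G x u u)) \<le> t" by (simp add: q_def g_def)
qed

text \<open>By \<open>section_angle\<close> the squared cosine is the quotient of
  \<open>qform\<close> by \<open>G\<close> at \<open>u\<close>; this quotient is the coefficient of
  \<open>b\<close> in the curvature of the plane of \<open>u\<close> and
  \<open>J x u\<close>.\<close>

lemma sectional_curvature_angle:
  assumes x: "x \<in> S" and E: "holomorphic_section J x (span {u, v})"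
  shows "sectional_curvature G \<Gamma> x u v = coeff_a n G J \<Gamma> x + coeff_b n G J \<Gamma> x *
    (cos (subspace_angle G x (span {u, v}) (orth_compl G x (scalar_distribution G J \<Gamma> x))))\<^sup>2"
proof -
  obtain c d where u0: "u \<noteq> 0" and d: "d \<noteq> 0" and v: "v = c *\<^sub>R u + d *\<^sub>R J x u"
    and sp: "span {u, v} = {a *\<^sub>R u + b *\<^sub>R J x u | a b. True}"
    using holomorphic_section_span[OF x E] by blast
  define g where "g = G x u u"
  define q where "q = qform x u u"
  have g: "g > 0" using G_pos[OF x u0] by (simp add: g_def)
  have q: "0 \<le> q" "q \<le> g" using qform_le_G[OF x, of u] by (simp_all add: q_def g_def qform_def)
  have "sqrt (q / g) \<le> 1" "- 1 \<le> sqrt (q / g)"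
    using q g by (auto intro: order_trans[of _ 0])
  then have cos: "(cos (subspace_angle G x (span {u, v}) (orth_compl G x (scalar_distribution G J \<Gamma> x))))\<^sup>2 = q / g"
    using q g unfolding section_angle[OF x u0 sp] q_def[symmetric] g_def[symmetric]
    by (simp add: cos_arccos)
  have z: "riem4 G \<Gamma> x u u w z = 0" "riem4 G \<Gamma> x w z u u = 0" for w z
    using riem4_antisym12[OF x, of u u w z] riem4_antisym34[OF x, of w z u u] by simp_all
  \<comment> \<open>By skew symmetry only the component of \<open>v\<close> along
    \<open>J x u\<close> contributes; its factor \<open>d\<^sup>2\<close> cancels against the same
    factor in the area.\<close>
  have "riem4 G \<Gamma> x u v v u = d\<^sup>2 * riem4 G \<Gamma> x u (J x u) (J x u) u"
    unfolding v by (simp add: riem4_lin x z power2_eq_square)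
  also have "riem4 G \<Gamma> x u (J x u) (J x u) u = coeff_a n G J \<Gamma> x * g\<^sup>2 + coeff_b n G J \<Gamma> x * (q * g)"
    unfolding riem4_kn[OF x]
    by (simp add: kn_def qform_def G_J_self G_J J_J G_lin x g_def q_def power2_eq_square algebra_simps)
  finally have num: "riem4 G \<Gamma> x u v v u = d\<^sup>2 * (coeff_a n G J \<Gamma> x * g\<^sup>2 + coeff_b n G J \<Gamma> x * (q * g))" .
  have den: "G x u u * G x v v - (G x u v)\<^sup>2 = d\<^sup>2 * g\<^sup>2"
    unfolding v by (simp add: G_lin x G_J_self G_J_J g_def[symmetric] power2_eq_square algebra_simps)
  show ?thesis
    unfolding sectional_curvature_def num den cos
    using d g by (simp add: field_simps power2_eq_square)
qed

end

subsection \<open>Charts of a manifold\<close>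

lemma
  assumes M: "smooth_manifold T A" and c: "c \<in> A"
  shows chart_domain_open: "openin T (fst c)" and chart_image_open: "open (chart_image c)"
    and chart_homeomorphic:
      "homeomorphic_map (subtopology T (fst c)) (top_of_set (chart_image c)) (snd c)"
  using M c by (auto simp: smooth_manifold_def)

lemma chart_inj:
  assumes "smooth_manifold T A" "c \<in> A"
  shows "inj_on (snd c) (fst c)"
proof -
  have "topspace (subtopology T (fst c)) = fst c"
    by (rule topspace_subtopology_subset[OF openin_subset[OF chart_domain_open[OF assms]]])
  then show ?thesis using homeomorphic_imp_injective_map[OF chart_homeomorphic[OF assms]] by simp
qed

lemma chart_inv_snd:
  "smooth_manifold T A \<Longrightarrow> c \<in> A \<Longrightarrow> m \<in> fst c \<Longrightarrow> chart_inv c (snd c m) = m"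
  unfolding chart_inv_def using chart_inj inv_into_f_f by metis

lemma transition_snd:
  "smooth_manifold T A \<Longrightarrow> c \<in> A \<Longrightarrow> m \<in> fst c \<Longrightarrow> transition c d (snd c m) = snd d m"
  by (simp add: transition_def chart_inv_snd)

lemma open_overlap:
  assumes M: "smooth_manifold T A" and c: "c \<in> A" and d: "d \<in> A"
  shows "open (overlap c d)"
proof -
  have "openin (subtopology T (fst c)) (fst c \<inter> fst d)"
    using chart_domain_open[OF M d] by (metis Int_commute openin_subtopology_Int)
  then have "openin (top_of_set (chart_image c)) (overlap c d)"
    using homeomorphic_imp_open_map[OF chart_homeomorphic[OF M c]]
    by (simp add: overlap_def open_map_def)
  then show ?thesis using openin_open_trans chart_image_open[OF M c] by blast
qed

lemma overlap_subset: "overlap c d \<subseteq> chart_image c"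
  by (auto simp: overlap_def chart_image_def)

lemma transition_overlap:
  assumes "smooth_manifold T A" "c \<in> A" "x \<in> overlap c d"
  shows "transition c d x \<in> overlap d c"
  using assms by (auto simp: overlap_def transition_snd)

lemma transition_transition:
  assumes "smooth_manifold T A" "c \<in> A" "d \<in> A" "x \<in> overlap c d"
  shows "transition d c (transition c d x) = x"
  using assms by (auto simp: overlap_def transition_snd)

text \<open>The chain rule for the two mutually inverse transitions gives a right inverse.\<close>

lemma surj_dtransition:
  assumes M: "smooth_manifold T A" and c: "c \<in> A" and d: "d \<in> A" and x: "x \<in> overlap c d"
  shows "surj (dtransition c d x)"
proof -
  let ?y = "transition c d x"
  have y: "?y \<in> overlap d c" by (rule transition_overlap[OF M c x])
  have sm: "smooth_on (overlap c d) (transition c d)" "smooth_on (overlap d c) (transition d c)"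
    using M c d by (auto simp: smooth_manifold_def)
  have dx: "(transition c d has_derivative dtransition c d x) (at (transition d c ?y))"
    unfolding transition_transition[OF M c d x] dtransition_def
    by (rule smooth_on_has_derivative[OF sm(1) x])
  have "((\<lambda>z. transition c d (transition d c z)) has_derivative
      (\<lambda>v. dtransition c d x (dtransition d c ?y v))) (at ?y)"
    using has_derivative_compose[OF smooth_on_has_derivative[OF sm(2) y] dx]
    by (simp add: dtransition_def)
  then have "((\<lambda>z. z) has_derivative (\<lambda>v. dtransition c d x (dtransition d c ?y v))) (at ?y)"
    by (rule has_derivative_transform_within_open[OF _ open_overlap[OF M d c] y])
      (rule transition_transition[OF M d c])
  then have "(\<lambda>v. dtransition c d x (dtransition d c ?y v)) = (\<lambda>v. v)"
    using has_derivative_unique[OF _ has_derivative_ident] by blast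
  then show ?thesis by (metis surjI)
qed

lemma kaehler_chart_of_manifold:
  assumes K: "kaehler_manifold T A g J \<Gamma>" and c: "c \<in> A"
  shows "kaehler_chart (chart_image c) (g c) (J c) (\<Gamma> c)"
proof -
  note K' = K[unfolded kaehler_manifold_def]
  have LC: "covd (\<Gamma> c) X Y x - covd (\<Gamma> c) Y X x = lie_bracket X Y x"
    "frechet_derivative (\<lambda>y. g c y (Y y) (Z y)) (at x) (X x) =
      g c x (covd (\<Gamma> c) X Y x) (Z x) + g c x (Y x) (covd (\<Gamma> c) X Z x)"
    if "x \<in> chart_image c" "smooth_on (chart_image c) X" "smooth_on (chart_image c) Y"
      "smooth_on (chart_image c) Z" for X Y Z x
    using K' c that unfolding levi_civita_def by blast+
  have PJ: "covd (\<Gamma> c) X (\<lambda>y. J c y (Y y)) x = J c x (covd (\<Gamma> c) X Y x)"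
    if "x \<in> chart_image c" "smooth_on (chart_image c) X" "smooth_on (chart_image c) Y" for X Y x
    using K' c that by blast
  have "riemannian_metric A g" "almost_complex A J" "affine_connection A \<Gamma>"
    using K' by (auto simp: levi_civita_def)
  note g = this(1)[unfolded riemannian_metric_def, THEN conjunct1, rule_format, OF c]
    and J = this(2)[unfolded almost_complex_def, THEN conjunct1, rule_format, OF c]
    and \<Gamma> = this(3)[unfolded affine_connection_def, THEN conjunct1, rule_format, OF c]
  have GJ: "g c x (J c x u) (J c x v) = g c x u v" if "x \<in> chart_image c" for x u v
    using K' c that by blast
  show ?thesis
  proof (rule kaehler_chart.intro)
    show "open (chart_image c)" using K' c by (simp add: smooth_manifold_def)
    fix x u v w assume x: "x \<in> chart_image c"
    show "\<Gamma> c x u v = \<Gamma> c x v u"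
      using LC(1)[OF x smooth_on_const smooth_on_const smooth_on_const, of u v]
      by (simp add: covd_def lie_bracket_def)
    show "frechet_derivative (\<lambda>y. g c y v w) (at x) u = g c x (\<Gamma> c x u v) w + g c x v (\<Gamma> c x u w)"
      using LC(2)[OF x smooth_on_const smooth_on_const smooth_on_const, of v w u]
      by (simp add: covd_def)
    show "frechet_derivative (\<lambda>y. J c y v) (at x) u + \<Gamma> c x u (J c x v) = J c x (\<Gamma> c x u v)"
      using PJ[OF x smooth_on_const smooth_on_const, of u v] by (simp add: covd_def)
  qed (use g J \<Gamma> GJ in auto)
qed

lemma kaehler_chart_change_of_manifold:
  assumes K: "kaehler_manifold T A g J \<Gamma>" and c: "c \<in> A" and d: "d \<in> A"
  shows "kaehler_chart_change (chart_image c) (chart_image d) (g c) (J c) (\<Gamma> c) (g d) (J d) (\<Gamma> d)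
    (overlap c d) (transition c d) (dtransition c d)"
proof -
  note K' = K[unfolded kaehler_manifold_def]
  have M: "smooth_manifold T A" using K' by blast
  interpret kaehler_chart "chart_image c" "g c" "J c" "\<Gamma> c"
    by (rule kaehler_chart_of_manifold[OF K c])
  interpret target: kaehler_chart "chart_image d" "g d" "J d" "\<Gamma> d"
    by (rule kaehler_chart_of_manifold[OF K d])
  show ?thesis
  proof
    show "open (overlap c d)" by (rule open_overlap[OF M c d])
    show "overlap c d \<subseteq> chart_image c" by (rule overlap_subset)
    show "smooth_on (overlap c d) (transition c d)" using M c d by (simp add: smooth_manifold_def)
    show "dtransition c d x = frechet_derivative (transition c d) (at x)" for x
      by (rule dtransition_def)
    fix x assume x: "x \<in> overlap c d"
    show "transition c d x \<in> chart_image d"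
      using transition_overlap[OF M c x] overlap_subset[of d c] by auto
    show "surj (dtransition c d x)" by (rule surj_dtransition[OF M c d x])
    show "dtransition c d x (\<Gamma> c x u v) = frechet_derivative (\<lambda>y. dtransition c d y v) (at x) u +
        \<Gamma> d (transition c d x) (dtransition c d x u) (dtransition c d x v)" for u v
    proof -
      have "affine_connection A \<Gamma>" using K' by (simp add: levi_civita_def)
      from this[unfolded affine_connection_def, THEN conjunct2, rule_format, OF c d x]
      show ?thesis .
    qed
    have "riemannian_metric A g" "almost_complex A J" using K' by auto
    note g = this(1)[unfolded riemannian_metric_def, THEN conjunct2, rule_format, OF c d x]
      and J = this(2)[unfolded almost_complex_def, THEN conjunct2, rule_format, OF c d x]
    show "g d (transition c d x) (dtransition c d x u) (dtransition c d x v) = g c x u v" for u v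
      by (rule g)
    show "J d (transition c d x) (dtransition c d x u) = dtransition c d x (J c x u)" for u
      by (rule J)
  qed
qed

theorem proposition5p1:
  fixes T :: "'m topology"
    and A :: "('m, 'e::euclidean_space) chart set"
    and g :: "('m, 'e) chart \<Rightarrow> 'e \<Rightarrow> 'e \<Rightarrow> 'e \<Rightarrow> real"
    and J :: "('m, 'e) chart \<Rightarrow> 'e \<Rightarrow> 'e \<Rightarrow> 'e"
    and \<Gamma> :: "('m, 'e) chart \<Rightarrow> 'e \<Rightarrow> 'e \<Rightarrow> 'e \<Rightarrow> 'e"
    and n :: nat
  assumes "DIM('e) = 2 * n" and "2 * n \<ge> 6"
    and "bochner_kaehler T A g J \<Gamma> n"
    and "\<And>c x. c \<in> A \<Longrightarrow> x \<in> chart_image c \<Longrightarrow>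
           frechet_derivative (scal (g c) (\<Gamma> c)) (at x) \<noteq> (\<lambda>v. 0)"
    and "scalar_B0 T A g J \<Gamma>"
  shows "quasi_constant_hsc A g J \<Gamma> (\<lambda>c. scalar_distribution (g c) (J c) (\<Gamma> c)) \<and>
    (\<forall>c\<in>A. \<forall>x\<in>chart_image c.
       (\<forall>X Y Z. riem (\<Gamma> c) x X Y Z =
          coeff_a n (g c) (J c) (\<Gamma> c) x *\<^sub>R pi_tensor (g c) (J c) x X Y Z +
          coeff_b n (g c) (J c) (\<Gamma> c) x *\<^sub>R Phi_tensor (g c) (J c) (\<Gamma> c) x X Y Z) \<and>
       coeff_b n (g c) (J c) (\<Gamma> c) x \<noteq> 0)"
proof -
  have K: "kaehler_manifold T A g J \<Gamma>" using assms(3) by (simp add: bochner_kaehler_def)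
  have M: "smooth_manifold T A" using K by (simp add: kaehler_manifold_def)
  obtain k p :: "'m \<Rightarrow> real" where B0: "\<And>c x. c \<in> A \<Longrightarrow> x \<in> chart_image c \<Longrightarrow>
    (\<forall>x0\<in>scalar_distribution (g c) (J c) (\<Gamma> c) x.
       covd (\<Gamma> c) (\<lambda>_. x0) (xi (g c) (\<Gamma> c)) x = (k (chart_inv c x) / 2) *\<^sub>R x0) \<and>
    covd (\<Gamma> c) (\<lambda>y. J c y (xi (g c) (\<Gamma> c) y)) (xi (g c) (\<Gamma> c)) x =
      - p (chart_inv c x) *\<^sub>R J c x (xi (g c) (\<Gamma> c) x) \<and>
    covd (\<Gamma> c) (xi (g c) (\<Gamma> c)) (xi (g c) (\<Gamma> c)) x = 0"
    using assms(5) unfolding scalar_B0_def Let_def by blast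
  have SC: "scalar_chart (chart_image c) (g c) (J c) (\<Gamma> c) n
      (\<lambda>x. k (chart_inv c x) / 2) (\<lambda>x. p (chart_inv c x))" if c: "c \<in> A" for c
  proof -
    interpret kaehler_chart "chart_image c" "g c" "J c" "\<Gamma> c"
      by (rule kaehler_chart_of_manifold[OF K c])
    show ?thesis
    proof
      show "bochner_at (g c) (J c) (\<Gamma> c) n x" if "x \<in> chart_image c" for x
        using assms(3) c that unfolding bochner_kaehler_def bochner_at_def by blast
    qed (use assms(1,2,4) B0 c in blast)+
  qed
  note change = kaehler_chart_change_of_manifold[OF K]
  \<comment> \<open>The function \<open>F\<close> has to live on points of the manifold, so
    \<open>a\<close> and \<open>b\<close> are read in an arbitrarily chosen chart at each point;
    \<open>coeff_change\<close> makes the choice immaterial.\<close>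
  define ch where "ch m = (SOME d. d \<in> A \<and> m \<in> fst d)" for m
  define a where "a m = (let d = ch m in coeff_a n (g d) (J d) (\<Gamma> d) (snd d m))" for m
  define b where "b m = (let d = ch m in coeff_b n (g d) (J d) (\<Gamma> d) (snd d m))" for m
  have ab: "a (chart_inv c x) = coeff_a n (g c) (J c) (\<Gamma> c) x" "b (chart_inv c x) = coeff_b n (g c) (J c) (\<Gamma> c) x"
    if c: "c \<in> A" and x: "x \<in> chart_image c" for c x
  proof -
    obtain m where m: "m \<in> fst c" "x = snd c m" using x by (auto simp: chart_image_def)
    define d where "d = ch m"
    have d: "d \<in> A" "m \<in> fst d"
      unfolding d_def ch_def using someI[of "\<lambda>d. d \<in> A \<and> m \<in> fst d" c] c m by auto
    have "x \<in> overlap c d" using m d by (auto simp: overlap_def)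
    note kaehler_chart_change.coeff_change[OF change[OF c d(1)] this, of n]
    then show "a (chart_inv c x) = coeff_a n (g c) (J c) (\<Gamma> c) x"
      "b (chart_inv c x) = coeff_b n (g c) (J c) (\<Gamma> c) x"
      using transition_snd[OF M c m(1)] chart_inv_snd[OF M c m(1)]
      by (simp_all add: a_def b_def d_def[symmetric] m(2))
  qed
  have "quasi_constant_hsc A g J \<Gamma> (\<lambda>c. scalar_distribution (g c) (J c) (\<Gamma> c))"
    unfolding quasi_constant_hsc_def codim2_distribution_def
  proof (intro conjI ballI exI[of _ "\<lambda>m \<theta>. a m + b m * (cos \<theta>)\<^sup>2"] allI impI)
    fix c x assume c: "c \<in> A" and x: "x \<in> chart_image c"
    note sc = SC[OF c]
    show "subspace (scalar_distribution (g c) (J c) (\<Gamma> c) x)"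
      by (rule scalar_chart.subspace_scalar_distribution[OF sc x])
    show "dim (scalar_distribution (g c) (J c) (\<Gamma> c) x) + 2 = DIM('e)"
      by (rule scalar_chart.dim_scalar_distribution[OF sc x])
    show "\<exists>V w1 w2. open V \<and> x \<in> V \<and> V \<subseteq> chart_image c \<and>
       (\<forall>v. smooth_on V (\<lambda>y. w1 y v) \<and> smooth_on V (\<lambda>y. w2 y v)) \<and>
       (\<forall>y\<in>V. linear (w1 y) \<and> linear (w2 y) \<and>
          scalar_distribution (g c) (J c) (\<Gamma> c) y = {v. w1 y v = (0::real) \<and> w2 y v = (0::real)})"
      by (rule scalar_chart.scalar_distribution_forms[OF sc x])
    show "J c x ` scalar_distribution (g c) (J c) (\<Gamma> c) x \<subseteq> scalar_distribution (g c) (J c) (\<Gamma> c) x"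
      by (rule scalar_chart.J_scalar_distribution[OF sc x])
    show "sectional_curvature (g c) (\<Gamma> c) x u v = a (chart_inv c x) + b (chart_inv c x) *
        (cos (subspace_angle (g c) x (span {u, v})
          (orth_compl (g c) x (scalar_distribution (g c) (J c) (\<Gamma> c) x))))\<^sup>2"
      if "holomorphic_section (J c) x (span {u, v})" for u v
      unfolding ab[OF c x] by (rule scalar_chart.sectional_curvature_angle[OF sc x that])
  next
    fix c d x assume "c \<in> A" "d \<in> A" "x \<in> overlap c d"
    then show "scalar_distribution (g d) (J d) (\<Gamma> d) (transition c d x) =
        dtransition c d x ` scalar_distribution (g c) (J c) (\<Gamma> c) x"
      by (rule kaehler_chart_change.scalar_distribution_change[OF change])
  qed
  then show ?thesis
    using scalar_chart.riem_pi_Phi[OF SC] scalar_chart.coeff_b_nonzero[OF SC] by blast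
qed

end
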